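(* Let $(A,S_A,\alpha_A)$ and $(H,S_H,\alpha_H)$ be Hom-Hopf algebras (with bijective structure maps $\alpha_A,\alpha_H$). Assume that $A$ is a left $H$-module Hom-algebra with action $H\otimes A\to A$, $h\otimes a\mapsto h\cdot a$, and that $H$ is a right $A$-comodule Hom-coalgebra with coaction $H\to H\otimes A$, $h\mapsto h_{(0)}\otimes h_{(1)}$. Suppose that: (1) for all $h\in H$, $b\in A$, $$\Delta(h\cdot b)=\alpha_H^{-1}(h_{1(0)})\cdot b_1\otimes \alpha_A^{-1}(h_{1(1)})\big(\alpha_H^{-1}(h_2)\cdot\alpha_A^{-1}(b_2)\big),\qquad \varepsilon_A(h\cdot b)=\varepsilon_A(b)\varepsilon_H(h);$$ (2) for all $h,g\in H$, $$(hg)_{(0)}\otimes(hg)_{(1)}=\alpha_H^{-1}(h_{1(0)})g_{(0)}\otimes\alpha_A^{-1}(h_{1(1)})\big(\alpha_H^{-1}(h_2)\cdot\alpha_A^{-1}(g_{(1)})\big);$$ (3) for all $h\in H$, $b\in A$, $$h_{2(0)}\otimes(h_1\cdot b)h_{2(1)}=h_{1(0)}\otimes h_{1(1)}(h_2\cdot b).$$ Then $(A\otimes H,\alpha_A\otimes\alpha_H)$ is a Hom-Hopf algebra, with unit $1_A\otimes 1_H$ and counit $\varepsilon_A\otimes\varepsilon_H$, under the multiplication $$(a\otimes h)(b\otimes g)=a\big(\alpha_H^{-2}(h_1)\cdot\alpha_A^{-1}(b)\big)\otimes\alpha_H^{-1}(h_2)g,$$ the comultiplication $$\Delta(a\otimes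 h)=a_1\otimes\alpha_H^{-1}(h_{1(0)})\otimes\alpha_A^{-1}(a_2)\alpha_A^{-2}(h_{1(1)})\otimes h_2,$$ and the antipode $$S(a\otimes h)=\big(1\otimes S_H(\alpha_H^{-2}(h_{(0)}))\big)\big(S_A(\alpha_A^{-2}(a)\alpha_A^{-3}(h_{(1)}))\otimes 1\big),$$ for all $a,b\in A$, $h,g\in H$.
   Context: Everything is over a fixed field $k$. Sweedler notation $\Delta(c)=c_1\otimes c_2$, iterated as $\Delta(c_1)=c_{11}\otimes c_{12}$ etc., is used with summation omitted; $h_{1(0)}\otimes h_{1(1)}$ denotes the coaction applied to $h_1$. A (unital) Hom-associative algebra is $(A,\mu,\alpha)$ with $\alpha:A\to A$, $\mu(a\otimes b)=ab$ linear and $1_A\in A$ such that $\alpha(ab)=\alpha(a)\alpha(b)$, $\alpha(1_A)=1_A$, $1_Aa=\alpha(a)=a1_A$, $\alpha(a)(bc)=(ab)\alpha(c)$. A (counital) Hom-coassociative coalgebra is $(C,\Delta,\varepsilon,\alpha)$ with $\varepsilon\circ\alpha=\varepsilon$, $(\alpha\otimes\alpha)\Delta=\Delta\alpha$, $(\varepsilon\otimes id)\Delta=\alpha=(id\otimes\varepsilon)\Delta$, $(\Delta\otimes\alpha)\Delta=(\alpha\otimes\Delta)\Delta$. A Hom-bialgebra $(H,\mu,\Delta,\alpha)$ is both, with the same $\alpha$, such that $\Delta$ and $\varepsilon$ are unital and multiplicative ($H\otimes H$ has the componentwise product). A Hom-Hopf algebra is a Hom-bialgebra with a linear map $S$ (antipode)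 such that $S\alpha=\alpha S$ and $S(h_1)h_2=h_1S(h_2)=\varepsilon(h)1$. A left $A$-module is $(M,\alpha_M)$ with $a\otimes m\mapsto a\cdot m$ such that $1_A\cdot m=\alpha_M(m)$, $\alpha_M(a\cdot m)=\alpha_A(a)\cdot\alpha_M(m)$, $\alpha_A(a)\cdot(b\cdot m)=(ab)\cdot\alpha_M(m)$. A right $C$-comodule is $(M,\alpha_M)$ with $\rho:M\to M\otimes C$ such that $(id\otimes\varepsilon_C)\rho=\alpha_M$, $(\alpha_M\otimes\alpha_C)\rho=\rho\alpha_M$, $(\rho\otimes\alpha_C)\rho=(\alpha_M\otimes\Delta)\rho$. $(A,\alpha_A)$, a Hom-associative algebra, is a left $H$-module Hom-algebra if it is a left $H$-module with $\alpha_H^2(h)\cdot(ab)=(h_1\cdot a)(h_2\cdot b)$ and $h\cdot 1_A=\varepsilon(h)1_A$. A Hom-coassociative coalgebra $(C,\alpha_C)$ is a right $H$-comodule Hom-coalgebra (for a Hom-bialgebra $H$) if it is a right $H$-comodule, $c\mapsto c_{(0)}\otimes c_{(1)}$, with $\varepsilon_C(c_{(0)})c_{(1)}=\varepsilon_C(c)1_H$ and $c_{(0)1}\otimes c_{(0)2}\otimes\alpha_H^2(c_{(1)})=c_{1(0)}\otimes c_{2(0)}\otimes c_{1(1)}c_{2(1)}$. *)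

theory Defs
  imports "HOL-Algebra.Module" "HOL-Algebra.AbelCoset"
begin

section \<open>Linear and bilinear maps\<close>

text \<open>
  A vector space over the ground field is a \<^locale>\<open>module\<close> over a \<^locale>\<open>field\<close>.  Maps are total
  HOL functions whose values matter on the carriers only.
\<close>

definition linear_map ::
  "('k, 'r) ring_scheme \<Rightarrow> ('k, 'a, 'm) module_scheme \<Rightarrow> ('k, 'b, 'n) module_scheme \<Rightarrow> ('a \<Rightarrow> 'b) \<Rightarrow> bool"
where
  "linear_map K V W f \<longleftrightarrow>
     f \<in> carrier V \<rightarrow> carrier W \<and>
     (\<forall>x\<in>carrier V. \<forall>y\<in>carrier V. f (x \<oplus>\<^bsub>V\<^esub> y) = f x \<oplus>\<^bsub>W\<^esub> f y) \<and>
     (\<forall>r\<in>carrier K. \<forall>x\<in>carrier V. f (r \<odot>\<^bsub>V\<^esub> x) = r \<odot>\<^bsub>W\<^esub> f x)"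

definition bilinear_map ::
  "('k, 'r) ring_scheme \<Rightarrow> ('k, 'a, 'm) module_scheme \<Rightarrow> ('k, 'b, 'n) module_scheme
    \<Rightarrow> ('k, 'c, 'p) module_scheme \<Rightarrow> ('a \<Rightarrow> 'b \<Rightarrow> 'c) \<Rightarrow> bool"
where
  "bilinear_map K V W U f \<longleftrightarrow>
     (\<forall>x\<in>carrier V. linear_map K W U (\<lambda>y. f x y)) \<and>
     (\<forall>y\<in>carrier W. linear_map K V U (\<lambda>x. f x y))"

definition scalars :: "('k, 'r) ring_scheme \<Rightarrow> ('k, 'k) module" where
  "scalars K =
     \<lparr> carrier = carrier K, mult = mult K, one = \<one>\<^bsub>K\<^esub>, zero = \<zero>\<^bsub>K\<^esub>, add = add K, smult = mult K \<rparr>"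


section \<open>Tensor products\<close>

text \<open>
  The tensor product of \<open>V\<close> and \<open>W\<close> is the free vector space on \<open>carrier V \<times> carrier W\<close> modulo the
  subspace generated by the bilinearity relations; its elements are cosets.  The record fields
  \<^const>\<open>mult\<close> and \<^const>\<open>one\<close> are not part of a vector space and are left \<^const>\<open>undefined\<close>.
\<close>

definition free_space :: "('k, 'r) ring_scheme \<Rightarrow> 'x set \<Rightarrow> ('k, 'x \<Rightarrow> 'k) module" where
  "free_space K X =
     \<lparr> carrier = {p. range p \<subseteq> carrier K \<and> finite {x. p x \<noteq> \<zero>\<^bsub>K\<^esub>} \<and> {x. p x \<noteq> \<zero>\<^bsub>K\<^esub>} \<subseteq> X},
       mult = undefined,
       one = undefined,
       zero = (\<lambda>_. \<zero>\<^bsub>K\<^esub>),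
       add = (\<lambda>p q x. p x \<oplus>\<^bsub>K\<^esub> q x),
       smult = (\<lambda>r p x. r \<otimes>\<^bsub>K\<^esub> p x) \<rparr>"

definition basis_vec :: "('k, 'r) ring_scheme \<Rightarrow> 'x \<Rightarrow> 'x \<Rightarrow> 'k" where
  "basis_vec K x = (\<lambda>y. if y = x then \<one>\<^bsub>K\<^esub> else \<zero>\<^bsub>K\<^esub>)"

definition tensor_relators ::
  "('k, 'r) ring_scheme \<Rightarrow> ('k, 'a, 'm) module_scheme \<Rightarrow> ('k, 'b, 'n) module_scheme \<Rightarrow> ('a \<times> 'b \<Rightarrow> 'k) set"
where
  "tensor_relators K V W =
     (let F = free_space K (carrier V \<times> carrier W); e = basis_vec K in
       {e (x \<oplus>\<^bsub>V\<^esub> x', y) \<ominus>\<^bsub>F\<^esub> (e (x, y) \<oplus>\<^bsub>F\<^esub> e (x', y)) | x x' y.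
          x \<in> carrier V \<and> x' \<in> carrier V \<and> y \<in> carrier W} \<union>
       {e (x, y \<oplus>\<^bsub>W\<^esub> y') \<ominus>\<^bsub>F\<^esub> (e (x, y) \<oplus>\<^bsub>F\<^esub> e (x, y')) | x y y'.
          x \<in> carrier V \<and> y \<in> carrier W \<and> y' \<in> carrier W} \<union>
       {e (r \<odot>\<^bsub>V\<^esub> x, y) \<ominus>\<^bsub>F\<^esub> r \<odot>\<^bsub>F\<^esub> e (x, y) | r x y.
          r \<in> carrier K \<and> x \<in> carrier V \<and> y \<in> carrier W} \<union>
       {e (x, r \<odot>\<^bsub>W\<^esub> y) \<ominus>\<^bsub>F\<^esub> r \<odot>\<^bsub>F\<^esub> e (x, y) | r x y.
          r \<in> carrier K \<and> x \<in> carrier V \<and> y \<in> carrier W})"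

definition tensor_kernel ::
  "('k, 'r) ring_scheme \<Rightarrow> ('k, 'a, 'm) module_scheme \<Rightarrow> ('k, 'b, 'n) module_scheme \<Rightarrow> ('a \<times> 'b \<Rightarrow> 'k) set"
where
  "tensor_kernel K V W =
     \<Inter> {N. submodule N K (free_space K (carrier V \<times> carrier W)) \<and> tensor_relators K V W \<subseteq> N}"

definition tensor ::
  "('k, 'r) ring_scheme \<Rightarrow> ('k, 'a, 'm) module_scheme \<Rightarrow> ('k, 'b, 'n) module_scheme
    \<Rightarrow> ('k, ('a \<times> 'b \<Rightarrow> 'k) set) module"
where
  "tensor K V W =
     (let F = free_space K (carrier V \<times> carrier W); N = tensor_kernel K V W in
       \<lparr> carrier = a_rcosets\<^bsub>F\<^esub> N,
         mult = undefined,
         one = undefined,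
         zero = N,
         add = set_add F,
         smult = (\<lambda>r t. \<Union>p\<in>t. N +>\<^bsub>F\<^esub> (r \<odot>\<^bsub>F\<^esub> p)) \<rparr>)"

text \<open>The pure tensor \<open>v \<otimes> w\<close> in \<open>V \<otimes> W\<close>.\<close>

definition pure ::
  "('k, 'r) ring_scheme \<Rightarrow> ('k, 'a, 'm) module_scheme \<Rightarrow> ('k, 'b, 'n) module_scheme
    \<Rightarrow> 'a \<Rightarrow> 'b \<Rightarrow> ('a \<times> 'b \<Rightarrow> 'k) set"
where
  "pure K V W v w = tensor_kernel K V W +>\<^bsub>free_space K (carrier V \<times> carrier W)\<^esub> basis_vec K (v, w)"

text \<open>
  Sweedler notation: if \<open>t\<close> is the class of \<open>\<Sum>\<^sub>i r\<^sub>i (v\<^sub>i, w\<^sub>i)\<close>, then \<open>sweedler K U t f\<close> is the element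
  \<open>\<Sum>\<^sub>i r\<^sub>i f(v\<^sub>i, w\<^sub>i)\<close> of \<open>U\<close>.  For bilinear \<open>f\<close>, the only kind it is applied to, this does not depend on
  the chosen representative, i.e. \<open>\<lambda>t. sweedler K U t f\<close> is the linear map on \<open>V \<otimes> W\<close> induced by \<open>f\<close>.
\<close>

definition sweedler ::
  "('k, 'r) ring_scheme \<Rightarrow> ('k, 'c, 'm) module_scheme \<Rightarrow> ('a \<times> 'b \<Rightarrow> 'k) set \<Rightarrow> ('a \<Rightarrow> 'b \<Rightarrow> 'c) \<Rightarrow> 'c"
where
  "sweedler K U t f =
     (let p = (SOME p. p \<in> t) in
       \<Oplus>\<^bsub>U\<^esub>z\<in>{z. p z \<noteq> \<zero>\<^bsub>K\<^esub>}. p z \<odot>\<^bsub>U\<^esub> f (fst z) (snd z))"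

text \<open>\<open>tensor_map K V' W' f g\<close> is \<open>f \<otimes> g\<close>, where \<open>V'\<close> and \<open>W'\<close> are the codomains of \<open>f\<close> and \<open>g\<close>.\<close>

definition tensor_map ::
  "('k, 'r) ring_scheme \<Rightarrow> ('k, 'c, 'm) module_scheme \<Rightarrow> ('k, 'd, 'n) module_scheme
    \<Rightarrow> ('a \<Rightarrow> 'c) \<Rightarrow> ('b \<Rightarrow> 'd) \<Rightarrow> ('a \<times> 'b \<Rightarrow> 'k) set \<Rightarrow> ('c \<times> 'd \<Rightarrow> 'k) set"
where
  "tensor_map K V' W' f g t = sweedler K (tensor K V' W') t (\<lambda>v w. pure K V' W' (f v) (g w))"

text \<open>The canonical isomorphism \<open>(U \<otimes> V) \<otimes> W \<cong> U \<otimes> (V \<otimes> W)\<close>, usually suppressed in writing.\<close>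

definition tensor_assoc ::
  "('k, 'r) ring_scheme \<Rightarrow> ('k, 'a, 'm) module_scheme \<Rightarrow> ('k, 'b, 'n) module_scheme
    \<Rightarrow> ('k, 'c, 'p) module_scheme
    \<Rightarrow> (('a \<times> 'b \<Rightarrow> 'k) set \<times> 'c \<Rightarrow> 'k) set \<Rightarrow> ('a \<times> ('b \<times> 'c \<Rightarrow> 'k) set \<Rightarrow> 'k) set"
where
  "tensor_assoc K U V W t =
     sweedler K (tensor K U (tensor K V W)) t (\<lambda>s w.
       sweedler K (tensor K U (tensor K V W)) s (\<lambda>u v.
         pure K U (tensor K V W) u (pure K V W v w)))"

text \<open>\<open>A \<otimes> B\<close> with the componentwise product.\<close>

definition tensor_alg ::
  "('k, 'r) ring_scheme \<Rightarrow> ('k, 'a, 'm) module_scheme \<Rightarrow> ('k, 'b, 'n) module_scheme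
    \<Rightarrow> ('k, ('a \<times> 'b \<Rightarrow> 'k) set) module"
where
  "tensor_alg K A B = (tensor K A B)
     \<lparr> mult := (\<lambda>s t. sweedler K (tensor K A B) s (\<lambda>a b. sweedler K (tensor K A B) t (\<lambda>a' b'.
         pure K A B (a \<otimes>\<^bsub>A\<^esub> a') (b \<otimes>\<^bsub>B\<^esub> b')))),
       one := pure K A B \<one>\<^bsub>A\<^esub> \<one>\<^bsub>B\<^esub> \<rparr>"


section \<open>Hom-structures\<close>

text \<open>
  The fields \<^const>\<open>mult\<close> and \<^const>\<open>one\<close> of the underlying record serve as the multiplication and the
  unit of a Hom-associative algebra; they are ignored when only the vector space matters.
\<close>

record ('k, 'a) hom_module = "('k, 'a) module" +
  alpha :: "'a \<Rightarrow> 'a"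

record ('k, 'a) hom_coalg = "('k, 'a) hom_module" +
  comult :: "'a \<Rightarrow> ('a \<times> 'a \<Rightarrow> 'k) set"
  counit :: "'a \<Rightarrow> 'k"

record ('k, 'a) hom_hopf = "('k, 'a) hom_coalg" +
  antipode :: "'a \<Rightarrow> 'a"

text \<open>The inverse of a bijective structure map; \<open>(ainv V ^^ n)\<close> is \<open>\<alpha>\<^sup>-\<^sup>n\<close>.\<close>

definition ainv :: "('k, 'a, 'm) hom_module_scheme \<Rightarrow> 'a \<Rightarrow> 'a" where
  "ainv V = inv_into (carrier V) (alpha V)"

locale hom_space = field K + module K V
  for K :: "('k, 'r) ring_scheme" and V :: "('k, 'a, 'm) hom_module_scheme" +
  assumes alpha_linear: "linear_map K V V (alpha V)"

locale hom_assoc_algebra = hom_space K A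
  for K :: "('k, 'r) ring_scheme" and A :: "('k, 'a, 'm) hom_module_scheme" +
  assumes mult_bilinear: "bilinear_map K A A A (mult A)"
    and unit_closed: "\<one>\<^bsub>A\<^esub> \<in> carrier A"
    and alpha_mult: "\<lbrakk>a \<in> carrier A; b \<in> carrier A\<rbrakk> \<Longrightarrow>
          alpha A (a \<otimes>\<^bsub>A\<^esub> b) = alpha A a \<otimes>\<^bsub>A\<^esub> alpha A b"
    and alpha_one: "alpha A \<one>\<^bsub>A\<^esub> = \<one>\<^bsub>A\<^esub>"
    and one_mult: "a \<in> carrier A \<Longrightarrow> \<one>\<^bsub>A\<^esub> \<otimes>\<^bsub>A\<^esub> a = alpha A a"
    and mult_one: "a \<in> carrier A \<Longrightarrow> a \<otimes>\<^bsub>A\<^esub> \<one>\<^bsub>A\<^esub> = alpha A a"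
    and hom_assoc: "\<lbrakk>a \<in> carrier A; b \<in> carrier A; c \<in> carrier A\<rbrakk> \<Longrightarrow>
          alpha A a \<otimes>\<^bsub>A\<^esub> (b \<otimes>\<^bsub>A\<^esub> c) = (a \<otimes>\<^bsub>A\<^esub> b) \<otimes>\<^bsub>A\<^esub> alpha A c"

locale hom_coassoc_coalgebra = hom_space K C
  for K :: "('k, 'r) ring_scheme" and C :: "('k, 'c, 'm) hom_coalg_scheme" +
  assumes comult_linear: "linear_map K C (tensor K C C) (comult C)"
    and counit_linear: "linear_map K C (scalars K) (counit C)"
    and counit_alpha: "c \<in> carrier C \<Longrightarrow> counit C (alpha C c) = counit C c"
    and alpha_comult: "c \<in> carrier C \<Longrightarrow>
          tensor_map K C C (alpha C) (alpha C) (comult C c) = comult C (alpha C c)"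
    and counit_left: "c \<in> carrier C \<Longrightarrow>
          sweedler K C (comult C c) (\<lambda>c1 c2. counit C c1 \<odot>\<^bsub>C\<^esub> c2) = alpha C c"
    and counit_right: "c \<in> carrier C \<Longrightarrow>
          sweedler K C (comult C c) (\<lambda>c1 c2. counit C c2 \<odot>\<^bsub>C\<^esub> c1) = alpha C c"
    and hom_coassoc: "c \<in> carrier C \<Longrightarrow>
          tensor_assoc K C C C (tensor_map K (tensor K C C) C (comult C) (alpha C) (comult C c)) =
          tensor_map K C (tensor K C C) (alpha C) (comult C) (comult C c)"

locale hom_bialgebra = hom_assoc_algebra K H + hom_coassoc_coalgebra K H
  for K :: "('k, 'r) ring_scheme" and H :: "('k, 'h, 'm) hom_coalg_scheme" +
  assumes comult_mult: "\<lbrakk>h \<in> carrier H; g \<in> carrier H\<rbrakk> \<Longrightarrow>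
          comult H (h \<otimes>\<^bsub>H\<^esub> g) = comult H h \<otimes>\<^bsub>tensor_alg K H H\<^esub> comult H g"
    and comult_one: "comult H \<one>\<^bsub>H\<^esub> = \<one>\<^bsub>tensor_alg K H H\<^esub>"
    and counit_mult: "\<lbrakk>h \<in> carrier H; g \<in> carrier H\<rbrakk> \<Longrightarrow>
          counit H (h \<otimes>\<^bsub>H\<^esub> g) = counit H h \<otimes>\<^bsub>K\<^esub> counit H g"
    and counit_one: "counit H \<one>\<^bsub>H\<^esub> = \<one>\<^bsub>K\<^esub>"

locale hom_hopf_algebra = hom_bialgebra K H
  for K :: "('k, 'r) ring_scheme" and H :: "('k, 'h, 'm) hom_hopf_scheme" +
  assumes antipode_linear: "linear_map K H H (antipode H)"
    and antipode_alpha: "h \<in> carrier H \<Longrightarrow> antipode H (alpha H h) = alpha H (antipode H h)"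
    and antipode_left: "h \<in> carrier H \<Longrightarrow>
          sweedler K H (comult H h) (\<lambda>h1 h2. antipode H h1 \<otimes>\<^bsub>H\<^esub> h2) = counit H h \<odot>\<^bsub>H\<^esub> \<one>\<^bsub>H\<^esub>"
    and antipode_right: "h \<in> carrier H \<Longrightarrow>
          sweedler K H (comult H h) (\<lambda>h1 h2. h1 \<otimes>\<^bsub>H\<^esub> antipode H h2) = counit H h \<odot>\<^bsub>H\<^esub> \<one>\<^bsub>H\<^esub>"

locale left_hom_module = A: hom_assoc_algebra K A + M: hom_space K M
  for K :: "('k, 'r) ring_scheme" and A :: "('k, 'a, 'm) hom_module_scheme"
    and M :: "('k, 'x, 'n) hom_module_scheme" and act :: "'a \<Rightarrow> 'x \<Rightarrow> 'x" +
  assumes act_bilinear: "bilinear_map K A M M act"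
    and one_act: "m \<in> carrier M \<Longrightarrow> act \<one>\<^bsub>A\<^esub> m = alpha M m"
    and alpha_act: "\<lbrakk>a \<in> carrier A; m \<in> carrier M\<rbrakk> \<Longrightarrow>
          alpha M (act a m) = act (alpha A a) (alpha M m)"
    and act_assoc: "\<lbrakk>a \<in> carrier A; b \<in> carrier A; m \<in> carrier M\<rbrakk> \<Longrightarrow>
          act (alpha A a) (act b m) = act (a \<otimes>\<^bsub>A\<^esub> b) (alpha M m)"

locale right_hom_comodule = C: hom_coassoc_coalgebra K C + M: hom_space K M
  for K :: "('k, 'r) ring_scheme" and C :: "('k, 'c, 'm) hom_coalg_scheme"
    and M :: "('k, 'x, 'n) hom_module_scheme" and coact :: "'x \<Rightarrow> ('x \<times> 'c \<Rightarrow> 'k) set" +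
  assumes coact_linear: "linear_map K M (tensor K M C) coact"
    and coact_counit: "m \<in> carrier M \<Longrightarrow>
          sweedler K M (coact m) (\<lambda>m0 m1. counit C m1 \<odot>\<^bsub>M\<^esub> m0) = alpha M m"
    and alpha_coact: "m \<in> carrier M \<Longrightarrow>
          tensor_map K M C (alpha M) (alpha C) (coact m) = coact (alpha M m)"
    and coact_coassoc: "m \<in> carrier M \<Longrightarrow>
          tensor_assoc K M C C (tensor_map K (tensor K M C) C coact (alpha C) (coact m)) =
          tensor_map K M (tensor K C C) (alpha M) (comult C) (coact m)"

locale left_module_hom_algebra =
  H: hom_bialgebra K H + A: hom_assoc_algebra K A + left_hom_module K H A act
  for K :: "('k, 'r) ring_scheme" and H :: "('k, 'h, 'm) hom_coalg_scheme"
    and A :: "('k, 'a, 'n) hom_module_scheme" and act :: "'h \<Rightarrow> 'a \<Rightarrow> 'a" +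
  assumes act_mult: "\<lbrakk>h \<in> carrier H; a \<in> carrier A; b \<in> carrier A\<rbrakk> \<Longrightarrow>
          act ((alpha H ^^ 2) h) (a \<otimes>\<^bsub>A\<^esub> b) =
          sweedler K A (comult H h) (\<lambda>h1 h2. act h1 a \<otimes>\<^bsub>A\<^esub> act h2 b)"
    and act_one: "h \<in> carrier H \<Longrightarrow> act h \<one>\<^bsub>A\<^esub> = counit H h \<odot>\<^bsub>A\<^esub> \<one>\<^bsub>A\<^esub>"

locale right_comodule_hom_coalgebra =
  H: hom_bialgebra K H + C: hom_coassoc_coalgebra K C + right_hom_comodule K H C coact
  for K :: "('k, 'r) ring_scheme" and H :: "('k, 'h, 'm) hom_coalg_scheme"
    and C :: "('k, 'c, 'n) hom_coalg_scheme" and coact :: "'c \<Rightarrow> ('c \<times> 'h \<Rightarrow> 'k) set" +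
  assumes counit_coact: "c \<in> carrier C \<Longrightarrow>
          sweedler K H (coact c) (\<lambda>c0 c1. counit C c0 \<odot>\<^bsub>H\<^esub> c1) = counit C c \<odot>\<^bsub>H\<^esub> \<one>\<^bsub>H\<^esub>"
    and comult_coact: "c \<in> carrier C \<Longrightarrow>
          tensor_map K (tensor K C C) H (comult C) (alpha H ^^ 2) (coact c) =
          sweedler K (tensor K (tensor K C C) H) (comult C c) (\<lambda>c1 c2.
            sweedler K (tensor K (tensor K C C) H) (coact c1) (\<lambda>c10 c11.
              sweedler K (tensor K (tensor K C C) H) (coact c2) (\<lambda>c20 c21.
                pure K (tensor K C C) H (pure K C C c10 c20) (c11 \<otimes>\<^bsub>H\<^esub> c21))))"


section \<open>The Hom-structure on \<open>A \<otimes> H\<close>\<close>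

text \<open>
  The operations on \<open>A \<otimes> H\<close> are the linear extensions of their formulas on pure tensors \<open>a \<otimes> h\<close>.
\<close>

definition bicross_mult ::
  "('k, 'r) ring_scheme \<Rightarrow> ('k, 'a, 'm) hom_hopf_scheme \<Rightarrow> ('k, 'h, 'n) hom_hopf_scheme
    \<Rightarrow> ('h \<Rightarrow> 'a \<Rightarrow> 'a) \<Rightarrow> ('a \<times> 'h \<Rightarrow> 'k) set \<Rightarrow> ('a \<times> 'h \<Rightarrow> 'k) set \<Rightarrow> ('a \<times> 'h \<Rightarrow> 'k) set"
where
  "bicross_mult K A H act s t =
     sweedler K (tensor K A H) s (\<lambda>a h.
       sweedler K (tensor K A H) t (\<lambda>b g.
         sweedler K (tensor K A H) (comult H h) (\<lambda>h1 h2.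
           pure K A H
             (a \<otimes>\<^bsub>A\<^esub> act ((ainv H ^^ 2) h1) (ainv A b))
             (ainv H h2 \<otimes>\<^bsub>H\<^esub> g))))"

definition bicross_comult ::
  "('k, 'r) ring_scheme \<Rightarrow> ('k, 'a, 'm) hom_hopf_scheme \<Rightarrow> ('k, 'h, 'n) hom_hopf_scheme
    \<Rightarrow> ('h \<Rightarrow> ('h \<times> 'a \<Rightarrow> 'k) set) \<Rightarrow> ('a \<times> 'h \<Rightarrow> 'k) set
    \<Rightarrow> (('a \<times> 'h \<Rightarrow> 'k) set \<times> ('a \<times> 'h \<Rightarrow> 'k) set \<Rightarrow> 'k) set"
where
  "bicross_comult K A H coact t =
     (let T = tensor K A H; TT = tensor K T T in
       sweedler K TT t (\<lambda>a h.
         sweedler K TT (comult A a) (\<lambda>a1 a2.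
           sweedler K TT (comult H h) (\<lambda>h1 h2.
             sweedler K TT (coact h1) (\<lambda>h10 h11.
               pure K T T
                 (pure K A H a1 (ainv H h10))
                 (pure K A H (ainv A a2 \<otimes>\<^bsub>A\<^esub> (ainv A ^^ 2) h11) h2))))))"

definition bicross_antipode ::
  "('k, 'r) ring_scheme \<Rightarrow> ('k, 'a, 'm) hom_hopf_scheme \<Rightarrow> ('k, 'h, 'n) hom_hopf_scheme
    \<Rightarrow> ('h \<Rightarrow> 'a \<Rightarrow> 'a) \<Rightarrow> ('h \<Rightarrow> ('h \<times> 'a \<Rightarrow> 'k) set) \<Rightarrow> ('a \<times> 'h \<Rightarrow> 'k) set \<Rightarrow> ('a \<times> 'h \<Rightarrow> 'k) set"
where
  "bicross_antipode K A H act coact t =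
     sweedler K (tensor K A H) t (\<lambda>a h.
       sweedler K (tensor K A H) (coact h) (\<lambda>h0 h1.
         bicross_mult K A H act
           (pure K A H \<one>\<^bsub>A\<^esub> (antipode H ((ainv H ^^ 2) h0)))
           (pure K A H (antipode A ((ainv A ^^ 2) a \<otimes>\<^bsub>A\<^esub> (ainv A ^^ 3) h1)) \<one>\<^bsub>H\<^esub>)))"

definition bicross_product ::
  "('k, 'r) ring_scheme \<Rightarrow> ('k, 'a, 'm) hom_hopf_scheme \<Rightarrow> ('k, 'h, 'n) hom_hopf_scheme
    \<Rightarrow> ('h \<Rightarrow> 'a \<Rightarrow> 'a) \<Rightarrow> ('h \<Rightarrow> ('h \<times> 'a \<Rightarrow> 'k) set) \<Rightarrow> ('k, ('a \<times> 'h \<Rightarrow> 'k) set) hom_hopf"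
where
  "bicross_product K A H act coact =
     \<lparr> carrier = carrier (tensor K A H),
       mult = bicross_mult K A H act,
       one = pure K A H \<one>\<^bsub>A\<^esub> \<one>\<^bsub>H\<^esub>,
       zero = zero (tensor K A H),
       add = add (tensor K A H),
       smult = smult (tensor K A H),
       alpha = tensor_map K A H (alpha A) (alpha H),
       comult = bicross_comult K A H coact,
       counit = (\<lambda>t. sweedler K (scalars K) t (\<lambda>a h. counit A a \<otimes>\<^bsub>K\<^esub> counit H h)),
       antipode = bicross_antipode K A H act coact \<rparr>"

end

theory Submission
  imports Defs
begin

text \<open>
  When \<open>\<alpha>\<close> is bijective, a Hom-Hopf algebra is the twist of an ordinary Hopf algebra by the automorphism
  \<open>\<alpha>\<close>: \<open>\<alpha>\<inverse> \<circ> \<mu>\<close> is associative and \<open>\<Delta> \<circ> \<alpha>\<inverse>\<close> coassociative.  Replacing the action by \<open>\<alpha>\<inverse>(h \<cdot> a)\<close> and the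
  coaction by \<open>\<rho> \<circ> \<alpha>\<inverse>\<close> removes all structure maps from the hypotheses, which become those of Majid's
  bicrossproduct theorem for ordinary Hopf algebras.  That theorem is a sequence of computations with
  Sweedler sums, in which both sides are expanded and brought to the same order of summation.  The
  structure on \<open>A \<otimes> H\<close> in question is the twist of the ordinary bicrossproduct by \<open>\<alpha>\<^sub>A \<otimes> \<alpha>\<^sub>H\<close>.
\<close>

section \<open>Linear maps\<close>

text \<open>Without the twist, every reassociation would shift powers of \<alpha>, and they would
  have to be matched at every step. Here powers of \<alpha> are compared only in
  \<open>matched\<close>, \<open>mult_eq\<close>, \<open>comult_eq\<close> and
  \<open>antipode_eq\<close>. One lemma, \<open>twist\<close>, works in both directions: with the
  inverse structure map it untwists, with the tensor product of the two structure maps it returns.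
  The other obstacle is formal. A tensor is a coset, and a Sweedler sum is a finite sum over a
  representative picked by choice. The choice depends on the tensor alone, so sums may be exchanged
  and linear maps pushed through for any summand; evaluating a sum at a pure tensor needs
  bilinearity, hence the many linearity rules for the simplifier. An unrestricted exchange of sums
  would loop, so the exchange rules are oriented or pinned to one coproduct. Associativity rests on
  the action axioms, coassociativity on the coaction axioms. The three compatibility conditions meet
  in the multiplicativity of the coproduct, where (3) lets an action pass a coaction.\<close>

lemma linear_mapI:
  assumes "\<And>x. x \<in> carrier V \<Longrightarrow> f x \<in> carrier W"
    and "\<And>x y. \<lbrakk>x \<in> carrier V; y \<in> carrier V\<rbrakk> \<Longrightarrow> f (x \<oplus>\<^bsub>V\<^esub> y) = f x \<oplus>\<^bsub>W\<^esub> f y"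
    and "\<And>r x. \<lbrakk>r \<in> carrier K; x \<in> carrier V\<rbrakk> \<Longrightarrow> f (r \<odot>\<^bsub>V\<^esub> x) = r \<odot>\<^bsub>W\<^esub> f x"
  shows "linear_map K V W f"
  using assms unfolding linear_map_def by blast

lemma linear_map_closed: "linear_map K V W f \<Longrightarrow> x \<in> carrier V \<Longrightarrow> f x \<in> carrier W"
  and linear_map_add: "linear_map K V W f \<Longrightarrow> x \<in> carrier V \<Longrightarrow> y \<in> carrier V \<Longrightarrow>
    f (x \<oplus>\<^bsub>V\<^esub> y) = f x \<oplus>\<^bsub>W\<^esub> f y"
  and linear_map_smult: "linear_map K V W f \<Longrightarrow> r \<in> carrier K \<Longrightarrow> x \<in> carrier V \<Longrightarrow>
    f (r \<odot>\<^bsub>V\<^esub> x) = r \<odot>\<^bsub>W\<^esub> f x"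
  unfolding linear_map_def by auto

lemma linear_map_zero:
  assumes "module K V" "module K W" "linear_map K V W f"
  shows "f \<zero>\<^bsub>V\<^esub> = \<zero>\<^bsub>W\<^esub>"
proof -
  interpret V: module K V by fact
  interpret W: module K W by fact
  have "f (\<zero>\<^bsub>K\<^esub> \<odot>\<^bsub>V\<^esub> \<zero>\<^bsub>V\<^esub>) = \<zero>\<^bsub>K\<^esub> \<odot>\<^bsub>W\<^esub> f \<zero>\<^bsub>V\<^esub>"
    using linear_map_smult[OF assms(3), of "\<zero>\<^bsub>K\<^esub>" "\<zero>\<^bsub>V\<^esub>"] by (simp del: V.smult_l_null V.smult_r_null)
  moreover have "f \<zero>\<^bsub>V\<^esub> \<in> carrier W" using assms(3) linear_map_closed by fastforce
  ultimately show ?thesis by simp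
qed

lemma linear_map_neg:
  assumes "module K V" "module K W" "linear_map K V W f" "x \<in> carrier V"
  shows "f (\<ominus>\<^bsub>V\<^esub> x) = \<ominus>\<^bsub>W\<^esub> f x"
proof -
  interpret V: module K V by fact
  interpret W: module K W by fact
  have "f (\<ominus>\<^bsub>V\<^esub> x) \<oplus>\<^bsub>W\<^esub> f x = \<zero>\<^bsub>W\<^esub>"
    using linear_map_add[OF assms(3), of "\<ominus>\<^bsub>V\<^esub> x" x] linear_map_zero[OF assms(1-3)] assms(4)
    by (simp add: V.M.l_neg)
  then show ?thesis
    using linear_map_closed[OF assms(3)] assms(4) by (intro W.M.minus_equality[symmetric]) auto
qed

lemma linear_map_cong:
  assumes "linear_map K V W f" "module K V" "\<And>x. x \<in> carrier V \<Longrightarrow> f x = g x"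
  shows "linear_map K V W g"
proof -
  interpret V: module K V by fact
  show ?thesis
    by (rule linear_mapI)
      (simp_all add: assms(3)[symmetric] linear_map_closed[OF assms(1)] linear_map_add[OF assms(1)]
        linear_map_smult[OF assms(1)])
qed

lemma linear_map_comp:
  "linear_map K V W f \<Longrightarrow> linear_map K W U g \<Longrightarrow> linear_map K V U (\<lambda>x. g (f x))"
  unfolding linear_map_def by (auto simp: Pi_iff)

lemma linear_map_finsum:
  assumes "module K V" "module K W" "linear_map K V W f" "finite S" "g \<in> S \<rightarrow> carrier V"
  shows "f (\<Oplus>\<^bsub>V\<^esub>z\<in>S. g z) = (\<Oplus>\<^bsub>W\<^esub>z\<in>S. f (g z))"
proof -
  interpret V: module K V by fact
  interpret W: module K W by fact
  show ?thesis using assms(4,5)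
    by (induction S) (auto simp: linear_map_zero[OF assms(1-3)] linear_map_add[OF assms(3)]
        linear_map_closed[OF assms(3)] Pi_def)
qed

lemma (in abelian_monoid) finsum_swap:
  assumes "finite S" "finite T" "\<And>x y. x \<in> S \<Longrightarrow> y \<in> T \<Longrightarrow> f x y \<in> carrier G"
  shows "(\<Oplus>x\<in>S. \<Oplus>y\<in>T. f x y) = (\<Oplus>y\<in>T. \<Oplus>x\<in>S. f x y)"
  using assms(1,3)
proof (induction S)
  case empty
  then show ?case by (simp add: finsum_zero)
next
  case (insert a S)
  have c: "\<And>y. y \<in> T \<Longrightarrow> (\<Oplus>x\<in>S. f x y) \<in> carrier G"
    using insert.prems by (intro finsum_closed) auto
  have "(\<Oplus>y\<in>T. \<Oplus>x\<in>insert a S. f x y) = (\<Oplus>y\<in>T. f a y \<oplus> (\<Oplus>x\<in>S. f x y))"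
    using insert c by (intro finsum_cong') (auto simp: Pi_def)
  also have "\<dots> = (\<Oplus>y\<in>T. f a y) \<oplus> (\<Oplus>y\<in>T. \<Oplus>x\<in>S. f x y)"
    using insert c by (intro finsum_addf) auto
  finally show ?case
    using insert by (subst finsum_insert) (auto intro!: finsum_closed)
qed

section \<open>Free spaces and tensor products\<close>

lemma free_space_simps [simp]:
  "zero (free_space K X) = (\<lambda>_. \<zero>\<^bsub>K\<^esub>)"
  "add (free_space K X) = (\<lambda>p q x. p x \<oplus>\<^bsub>K\<^esub> q x)"
  "smult (free_space K X) = (\<lambda>r p x. r \<otimes>\<^bsub>K\<^esub> p x)"
  by (simp_all add: free_space_def)

lemma free_space_carrier:
  "p \<in> carrier (free_space K X) \<longleftrightarrow>
    range p \<subseteq> carrier K \<and> finite {x. p x \<noteq> \<zero>\<^bsub>K\<^esub>} \<and> {x. p x \<noteq> \<zero>\<^bsub>K\<^esub>} \<subseteq> X"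
  by (simp add: free_space_def)

lemma free_spaceI:
  assumes "\<And>x. p x \<in> carrier K" "finite S" "{x. p x \<noteq> \<zero>\<^bsub>K\<^esub>} \<subseteq> S" "S \<subseteq> X"
  shows "p \<in> carrier (free_space K X)"
  using assms by (auto simp: free_space_carrier intro: finite_subset)

lemma free_space_val: "p \<in> carrier (free_space K X) \<Longrightarrow> p x \<in> carrier K"
  by (auto simp: free_space_carrier)

lemma free_space_module:
  assumes "cring K" shows "module K (free_space K X)"
proof -
  interpret cring K by fact
  let ?F = "free_space K X"
  have clos: "(\<lambda>x. p x \<oplus>\<^bsub>K\<^esub> q x) \<in> carrier ?F" if "p \<in> carrier ?F" "q \<in> carrier ?F" for p q
    by (rule free_spaceI[where S = "{x. p x \<noteq> \<zero>\<^bsub>K\<^esub>} \<union> {x. q x \<noteq> \<zero>\<^bsub>K\<^esub>}"])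
      (use that free_space_val[OF that(1)] free_space_val[OF that(2)] in \<open>auto simp: free_space_carrier\<close>)
  have sclos: "(\<lambda>x. r \<otimes>\<^bsub>K\<^esub> p x) \<in> carrier ?F" if "r \<in> carrier K" "p \<in> carrier ?F" for r p
    by (rule free_spaceI[where S = "{x. p x \<noteq> \<zero>\<^bsub>K\<^esub>}"])
      (use that free_space_val[OF that(2)] in \<open>auto simp: free_space_carrier\<close>)
  have inv: "\<exists>q\<in>carrier ?F. q \<oplus>\<^bsub>?F\<^esub> p = \<zero>\<^bsub>?F\<^esub>" if p: "p \<in> carrier ?F" for p
  proof (rule bexI)
    show "(\<lambda>x. \<ominus>\<^bsub>K\<^esub> \<one>\<^bsub>K\<^esub> \<otimes>\<^bsub>K\<^esub> p x) \<in> carrier ?F" by (rule sclos) (use p in auto)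
    show "(\<lambda>x. \<ominus>\<^bsub>K\<^esub> \<one>\<^bsub>K\<^esub> \<otimes>\<^bsub>K\<^esub> p x) \<oplus>\<^bsub>?F\<^esub> p = \<zero>\<^bsub>?F\<^esub>"
      by (auto simp: l_minus l_neg free_space_val[OF p])
  qed
  have zero: "(\<lambda>_. \<zero>\<^bsub>K\<^esub>) \<in> carrier ?F"
    by (rule free_spaceI[where S = "{}"]) auto
  show ?thesis
    by (intro moduleI abelian_groupI assms inv)
      (simp_all add: clos sclos zero free_space_val fun_eq_iff a_ac l_distr r_distr m_assoc)
qed

lemma basis_vec_closed:
  assumes "cring K" "x \<in> X" shows "basis_vec K x \<in> carrier (free_space K X)"
proof -
  interpret cring K by fact
  show ?thesis by (rule free_spaceI[where S = "{x}"]) (use assms in \<open>auto simp: basis_vec_def\<close>)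
qed

lemma free_space_induct [consumes 2, case_names zero basis add smult]:
  assumes K: "cring K" and p: "p \<in> carrier (free_space K X)"
    and z: "P (\<lambda>_. \<zero>\<^bsub>K\<^esub>)"
    and b: "\<And>x. x \<in> X \<Longrightarrow> P (basis_vec K x)"
    and a: "\<And>p q. \<lbrakk>p \<in> carrier (free_space K X); q \<in> carrier (free_space K X); P p; P q\<rbrakk>
        \<Longrightarrow> P (\<lambda>x. p x \<oplus>\<^bsub>K\<^esub> q x)"
    and s: "\<And>r p. \<lbrakk>r \<in> carrier K; p \<in> carrier (free_space K X); P p\<rbrakk> \<Longrightarrow> P (\<lambda>x. r \<otimes>\<^bsub>K\<^esub> p x)"
  shows "P p"
proof -
  interpret cring K by fact
  interpret F: module K "free_space K X" by (rule free_space_module[OF K])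
  have "P p" if "finite S" "S \<subseteq> X" "\<And>x. p x \<in> carrier K" "{x. p x \<noteq> \<zero>\<^bsub>K\<^esub>} \<subseteq> S" for S p
    using that
  proof (induction S arbitrary: p)
    case empty
    then have "p = (\<lambda>_. \<zero>\<^bsub>K\<^esub>)" by auto
    then show ?case using z by simp
  next
    case (insert c S)
    \<comment> \<open>The function is split into its part away from \<open>c\<close> and its value
      at \<open>c\<close> times a basis vector; the first part is supported in
      \<open>S\<close>.\<close>
    let ?q = "p(c := \<zero>\<^bsub>K\<^esub>)" and ?r = "\<lambda>x. p c \<otimes>\<^bsub>K\<^esub> basis_vec K c x"
    have q: "?q \<in> carrier (free_space K X)"
      by (rule free_spaceI[where S = S]) (use insert in auto)
    have bc: "basis_vec K c \<in> carrier (free_space K X)" using K insert by (simp add: basis_vec_closed)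
    have r: "?r \<in> carrier (free_space K X)"
      using F.smult_closed[OF insert.prems(2)[of c] bc] by simp
    have "P ?q" using insert by (intro insert.IH) auto
    moreover have "P ?r" using insert bc by (intro s b) auto
    ultimately have "P (\<lambda>x. ?q x \<oplus>\<^bsub>K\<^esub> ?r x)" using q r a by blast
    also have "(\<lambda>x. ?q x \<oplus>\<^bsub>K\<^esub> ?r x) = p" using insert by (auto simp: basis_vec_def fun_eq_iff)
    finally show ?case .
  qed
  from this[of "{x. p x \<noteq> \<zero>\<^bsub>K\<^esub>}" p] p show ?thesis by (auto simp: free_space_carrier)
qed

definition lin_ext ::
  "('k, 'r) ring_scheme \<Rightarrow> ('k, 'c, 'm) module_scheme \<Rightarrow> ('x \<Rightarrow> 'c) \<Rightarrow> ('x \<Rightarrow> 'k) \<Rightarrow> 'c" where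
  "lin_ext K U f p = (\<Oplus>\<^bsub>U\<^esub>z\<in>{z. p z \<noteq> \<zero>\<^bsub>K\<^esub>}. p z \<odot>\<^bsub>U\<^esub> f z)"

text \<open>The support of a sum can shrink by cancellation. Additivity of \<open>lin_ext\<close>
  therefore compares all three sums over one common finite set, where the extra terms
  vanish.\<close>

lemma lin_ext_superset:
  assumes "module K U" "f \<in> X \<rightarrow> carrier U" "p \<in> carrier (free_space K X)"
    and "finite S" "{z. p z \<noteq> \<zero>\<^bsub>K\<^esub>} \<subseteq> S" "S \<subseteq> X"
  shows "lin_ext K U f p = (\<Oplus>\<^bsub>U\<^esub>z\<in>S. p z \<odot>\<^bsub>U\<^esub> f z)"
proof -
  interpret U: module K U by fact
  show ?thesis unfolding lin_ext_def
    by (rule U.add.finprod_mono_neutral_cong_left[folded finsum_def])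
      (use assms in \<open>auto simp: free_space_val Pi_def subset_iff\<close>)
qed

lemma lin_ext_linear:
  assumes U: "module K U" and f: "f \<in> X \<rightarrow> carrier U"
  shows "linear_map K (free_space K X) U (lin_ext K U f)"
proof (rule linear_mapI)
  interpret U: module K U by fact
  interpret F: module K "free_space K X" by (rule free_space_module) unfold_locales
  note sup = lin_ext_superset[OF U f]
  have fin: "finite {z. p z \<noteq> \<zero>\<^bsub>K\<^esub>}" "{z. p z \<noteq> \<zero>\<^bsub>K\<^esub>} \<subseteq> X" if "p \<in> carrier (free_space K X)" for p
    using that by (auto simp: free_space_carrier)
  fix p assume p: "p \<in> carrier (free_space K X)"
  then show "lin_ext K U f p \<in> carrier U"
    unfolding lin_ext_def using f fin(2)[OF p]
    by (intro U.M.finsum_closed) (auto simp: free_space_val Pi_def)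
  fix q assume q: "q \<in> carrier (free_space K X)"
  let ?S = "{z. p z \<noteq> \<zero>\<^bsub>K\<^esub>} \<union> {z. q z \<noteq> \<zero>\<^bsub>K\<^esub>}"
  have S: "finite ?S" "?S \<subseteq> X" using fin[OF p] fin[OF q] by auto
  have pq: "(\<lambda>x. p x \<oplus>\<^bsub>K\<^esub> q x) \<in> carrier (free_space K X)" using F.M.a_closed[OF p q] by simp
  have "lin_ext K U f (p \<oplus>\<^bsub>free_space K X\<^esub> q) = (\<Oplus>\<^bsub>U\<^esub>z\<in>?S. (p z \<oplus>\<^bsub>K\<^esub> q z) \<odot>\<^bsub>U\<^esub> f z)"
    using p q by (subst free_space_simps, subst sup[OF pq S(1) _ S(2)]) (auto simp: free_space_val)
  also have "\<dots> = (\<Oplus>\<^bsub>U\<^esub>z\<in>?S. p z \<odot>\<^bsub>U\<^esub> f z \<oplus>\<^bsub>U\<^esub> q z \<odot>\<^bsub>U\<^esub> f z)"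
    by (rule U.M.finsum_cong')
      (use f S p q in \<open>auto simp: free_space_val[OF p] free_space_val[OF q] Pi_def subset_iff U.smult_l_distr\<close>)
  also have "\<dots> = (\<Oplus>\<^bsub>U\<^esub>z\<in>?S. p z \<odot>\<^bsub>U\<^esub> f z) \<oplus>\<^bsub>U\<^esub> (\<Oplus>\<^bsub>U\<^esub>z\<in>?S. q z \<odot>\<^bsub>U\<^esub> f z)"
    by (rule U.M.finsum_addf)
      (use f S p q in \<open>auto simp: free_space_val[OF p] free_space_val[OF q] Pi_def subset_iff\<close>)
  also have "\<dots> = lin_ext K U f p \<oplus>\<^bsub>U\<^esub> lin_ext K U f q"
    using sup[OF p S(1) _ S(2)] sup[OF q S(1) _ S(2)] by force
  finally show "lin_ext K U f (p \<oplus>\<^bsub>free_space K X\<^esub> q) = lin_ext K U f p \<oplus>\<^bsub>U\<^esub> lin_ext K U f q" .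
next
  interpret U: module K U by fact
  interpret F: module K "free_space K X" by (rule free_space_module) unfold_locales
  fix r p assume r: "r \<in> carrier K" and p: "p \<in> carrier (free_space K X)"
  let ?S = "{z. p z \<noteq> \<zero>\<^bsub>K\<^esub>}"
  have S: "finite ?S" "?S \<subseteq> X" using p by (auto simp: free_space_carrier)
  have rp: "(\<lambda>x. r \<otimes>\<^bsub>K\<^esub> p x) \<in> carrier (free_space K X)" using F.smult_closed[OF r p] by simp
  have "lin_ext K U f (r \<odot>\<^bsub>free_space K X\<^esub> p) = (\<Oplus>\<^bsub>U\<^esub>z\<in>?S. (r \<otimes>\<^bsub>K\<^esub> p z) \<odot>\<^bsub>U\<^esub> f z)"
    using p r by (subst free_space_simps, subst lin_ext_superset[OF U f rp S(1) _ S(2)]) (auto simp: free_space_val)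
  also have "\<dots> = (\<Oplus>\<^bsub>U\<^esub>z\<in>?S. r \<odot>\<^bsub>U\<^esub> (p z \<odot>\<^bsub>U\<^esub> f z))"
    by (rule U.M.finsum_cong')
      (use f S p r in \<open>auto simp: free_space_val[OF p] Pi_def subset_iff U.smult_assoc1\<close>)
  also have "\<dots> = r \<odot>\<^bsub>U\<^esub> lin_ext K U f p"
    unfolding lin_ext_def by (rule U.finsum_smult_ldistr[symmetric])
      (use f S p r in \<open>auto simp: free_space_val[OF p] Pi_def subset_iff\<close>)
  finally show "lin_ext K U f (r \<odot>\<^bsub>free_space K X\<^esub> p) = r \<odot>\<^bsub>U\<^esub> lin_ext K U f p" .
qed

lemma lin_ext_basis:
  assumes U: "module K U" and f: "f \<in> X \<rightarrow> carrier U" and x: "x \<in> X"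
  shows "lin_ext K U f (basis_vec K x) = f x"
proof -
  interpret U: module K U by fact
  have "lin_ext K U f (basis_vec K x) = (\<Oplus>\<^bsub>U\<^esub>z\<in>{x}. basis_vec K x z \<odot>\<^bsub>U\<^esub> f z)"
    by (rule lin_ext_superset[OF U f])
      (use x U.cring_axioms in \<open>auto simp: basis_vec_closed\<close>, auto simp: basis_vec_def split: if_splits)
  then show ?thesis using f x by (auto simp: basis_vec_def Pi_def)
qed

section \<open>The tensor product as a quotient module\<close>

locale tensor_space = V: module K V + W: module K W
  for K :: "('k, 'r) ring_scheme" and V :: "('k, 'a, 'm) module_scheme"
    and W :: "('k, 'b, 'n) module_scheme"
begin

abbreviation F where "F \<equiv> free_space K (carrier V \<times> carrier W)"
abbreviation N where "N \<equiv> tensor_kernel K V W"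
abbreviation cls where "cls p \<equiv> N +>\<^bsub>F\<^esub> p"

sublocale F: module K F
  by (rule free_space_module) unfold_locales

lemma relators_subset: "tensor_relators K V W \<subseteq> carrier F"
proof -
  have b: "basis_vec K z \<in> carrier F" if "z \<in> carrier V \<times> carrier W" for z
    using that V.R.cring_axioms by (simp add: basis_vec_closed)
  show ?thesis unfolding tensor_relators_def Let_def
    by (auto intro!: F.M.minus_closed F.M.a_closed F.smult_closed b simp del: free_space_simps)
qed

lemma kernel_submodule: "submodule N K F"
proof -
  let ?\<N> = "{N. submodule N K F \<and> tensor_relators K V W \<subseteq> N}"
  \<comment> \<open>\<open>carrier F\<close> belongs to the family, so the intersection is nonempty
    in its index set and stays inside the carrier.\<close>
  have c: "carrier F \<in> ?\<N>" using F.carrier_is_submodule relators_subset by auto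
  have e: "\<And>N. N \<in> ?\<N> \<Longrightarrow> submodule N K F" by auto
  show ?thesis unfolding tensor_kernel_def
  proof (rule F.submoduleI)
    show "\<Inter> ?\<N> \<subseteq> carrier F" using c by blast
    show "\<zero>\<^bsub>F\<^esub> \<in> \<Inter> ?\<N>"
      using subgroup.one_closed[OF submodule.axioms(1)[OF e]] by force
    fix p q assume p: "p \<in> \<Inter> ?\<N>" and q: "q \<in> \<Inter> ?\<N>"
    show "\<ominus>\<^bsub>F\<^esub> p \<in> \<Inter> ?\<N>" using p F.submoduleE(3)[OF e] by blast
    show "p \<oplus>\<^bsub>F\<^esub> q \<in> \<Inter> ?\<N>" using p q F.submoduleE(5)[OF e] by blast
    fix r assume "r \<in> carrier K"
    then show "r \<odot>\<^bsub>F\<^esub> p \<in> \<Inter> ?\<N>" using p F.submoduleE(4)[OF e] by blast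
  qed
qed

lemma kernel_relators: "tensor_relators K V W \<subseteq> N"
  unfolding tensor_kernel_def by blast

lemma kernel_least: "submodule M K F \<Longrightarrow> tensor_relators K V W \<subseteq> M \<Longrightarrow> N \<subseteq> M"
  unfolding tensor_kernel_def by blast

sublocale N: abelian_subgroup N F
  by (rule abelian_subgroupI3)
    (use kernel_submodule in \<open>auto simp: additive_subgroup_def submodule_def F.M.abelian_group_axioms\<close>)

lemma cls_eq_iff:
  assumes p: "p \<in> carrier F" and q: "q \<in> carrier F"
  shows "cls p = cls q \<longleftrightarrow> p \<ominus>\<^bsub>F\<^esub> q \<in> N"
proof
  assume "cls p = cls q"
  then have "p \<in> cls q" using N.a_rcos_self[OF p] by simp
  then show "p \<ominus>\<^bsub>F\<^esub> q \<in> N" using N.a_rcos_module_imp[OF q] p q by (simp add: F.M.minus_eq)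
next
  assume "p \<ominus>\<^bsub>F\<^esub> q \<in> N"
  then have "p \<in> cls q" using N.a_rcos_module_rev[OF q p] by (simp add: F.M.minus_eq)
  then show "cls p = cls q"
    using F.M.a_repr_independence[OF _ q N.a_subgroup] by simp
qed

lemma tensor_simps:
  "carrier (tensor K V W) = {cls p | p. p \<in> carrier F}"
  "zero (tensor K V W) = N"
  "add (tensor K V W) = set_add F"
  by (auto simp: tensor_def Let_def A_RCOSETS_def')

lemma cls_closed: "p \<in> carrier F \<Longrightarrow> cls p \<in> carrier (tensor K V W)"
  by (auto simp: tensor_simps)

lemma cls_add: "p \<in> carrier F \<Longrightarrow> q \<in> carrier F \<Longrightarrow> cls p \<oplus>\<^bsub>tensor K V W\<^esub> cls q = cls (p \<oplus>\<^bsub>F\<^esub> q)"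
  by (simp add: tensor_simps N.a_rcos_sum del: free_space_simps)

lemma cls_zero: "cls \<zero>\<^bsub>F\<^esub> = zero (tensor K V W)"
  using F.M.a_coset_add_zero[OF N.a_subset] by (simp add: tensor_simps)

text \<open>Scalar multiplication of a coset is a union over all its representatives. These
  contribute one and the same coset, because the kernel is closed under scalars.\<close>

lemma cls_smult:
  assumes r: "r \<in> carrier K" and p: "p \<in> carrier F"
  shows "r \<odot>\<^bsub>tensor K V W\<^esub> cls p = cls (r \<odot>\<^bsub>F\<^esub> p)"
proof -
  have "cls (r \<odot>\<^bsub>F\<^esub> q) = cls (r \<odot>\<^bsub>F\<^esub> p)" if q: "q \<in> cls p" for q
  proof -
    have qF: "q \<in> carrier F" by (rule N.a_elemrcos_carrier[OF p q])
    have "q \<ominus>\<^bsub>F\<^esub> p \<in> N" unfolding F.M.minus_eq by (rule N.a_rcos_module_imp[OF p q])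
    then have "r \<odot>\<^bsub>F\<^esub> (q \<ominus>\<^bsub>F\<^esub> p) \<in> N" by (rule F.submoduleE(4)[OF kernel_submodule r])
    also have "r \<odot>\<^bsub>F\<^esub> (q \<ominus>\<^bsub>F\<^esub> p) = r \<odot>\<^bsub>F\<^esub> q \<ominus>\<^bsub>F\<^esub> r \<odot>\<^bsub>F\<^esub> p"
      using r p qF F.smult_r_distr[OF r qF, of "\<ominus>\<^bsub>F\<^esub> p"] F.smult_r_minus[OF r p]
      by (simp add: F.M.minus_eq del: free_space_simps)
    finally show ?thesis
      by (simp only: cls_eq_iff[OF F.smult_closed[OF r qF] F.smult_closed[OF r p]])
  qed
  moreover have "p \<in> cls p" using p N.a_rcos_self by blast
  ultimately have "(\<Union>q\<in>cls p. cls (r \<odot>\<^bsub>F\<^esub> q)) = cls (r \<odot>\<^bsub>F\<^esub> p)" by blast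
  then show ?thesis by (simp add: tensor_def Let_def del: free_space_simps)
qed

lemma module_tensor: "module K (tensor K V W)"
proof (intro moduleI abelian_groupI V.R.cring_axioms)
  note [simp del] = free_space_simps
  let ?T = "tensor K V W"
  note ops = cls_add cls_smult cls_zero[symmetric] cls_closed
  have ex: "\<exists>p\<in>carrier F. t = cls p" if "t \<in> carrier ?T" for t
    using that by (auto simp: tensor_simps)
  show "\<exists>y\<in>carrier ?T. y \<oplus>\<^bsub>?T\<^esub> x = \<zero>\<^bsub>?T\<^esub>" if x: "x \<in> carrier ?T" for x
  proof -
    obtain p where p: "p \<in> carrier F" "x = cls p" using ex x by blast
    then show ?thesis by (intro bexI[of _ "cls (\<ominus>\<^bsub>F\<^esub> p)"]) (auto simp: ops F.M.l_neg)
  qed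
  show "\<zero>\<^bsub>?T\<^esub> \<in> carrier ?T" by (metis cls_closed cls_zero F.M.zero_closed)
  fix x y z assume x: "x \<in> carrier ?T" and y: "y \<in> carrier ?T" and z: "z \<in> carrier ?T"
  from ex[OF x] obtain p where [simp]: "p \<in> carrier F" "x = cls p" by metis
  from ex[OF y] obtain q where [simp]: "q \<in> carrier F" "y = cls q" by metis
  from ex[OF z] obtain s where [simp]: "s \<in> carrier F" "z = cls s" by metis
  show "x \<oplus>\<^bsub>?T\<^esub> y \<in> carrier ?T" by (simp add: cls_add cls_closed)
  show "x \<oplus>\<^bsub>?T\<^esub> y = y \<oplus>\<^bsub>?T\<^esub> x" by (simp add: cls_add F.M.a_comm)
  show "x \<oplus>\<^bsub>?T\<^esub> y \<oplus>\<^bsub>?T\<^esub> z = x \<oplus>\<^bsub>?T\<^esub> (y \<oplus>\<^bsub>?T\<^esub> z)" by (simp add: cls_add F.M.a_assoc)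
  show "\<zero>\<^bsub>?T\<^esub> \<oplus>\<^bsub>?T\<^esub> x = x" by (simp add: cls_zero[symmetric] cls_add)
  show "\<one>\<^bsub>K\<^esub> \<odot>\<^bsub>?T\<^esub> x = x" by (simp add: cls_smult)
  fix a b assume [simp]: "a \<in> carrier K" "b \<in> carrier K"
  show "a \<odot>\<^bsub>?T\<^esub> x \<in> carrier ?T" by (simp add: cls_smult cls_closed)
  show "a \<odot>\<^bsub>?T\<^esub> (x \<oplus>\<^bsub>?T\<^esub> y) = a \<odot>\<^bsub>?T\<^esub> x \<oplus>\<^bsub>?T\<^esub> a \<odot>\<^bsub>?T\<^esub> y"
    by (simp add: cls_add cls_smult F.smult_r_distr)
  show "(a \<oplus>\<^bsub>K\<^esub> b) \<odot>\<^bsub>?T\<^esub> x = a \<odot>\<^bsub>?T\<^esub> x \<oplus>\<^bsub>?T\<^esub> b \<odot>\<^bsub>?T\<^esub> x"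
    by (simp add: cls_add cls_smult F.smult_l_distr)
  show "(a \<otimes>\<^bsub>K\<^esub> b) \<odot>\<^bsub>?T\<^esub> x = a \<odot>\<^bsub>?T\<^esub> (b \<odot>\<^bsub>?T\<^esub> x)"
    by (simp add: cls_smult F.smult_assoc1)
qed

end

section \<open>Pure tensors and the universal property\<close>

context tensor_space
begin

lemma pure_eq_cls: "pure K V W v w = cls (basis_vec K (v, w))"
  by (simp add: pure_def)

lemma basis_closed: "v \<in> carrier V \<Longrightarrow> w \<in> carrier W \<Longrightarrow> basis_vec K (v, w) \<in> carrier F"
  by (simp add: basis_vec_closed V.R.cring_axioms)

lemma pure_closed: "v \<in> carrier V \<Longrightarrow> w \<in> carrier W \<Longrightarrow> pure K V W v w \<in> carrier (tensor K V W)"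
  by (simp add: pure_eq_cls basis_closed cls_closed)

lemma cls_eqI: "p \<ominus>\<^bsub>F\<^esub> q \<in> tensor_relators K V W \<Longrightarrow> p \<in> carrier F \<Longrightarrow> q \<in> carrier F \<Longrightarrow> cls p = cls q"
  using kernel_relators by (simp add: cls_eq_iff subset_iff)

lemma pure_linear_left:
  assumes w: "w \<in> carrier W"
  shows "linear_map K V (tensor K V W) (\<lambda>v. pure K V W v w)"
proof (rule linear_mapI)
  note [simp del] = free_space_simps
  fix x assume x: "x \<in> carrier V"
  then show "pure K V W x w \<in> carrier (tensor K V W)" using w by (rule pure_closed)
  fix y assume y: "y \<in> carrier V"
  show "pure K V W (x \<oplus>\<^bsub>V\<^esub> y) w = pure K V W x w \<oplus>\<^bsub>tensor K V W\<^esub> pure K V W y w"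
    unfolding pure_eq_cls cls_add[OF basis_closed[OF x w] basis_closed[OF y w]]
    by (rule cls_eqI)
      (use x y w in \<open>auto simp: tensor_relators_def Let_def basis_closed\<close>)
next
  note [simp del] = free_space_simps
  fix r x assume r: "r \<in> carrier K" and x: "x \<in> carrier V"
  show "pure K V W (r \<odot>\<^bsub>V\<^esub> x) w = r \<odot>\<^bsub>tensor K V W\<^esub> pure K V W x w"
    unfolding pure_eq_cls cls_smult[OF r basis_closed[OF x w]]
    by (rule cls_eqI)
      (use x r w in \<open>auto simp: tensor_relators_def Let_def basis_closed\<close>)
qed

lemma pure_linear_right:
  assumes v: "v \<in> carrier V"
  shows "linear_map K W (tensor K V W) (\<lambda>w. pure K V W v w)"
proof (rule linear_mapI)
  note [simp del] = free_space_simps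
  fix x assume x: "x \<in> carrier W"
  then show "pure K V W v x \<in> carrier (tensor K V W)" by (rule pure_closed[OF v])
  fix y assume y: "y \<in> carrier W"
  show "pure K V W v (x \<oplus>\<^bsub>W\<^esub> y) = pure K V W v x \<oplus>\<^bsub>tensor K V W\<^esub> pure K V W v y"
    unfolding pure_eq_cls cls_add[OF basis_closed[OF v x] basis_closed[OF v y]]
    by (rule cls_eqI)
      (use x y v in \<open>auto simp: tensor_relators_def Let_def basis_closed\<close>)
next
  note [simp del] = free_space_simps
  fix r x assume r: "r \<in> carrier K" and x: "x \<in> carrier W"
  show "pure K V W v (r \<odot>\<^bsub>W\<^esub> x) = r \<odot>\<^bsub>tensor K V W\<^esub> pure K V W v x"
    unfolding pure_eq_cls cls_smult[OF r basis_closed[OF v x]]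
    by (rule cls_eqI)
      (use x r v in \<open>auto simp: tensor_relators_def Let_def basis_closed\<close>)
qed

lemma cls_linear: "linear_map K F (tensor K V W) cls"
  by (rule linear_mapI) (simp_all add: cls_closed cls_add cls_smult del: free_space_simps)

text \<open>Composed with \<open>cls\<close>, both maps are linear on the free space, which is
  generated by basis vectors, and the classes of basis vectors are the pure tensors.\<close>

lemma tensor_map_eqI:
  assumes U: "module K U" and f: "linear_map K (tensor K V W) U f"
    and g: "linear_map K (tensor K V W) U g"
    and eq: "\<And>v w. v \<in> carrier V \<Longrightarrow> w \<in> carrier W \<Longrightarrow> f (pure K V W v w) = g (pure K V W v w)"
    and t: "t \<in> carrier (tensor K V W)"
  shows "f t = g t"
proof -
  note [simp del] = free_space_simps
  have f': "linear_map K F U (\<lambda>p. f (cls p))" and g': "linear_map K F U (\<lambda>p. g (cls p))"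
    by (rule linear_map_comp[OF cls_linear f] linear_map_comp[OF cls_linear g])+
  obtain p where p: "p \<in> carrier F" and tp: "t = cls p" using t by (auto simp: tensor_simps)
  from V.R.cring_axioms p have "f (cls p) = g (cls p)"
  proof (induction rule: free_space_induct)
    case zero
    then show ?case
      using linear_map_zero[OF F.module_axioms U f'] linear_map_zero[OF F.module_axioms U g']
      by (simp add: free_space_simps)
  next
    case (basis x)
    then show ?case using eq by (auto simp: pure_eq_cls)
  next
    case (add p q)
    then show ?case using linear_map_add[OF f', of p q] linear_map_add[OF g', of p q]
      by (simp add: free_space_simps)
  next
    case (smult r p)
    then show ?case using linear_map_smult[OF f', of r p] linear_map_smult[OF g', of r p]
      by (simp add: free_space_simps)
  qed
  then show ?thesis by (simp add: tp)
qed

lemma rep: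
  assumes "t \<in> carrier (tensor K V W)"
  shows "(SOME p. p \<in> t) \<in> carrier F" "cls (SOME p. p \<in> t) = t"
proof -
  obtain p where p: "p \<in> carrier F" and tp: "t = cls p" using assms by (auto simp: tensor_simps)
  have "p \<in> t" using N.a_rcos_self[OF p] tp by simp
  then have q: "(SOME p. p \<in> t) \<in> t" by (rule someI[of "\<lambda>p. p \<in> t"])
  show "(SOME p. p \<in> t) \<in> carrier F" by (rule N.a_elemrcos_carrier[OF p]) (use q tp in simp)
  show "cls (SOME p. p \<in> t) = t"
    using F.M.a_repr_independence[OF _ p N.a_subgroup] q unfolding tp by simp
qed

text \<open>The linear extension of \<open>f\<close> kills the bilinearity relators, so its zero set
  is a submodule containing the kernel. Hence the representative chosen inside
  \<open>sweedler\<close> may be exchanged for any \<open>p\<close> of the same class.\<close>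

lemma sweedler_cls:
  assumes U: "module K U" and f: "bilinear_map K V W U f" and p: "p \<in> carrier F"
  shows "sweedler K U (cls p) f = lin_ext K U (\<lambda>z. f (fst z) (snd z)) p"
proof -
  interpret U: module K U by fact
  note [simp del] = free_space_simps
  let ?f = "\<lambda>z. f (fst z) (snd z)" and ?\<phi> = "lin_ext K U (\<lambda>z. f (fst z) (snd z))"
  have L1: "linear_map K V U (\<lambda>v. f v w)" if "w \<in> carrier W" for w
    using f that by (simp add: bilinear_map_def)
  have L2: "linear_map K W U (f v)" if "v \<in> carrier V" for v
    using f that by (simp add: bilinear_map_def)
  have fc: "?f \<in> carrier V \<times> carrier W \<rightarrow> carrier U"
    using linear_map_closed[OF L1] by auto
  note lin = lin_ext_linear[OF U fc]
  note phi = linear_map_add[OF lin] linear_map_smult[OF lin] linear_map_closed[OF lin]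
    linear_map_neg[OF F.module_axioms U lin] linear_map_zero[OF F.module_axioms U lin]
  have bv: "?\<phi> (basis_vec K (v, w)) = f v w" if "v \<in> carrier V" "w \<in> carrier W" for v w
    using lin_ext_basis[OF U fc, of "(v, w)"] that by simp
  let ?M = "{p \<in> carrier F. ?\<phi> p = \<zero>\<^bsub>U\<^esub>}"
  have "submodule ?M K F"
    by (rule F.submoduleI) (auto simp: phi)
  moreover have "tensor_relators K V W \<subseteq> ?M"
    unfolding tensor_relators_def Let_def
    by (auto simp: basis_closed F.M.minus_eq phi bv linear_map_add[OF L1] linear_map_add[OF L2]
        linear_map_smult[OF L1] linear_map_smult[OF L2] linear_map_closed[OF L1] U.M.r_neg
        U.M.minus_add[symmetric] simp del: free_space_simps)
  ultimately have ker: "N \<subseteq> ?M" by (rule kernel_least)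
  let ?q = "SOME q. q \<in> cls p"
  have q: "?q \<in> carrier F" "cls ?q = cls p" using rep[OF cls_closed[OF p]] by auto
  then have "?q \<ominus>\<^bsub>F\<^esub> p \<in> N" using cls_eq_iff[OF q(1) p] by simp
  then have "?\<phi> ?q \<oplus>\<^bsub>U\<^esub> \<ominus>\<^bsub>U\<^esub> ?\<phi> p = \<zero>\<^bsub>U\<^esub>"
    using ker p q(1) by (auto simp: F.M.minus_eq phi)
  then have "?\<phi> ?q = ?\<phi> p"
    using p q(1) phi(3) U.M.minus_equality[of "?\<phi> ?q" "\<ominus>\<^bsub>U\<^esub> ?\<phi> p"] by auto
  then show ?thesis by (simp add: sweedler_def Let_def lin_ext_def)
qed

lemma sweedler_pure:
  assumes U: "module K U" and f: "bilinear_map K V W U f" and v: "v \<in> carrier V" "w \<in> carrier W"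
  shows "sweedler K U (pure K V W v w) f = f v w"
proof -
  have "(\<lambda>z. f (fst z) (snd z)) \<in> carrier V \<times> carrier W \<rightarrow> carrier U"
    using f unfolding bilinear_map_def linear_map_def by (auto simp: Pi_iff)
  from lin_ext_basis[OF U this, of "(v, w)"] show ?thesis
    using v sweedler_cls[OF U f basis_closed[OF v]] by (simp add: pure_eq_cls)
qed

lemma sweedler_linear:
  assumes U: "module K U" and f: "bilinear_map K V W U f"
  shows "linear_map K (tensor K V W) U (\<lambda>t. sweedler K U t f)"
proof -
  have fc: "(\<lambda>z. f (fst z) (snd z)) \<in> carrier V \<times> carrier W \<rightarrow> carrier U"
    using f unfolding bilinear_map_def linear_map_def by (auto simp: Pi_iff)
  note lin = lin_ext_linear[OF U fc] and s = sweedler_cls[OF U f]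
  show ?thesis
    by (rule linear_mapI)
      (auto simp: tensor_simps(1) cls_add cls_smult s linear_map_closed[OF lin] linear_map_add[OF lin]
        linear_map_smult[OF lin] simp del: free_space_simps)
qed

end

lemma foldSetD_cong:
  assumes "(A, y) \<in> foldSetD D f e" "\<And>x. x \<in> A \<Longrightarrow> f x = g x"
  shows "(A, y) \<in> foldSetD D g e"
  using assms by induction (auto intro!: foldSetD.intros)

text \<open>The relation \<open>foldSetD\<close> evaluates its function on elements of the set only.
  The two sums thus agree by definition, even where \<open>f\<close> leaves the carrier; this is
  what allows a carrier test to be inserted into an arbitrary summand.\<close>

lemma finsum_cong_total:
  assumes "\<And>x. x \<in> S \<Longrightarrow> f x = g x"
  shows "finsum G f S = finsum G g S"
proof -
  have "(S, y) \<in> foldSetD D (h \<circ> f) e \<longleftrightarrow> (S, y) \<in> foldSetD D (h \<circ> g) e"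
    for y e and D :: "'b set" and h :: "'b \<Rightarrow> 'b \<Rightarrow> 'b"
    using foldSetD_cong[of S y D "h \<circ> f" e "h \<circ> g"] foldSetD_cong[of S y D "h \<circ> g" e "h \<circ> f"] assms
    by auto
  then show ?thesis by (simp add: finsum_def finprod_def foldD_def)
qed

section \<open>Sweedler sums\<close>

text \<open>Restricting the summand to the carriers makes the congruence rule unconditional.\<close>

definition sw ::
  "('k, 'r) ring_scheme \<Rightarrow> ('k, 'a, 'm) module_scheme \<Rightarrow> ('k, 'b, 'n) module_scheme
    \<Rightarrow> ('k, 'c, 'p) module_scheme \<Rightarrow> ('a \<times> 'b \<Rightarrow> 'k) set \<Rightarrow> ('a \<Rightarrow> 'b \<Rightarrow> 'c) \<Rightarrow> 'c"
where
  "sw K V W U t f =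
    sweedler K U t (\<lambda>v w. if v \<in> carrier V \<and> w \<in> carrier W then f v w else \<zero>\<^bsub>U\<^esub>)"

lemma sw_cong [cong]:
  assumes "t = t'" "\<And>v w. v \<in> carrier V \<Longrightarrow> w \<in> carrier W \<Longrightarrow> f v w = g v w"
  shows "sw K V W U t f = sw K V W U t' g"
proof -
  have "(\<lambda>v w. if v \<in> carrier V \<and> w \<in> carrier W then f v w else \<zero>\<^bsub>U\<^esub>) =
    (\<lambda>v w. if v \<in> carrier V \<and> w \<in> carrier W then g v w else \<zero>\<^bsub>U\<^esub>)"
    using assms(2) by (auto simp: fun_eq_iff)
  then show ?thesis using assms(1) by (simp only: sw_def)
qed

text \<open>The chosen representative is supported in \<open>carrier V \<times> carrier W\<close>,
  so the carrier test inside \<open>sw\<close> always succeeds.\<close>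

lemma sweedler_eq_sw:
  assumes "module K V" "module K W" "t \<in> carrier (tensor K V W)"
  shows "sweedler K U t f = sw K V W U t f"
proof -
  interpret tensor_space K V W using assms by (simp add: tensor_space_def)
  have "{z. (SOME p. p \<in> t) z \<noteq> \<zero>\<^bsub>K\<^esub>} \<subseteq> carrier V \<times> carrier W"
    using rep(1)[OF assms(3)] by (simp add: free_space_carrier)
  then show ?thesis unfolding sw_def sweedler_def Let_def
    by (intro finsum_cong_total) auto
qed

lemma tensor_module: "module K V \<Longrightarrow> module K W \<Longrightarrow> module K (tensor K V W)"
  by (simp add: tensor_space_def tensor_space.module_tensor)

context
  fixes K :: "('k, 'r) ring_scheme" and V :: "('k, 'a, 'm) module_scheme"
    and W :: "('k, 'b, 'n) module_scheme"
  assumes VW: "module K V" "module K W"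
begin

interpretation tensor_space K V W using VW by (simp add: tensor_space_def)

lemma pure_in_tensor: "v \<in> carrier V \<Longrightarrow> w \<in> carrier W \<Longrightarrow> pure K V W v w \<in> carrier (tensor K V W)"
  by (rule pure_closed)

lemma linear_pure_left:
  "linear_map K X V f \<Longrightarrow> w \<in> carrier W \<Longrightarrow> linear_map K X (tensor K V W) (\<lambda>x. pure K V W (f x) w)"
  by (rule linear_map_comp[OF _ pure_linear_left])

lemma linear_pure_right:
  "linear_map K X W f \<Longrightarrow> v \<in> carrier V \<Longrightarrow> linear_map K X (tensor K V W) (\<lambda>x. pure K V W v (f x))"
  by (rule linear_map_comp[OF _ pure_linear_right])

lemmas linear_eq_on_pure = tensor_map_eqI

context
  fixes U :: "('k, 'c, 'p) module_scheme"
  assumes U: "module K U"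
begin

interpretation U: module K U by (rule U)

lemma sw_linear_ext:
  assumes "\<And>v. v \<in> carrier V \<Longrightarrow> linear_map K W U (f v)"
    and "\<And>w. w \<in> carrier W \<Longrightarrow> linear_map K V U (\<lambda>v. f v w)"
  shows "linear_map K (tensor K V W) U (\<lambda>t. sw K V W U t f)"
    and "v \<in> carrier V \<Longrightarrow> w \<in> carrier W \<Longrightarrow> sw K V W U (pure K V W v w) f = f v w"
proof -
  have b: "bilinear_map K V W U f" using assms by (simp add: bilinear_map_def)
  show "linear_map K (tensor K V W) U (\<lambda>t. sw K V W U t f)"
    by (rule linear_map_cong[OF sweedler_linear[OF U b] module_tensor]) (simp add: sweedler_eq_sw VW)
  show "v \<in> carrier V \<Longrightarrow> w \<in> carrier W \<Longrightarrow> sw K V W U (pure K V W v w) f = f v w"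
    using sweedler_pure[OF U b] sweedler_eq_sw[OF VW pure_closed, of v w U f] by simp
qed

end

lemma sw_closed:
  assumes U: "module K U" and t: "t \<in> carrier (tensor K V W)"
    and f: "\<And>v w. v \<in> carrier V \<Longrightarrow> w \<in> carrier W \<Longrightarrow> f v w \<in> carrier U"
  shows "sw K V W U t f \<in> carrier U"
proof -
  interpret U: module K U by (rule U)
  obtain p where p: "p \<in> carrier F" "p = (SOME p. p \<in> t)" using rep(1)[OF t] by blast
  have "p z \<odot>\<^bsub>U\<^esub> f (fst z) (snd z) \<in> carrier U" if "p z \<noteq> \<zero>\<^bsub>K\<^esub>" for z
    using p(1) that f[of "fst z" "snd z"] free_space_val[OF p(1), of z] by (auto simp: free_space_carrier)
  then show ?thesis
    by (auto simp: sweedler_eq_sw[OF VW t, symmetric] sweedler_def p(2)[symmetric] intro!: U.M.finsum_closed)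
qed

text \<open>The representative behind \<open>sw\<close> depends on \<open>t\<close> alone, so both
  sides are finite sums with the same index set and the same coefficients.\<close>

lemma sw_push:
  assumes U: "module K U" "module K U'" and L: "linear_map K U U' L"
    and t: "t \<in> carrier (tensor K V W)"
    and f: "\<And>v w. v \<in> carrier V \<Longrightarrow> w \<in> carrier W \<Longrightarrow> f v w \<in> carrier U"
  shows "L (sw K V W U t f) = sw K V W U' t (\<lambda>v w. L (f v w))"
proof -
  interpret U: module K U by (rule U)
  interpret U': module K U' by (rule U)
  obtain p where p: "p \<in> carrier F" "p = (SOME p. p \<in> t)" using rep(1)[OF t] by blast
  have fin: "finite {z. p z \<noteq> \<zero>\<^bsub>K\<^esub>}" using p(1) by (auto simp: free_space_carrier)
  have c: "f (fst z) (snd z) \<in> carrier U" "p z \<in> carrier K" if "p z \<noteq> \<zero>\<^bsub>K\<^esub>" for z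
    using p(1) that f[of "fst z" "snd z"] free_space_val[OF p(1), of z] by (auto simp: free_space_carrier)
  have "L (sw K V W U t f) = (\<Oplus>\<^bsub>U'\<^esub>z\<in>{z. p z \<noteq> \<zero>\<^bsub>K\<^esub>}. L (p z \<odot>\<^bsub>U\<^esub> f (fst z) (snd z)))"
    unfolding sweedler_eq_sw[OF VW t, symmetric] sweedler_def p(2)[symmetric] Let_def
    by (rule linear_map_finsum[OF U L fin]) (auto simp: c)
  also have "\<dots> = sw K V W U' t (\<lambda>v w. L (f v w))"
    unfolding sweedler_eq_sw[OF VW t, symmetric] sweedler_def p(2)[symmetric] Let_def
    by (rule finsum_cong_total) (simp add: c linear_map_smult[OF L])
  finally show ?thesis .
qed

text \<open>Linearity in a parameter of the summand while the tensor stays fixed;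
  \<open>linear_sw\<close> is the counterpart in which the tensor varies.\<close>

lemma sw_linear_param:
  assumes U: "module K U" and X: "module K X" and t: "t \<in> carrier (tensor K V W)"
    and f: "\<And>v w. v \<in> carrier V \<Longrightarrow> w \<in> carrier W \<Longrightarrow> linear_map K X U (\<lambda>x. f x v w)"
  shows "linear_map K X U (\<lambda>x. sw K V W U t (f x))"
proof (rule linear_mapI)
  interpret U: module K U by (rule U)
  interpret X: module K X by (rule X)
  obtain p where p: "p \<in> carrier F" "p = (SOME p. p \<in> t)" using rep(1)[OF t] by blast
  let ?S = "{z. p z \<noteq> \<zero>\<^bsub>K\<^esub>}"
  have fin: "finite ?S" using p(1) by (auto simp: free_space_carrier)
  have L: "linear_map K X U (\<lambda>x. f x (fst z) (snd z))" and pc: "p z \<in> carrier K" if "p z \<noteq> \<zero>\<^bsub>K\<^esub>" for z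
    using p(1) that f[of "fst z" "snd z"] free_space_val[OF p(1), of z] by (auto simp: free_space_carrier)
  have c: "f x (fst z) (snd z) \<in> carrier U" if "x \<in> carrier X" "p z \<noteq> \<zero>\<^bsub>K\<^esub>" for x z
    using linear_map_closed[OF L] that by blast
  have e: "sw K V W U t (f x) = (\<Oplus>\<^bsub>U\<^esub>z\<in>?S. p z \<odot>\<^bsub>U\<^esub> f x (fst z) (snd z))" for x
    by (simp add: sweedler_eq_sw[OF VW t, symmetric] sweedler_def p(2)[symmetric])
  fix x assume x: "x \<in> carrier X"
  show "sw K V W U t (f x) \<in> carrier U"
    using x linear_map_closed[OF f] by (intro sw_closed[OF U t])
  fix y assume y: "y \<in> carrier X"
  have "sw K V W U t (f (x \<oplus>\<^bsub>X\<^esub> y)) =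
      (\<Oplus>\<^bsub>U\<^esub>z\<in>?S. p z \<odot>\<^bsub>U\<^esub> f x (fst z) (snd z) \<oplus>\<^bsub>U\<^esub> p z \<odot>\<^bsub>U\<^esub> f y (fst z) (snd z))"
    unfolding e by (rule finsum_cong_total) (simp add: linear_map_add[OF L] x y c pc U.smult_r_distr)
  also have "\<dots> = sw K V W U t (f x) \<oplus>\<^bsub>U\<^esub> sw K V W U t (f y)"
    unfolding e by (rule U.M.finsum_addf) (simp_all add: c pc x y)
  finally show "sw K V W U t (f (x \<oplus>\<^bsub>X\<^esub> y)) = sw K V W U t (f x) \<oplus>\<^bsub>U\<^esub> sw K V W U t (f y)" .
next
  interpret U: module K U by (rule U)
  interpret X: module K X by (rule X)
  obtain p where p: "p \<in> carrier F" "p = (SOME p. p \<in> t)" using rep(1)[OF t] by blast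
  let ?S = "{z. p z \<noteq> \<zero>\<^bsub>K\<^esub>}"
  have fin: "finite ?S" using p(1) by (auto simp: free_space_carrier)
  have L: "linear_map K X U (\<lambda>x. f x (fst z) (snd z))" and pc: "p z \<in> carrier K" if "p z \<noteq> \<zero>\<^bsub>K\<^esub>" for z
    using p(1) that f[of "fst z" "snd z"] free_space_val[OF p(1), of z] by (auto simp: free_space_carrier)
  have c: "f x (fst z) (snd z) \<in> carrier U" if "x \<in> carrier X" "p z \<noteq> \<zero>\<^bsub>K\<^esub>" for x z
    using linear_map_closed[OF L] that by blast
  have e: "sw K V W U t (f x) = (\<Oplus>\<^bsub>U\<^esub>z\<in>?S. p z \<odot>\<^bsub>U\<^esub> f x (fst z) (snd z))" for x
    by (simp add: sweedler_eq_sw[OF VW t, symmetric] sweedler_def p(2)[symmetric])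
  fix r x assume r: "r \<in> carrier K" and x: "x \<in> carrier X"
  have "sw K V W U t (f (r \<odot>\<^bsub>X\<^esub> x)) = (\<Oplus>\<^bsub>U\<^esub>z\<in>?S. r \<odot>\<^bsub>U\<^esub> (p z \<odot>\<^bsub>U\<^esub> f x (fst z) (snd z)))"
    unfolding e by (rule finsum_cong_total)
      (simp add: linear_map_smult[OF L] r x c pc U.smult_assoc1[symmetric] V.R.m_comm)
  also have "\<dots> = r \<odot>\<^bsub>U\<^esub> sw K V W U t (f x)"
    unfolding e by (rule U.finsum_smult_ldistr[symmetric]) (simp_all add: fin r c pc x)
  finally show "sw K V W U t (f (r \<odot>\<^bsub>X\<^esub> x)) = r \<odot>\<^bsub>U\<^esub> sw K V W U t (f x)" .
qed

end

text \<open>With one representative fixed for each tensor this is the exchange of two finite sums.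
  The tensor \<open>t\<close> must not depend on \<open>v\<close> and \<open>w\<close>; sums over a
  coproduct of a bound variable are rearranged by coassociativity instead.\<close>

lemma sw_swap:
  assumes VW: "module K V" "module K W" "module K V'" "module K W'" and U: "module K U"
    and s: "s \<in> carrier (tensor K V W)" and t: "t \<in> carrier (tensor K V' W')"
    and f: "\<And>v w v' w'. \<lbrakk>v \<in> carrier V; w \<in> carrier W; v' \<in> carrier V'; w' \<in> carrier W'\<rbrakk>
      \<Longrightarrow> f v w v' w' \<in> carrier U"
  shows "sw K V W U s (\<lambda>v w. sw K V' W' U t (\<lambda>v' w'. f v w v' w')) =
    sw K V' W' U t (\<lambda>v' w'. sw K V W U s (\<lambda>v w. f v w v' w'))"
proof -
  interpret U: module K U by (rule U)
  interpret s: tensor_space K V W using VW by (simp add: tensor_space_def)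
  interpret t: tensor_space K V' W' using VW by (simp add: tensor_space_def)
  obtain p where p: "p \<in> carrier s.F" "p = (SOME p. p \<in> s)" using s.rep(1)[OF s] by blast
  obtain q where q: "q \<in> carrier t.F" "q = (SOME p. p \<in> t)" using t.rep(1)[OF t] by blast
  let ?S = "{z. p z \<noteq> \<zero>\<^bsub>K\<^esub>}" and ?T = "{z. q z \<noteq> \<zero>\<^bsub>K\<^esub>}"
  let ?f = "\<lambda>z z'. f (fst z) (snd z) (fst z') (snd z')"
  have fin: "finite ?S" "finite ?T" using p(1) q(1) by (auto simp: free_space_carrier)
  have pc: "p z \<in> carrier K" "q z' \<in> carrier K" for z z'
    using free_space_val[OF p(1)] free_space_val[OF q(1)] by auto
  have c: "?f z z' \<in> carrier U" if "p z \<noteq> \<zero>\<^bsub>K\<^esub>" "q z' \<noteq> \<zero>\<^bsub>K\<^esub>" for z z'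
    using p(1) q(1) that by (intro f) (auto simp: free_space_carrier)
  have es: "sw K V W U s g = (\<Oplus>\<^bsub>U\<^esub>z\<in>?S. p z \<odot>\<^bsub>U\<^esub> g (fst z) (snd z))" for g
    by (simp add: sweedler_eq_sw[OF VW(1,2) s, symmetric] sweedler_def p(2)[symmetric])
  have et: "sw K V' W' U t g = (\<Oplus>\<^bsub>U\<^esub>z\<in>?T. q z \<odot>\<^bsub>U\<^esub> g (fst z) (snd z))" for g
    by (simp add: sweedler_eq_sw[OF VW(3,4) t, symmetric] sweedler_def q(2)[symmetric])
  have "sw K V W U s (\<lambda>v w. sw K V' W' U t (\<lambda>v' w'. f v w v' w')) =
      (\<Oplus>\<^bsub>U\<^esub>z\<in>?S. \<Oplus>\<^bsub>U\<^esub>z'\<in>?T. p z \<odot>\<^bsub>U\<^esub> (q z' \<odot>\<^bsub>U\<^esub> ?f z z'))"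
    unfolding es et by (rule finsum_cong_total, rule U.finsum_smult_ldistr) (auto simp: fin c pc)
  also have "\<dots> = (\<Oplus>\<^bsub>U\<^esub>z'\<in>?T. \<Oplus>\<^bsub>U\<^esub>z\<in>?S. p z \<odot>\<^bsub>U\<^esub> (q z' \<odot>\<^bsub>U\<^esub> ?f z z'))"
    by (rule U.M.finsum_swap) (auto simp: fin c pc)
  also have "\<dots> = (\<Oplus>\<^bsub>U\<^esub>z'\<in>?T. \<Oplus>\<^bsub>U\<^esub>z\<in>?S. q z' \<odot>\<^bsub>U\<^esub> (p z \<odot>\<^bsub>U\<^esub> ?f z z'))"
    by (intro finsum_cong_total) (simp add: c pc U.smult_assoc1[symmetric] U.R.m_comm)
  also have "\<dots> = sw K V' W' U t (\<lambda>v' w'. sw K V W U s (\<lambda>v w. f v w v' w'))"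
    unfolding es et
    by (rule finsum_cong_total, rule U.finsum_smult_ldistr[symmetric]) (auto simp: fin c pc)
  finally show ?thesis .
qed

section \<open>Scalars, linearity and evaluation rules\<close>

lemma scalars_simps [simp]:
  "carrier (scalars K) = carrier K" "zero (scalars K) = \<zero>\<^bsub>K\<^esub>" "one (scalars K) = \<one>\<^bsub>K\<^esub>"
  "add (scalars K) = add K" "mult (scalars K) = mult K" "smult (scalars K) = mult K"
  by (simp_all add: scalars_def)

lemma module_scalars: "cring K \<Longrightarrow> module K (scalars K)"
proof -
  assume "cring K"
  then interpret cring K .
  show ?thesis
  proof (intro moduleI abelian_groupI)
    fix x assume "x \<in> carrier (scalars K)"
    then show "\<exists>y\<in>carrier (scalars K). y \<oplus>\<^bsub>scalars K\<^esub> x = \<zero>\<^bsub>scalars K\<^esub>"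
      by (intro bexI[of _ "\<ominus>\<^bsub>K\<^esub> x"]) (auto simp: l_neg)
  qed (simp_all add: cring_axioms a_ac l_distr r_distr m_assoc)
qed

declare tensor_module [simp] pure_in_tensor [simp] linear_pure_left [simp] linear_pure_right [simp]
  sw_closed [simp] sw_linear_param [simp]

lemma linear_map_id [simp]: "linear_map K V V (\<lambda>x. x)"
  by (simp add: linear_map_def)

lemma linear_sw [simp]:
  assumes "module K V" "module K W" "module K U" "linear_map K X (tensor K V W) f"
    and "\<And>v. v \<in> carrier V \<Longrightarrow> linear_map K W U (F v)"
    and "\<And>w. w \<in> carrier W \<Longrightarrow> linear_map K V U (\<lambda>v. F v w)"
  shows "linear_map K X U (\<lambda>x. sw K V W U (f x) F)"
  by (rule linear_map_comp[OF assms(4) sw_linear_ext(1)[OF assms(1-3)]]) (use assms in auto)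

lemma sw_pure [simp]:
  assumes "module K V" "module K W" "module K U" "v \<in> carrier V" "w \<in> carrier W"
    and "\<And>v. v \<in> carrier V \<Longrightarrow> linear_map K W U (F v)"
    and "\<And>w. w \<in> carrier W \<Longrightarrow> linear_map K V U (\<lambda>v. F v w)"
  shows "sw K V W U (pure K V W v w) F = F v w"
  using sw_linear_ext(2)[OF assms(1-3)] assms(4-) by blast

text \<open>Flattens a sum that assembles a tensor which is at once taken apart again. This is how a
  bilinear map is applied to an equation between tensors.\<close>

lemma sw_sw:
  assumes "module K V" "module K W" "module K V'" "module K W'" "module K U"
    and "t \<in> carrier (tensor K V W)"
    and "\<And>v w. v \<in> carrier V \<Longrightarrow> w \<in> carrier W \<Longrightarrow> F v w \<in> carrier (tensor K V' W')"
    and "\<And>v. v \<in> carrier V' \<Longrightarrow> linear_map K W' U (G v)"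
    and "\<And>w. w \<in> carrier W' \<Longrightarrow> linear_map K V' U (\<lambda>v. G v w)"
  shows "sw K V' W' U (sw K V W (tensor K V' W') t F) G = sw K V W U t (\<lambda>v w. sw K V' W' U (F v w) G)"
  by (rule sw_push[where U = "tensor K V' W'"]) (use assms in simp_all)

lemma linear_smult [simp]:
  assumes "module K U" "linear_map K X U f" "r \<in> carrier K"
  shows "linear_map K X U (\<lambda>x. r \<odot>\<^bsub>U\<^esub> f x)"
proof -
  interpret U: module K U by fact
  show ?thesis using assms
    by (intro linear_mapI) (simp_all add: linear_map_closed linear_map_add linear_map_smult
        U.smult_r_distr U.smult_assoc1[symmetric] U.R.m_comm)
qed

lemma linear_scale [simp]:
  assumes "module K U" "linear_map K X (scalars K) f" "u \<in> carrier U"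
  shows "linear_map K X U (\<lambda>x. f x \<odot>\<^bsub>U\<^esub> u)"
proof -
  interpret U: module K U by fact
  have "f x \<in> carrier K" if "x \<in> carrier X" for x using linear_map_closed[OF assms(2) that] by simp
  then show ?thesis using assms
    by (intro linear_mapI) (simp_all add: linear_map_add linear_map_smult
        U.smult_l_distr U.smult_assoc1)
qed

lemma linear_scalar_mult [simp]:
  assumes "cring K" "linear_map K X (scalars K) f" "r \<in> carrier K"
  shows "linear_map K X (scalars K) (\<lambda>x. f x \<otimes>\<^bsub>K\<^esub> r)" "linear_map K X (scalars K) (\<lambda>x. r \<otimes>\<^bsub>K\<^esub> f x)"
  using linear_scale[OF module_scalars[OF assms(1)] assms(2), of r]
    linear_smult[OF module_scalars[OF assms(1)] assms(2,3)] assms(3) by simp_all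

lemma sw_smult:
  assumes "module K V" "module K W" "module K U" "t \<in> carrier (tensor K V W)" "r \<in> carrier K"
    and "\<And>v w. v \<in> carrier V \<Longrightarrow> w \<in> carrier W \<Longrightarrow> F v w \<in> carrier U"
  shows "sw K V W U t (\<lambda>v w. r \<odot>\<^bsub>U\<^esub> F v w) = r \<odot>\<^bsub>U\<^esub> sw K V W U t F"
  by (rule sw_push[symmetric, of _ _ _ U U "\<lambda>u. r \<odot>\<^bsub>U\<^esub> u"]) (use assms in simp_all)

lemma sw_pure_id:
  assumes "module K V" "module K W" "t \<in> carrier (tensor K V W)"
  shows "sw K V W (tensor K V W) t (\<lambda>v w. pure K V W v w) = t"
  by (rule linear_eq_on_pure[of K V W "tensor K V W" _ "\<lambda>x. x"]) (use assms in simp_all)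

lemma tensor_map_sw:
  assumes "module K V" "module K W" "t \<in> carrier (tensor K V W)"
  shows "tensor_map K V' W' f g t = sw K V W (tensor K V' W') t (\<lambda>v w. pure K V' W' (f v) (g w))"
  by (simp add: tensor_map_def sweedler_eq_sw[OF assms])

text \<open>Stated for a bare record instead of inside the coalgebra locale, because
  \<open>hom_hopf_algebraI\<close> needs it before coassociativity has been established.\<close>

lemma coassoc_sw:
  assumes [simp]: "module K C" and lin: "linear_map K C C (alpha C)" "linear_map K C (tensor K C C) (comult C)"
    and [simp]: "c \<in> carrier C"
  shows "tensor_assoc K C C C (tensor_map K (tensor K C C) C (comult C) (alpha C) (comult C c)) =
      sw K C C (tensor K C (tensor K C C)) (comult C c) (\<lambda>x z.
        sw K C C (tensor K C (tensor K C C)) (comult C x) (\<lambda>u v.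
          pure K C (tensor K C C) u (pure K C C v (alpha C z))))"
    and "tensor_map K C (tensor K C C) (alpha C) (comult C) (comult C c) =
      sw K C C (tensor K C (tensor K C C)) (comult C c) (\<lambda>x z.
        pure K C (tensor K C C) (alpha C x) (comult C z))"
proof -
  have [simp]: "alpha C x \<in> carrier C" "comult C x \<in> carrier (tensor K C C)" if "x \<in> carrier C" for x
    using lin that by (auto dest: linear_map_closed)
  show "tensor_assoc K C C C (tensor_map K (tensor K C C) C (comult C) (alpha C) (comult C c)) =
      sw K C C (tensor K C (tensor K C C)) (comult C c) (\<lambda>x z.
        sw K C C (tensor K C (tensor K C C)) (comult C x) (\<lambda>u v.
          pure K C (tensor K C C) u (pure K C C v (alpha C z))))"
    "tensor_map K C (tensor K C C) (alpha C) (comult C) (comult C c) =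
      sw K C C (tensor K C (tensor K C C)) (comult C c) (\<lambda>x z.
        pure K C (tensor K C C) (alpha C x) (comult C z))"
    using lin by (simp_all add: tensor_map_sw[of K C C] tensor_assoc_def sw_sw
      sweedler_eq_sw[of K "tensor K C C" C] sweedler_eq_sw[of K C C] cong: if_cong)
qed

section \<open>The Hom-axioms as rules for Sweedler sums\<close>

context hom_space
begin

lemma space [simp]: "module K V" ..

lemma ground_cring [simp]: "cring K" ..

lemma scalars_module [simp]: "module K (scalars K)" by (simp add: module_scalars)

lemma alpha_closed [simp]: "x \<in> carrier V \<Longrightarrow> alpha V x \<in> carrier V"
  by (rule linear_map_closed[OF alpha_linear])

lemma linear_alpha [simp]: "linear_map K X V f \<Longrightarrow> linear_map K X V (\<lambda>x. alpha V (f x))"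
  by (rule linear_map_comp[OF _ alpha_linear])

end

context hom_assoc_algebra
begin

lemma mult_linear:
  "b \<in> carrier A \<Longrightarrow> linear_map K A A (\<lambda>a. a \<otimes>\<^bsub>A\<^esub> b)" "a \<in> carrier A \<Longrightarrow> linear_map K A A (\<lambda>b. a \<otimes>\<^bsub>A\<^esub> b)"
  using mult_bilinear by (simp_all add: bilinear_map_def)

lemma mult_closed [simp]: "a \<in> carrier A \<Longrightarrow> b \<in> carrier A \<Longrightarrow> a \<otimes>\<^bsub>A\<^esub> b \<in> carrier A"
  by (rule linear_map_closed[OF mult_linear(1)])

lemma linear_mult_left [simp]:
    "linear_map K X A f \<Longrightarrow> b \<in> carrier A \<Longrightarrow> linear_map K X A (\<lambda>x. f x \<otimes>\<^bsub>A\<^esub> b)"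
  and linear_mult_right [simp]:
    "linear_map K X A f \<Longrightarrow> b \<in> carrier A \<Longrightarrow> linear_map K X A (\<lambda>x. b \<otimes>\<^bsub>A\<^esub> f x)"
  by (rule linear_map_comp[OF _ mult_linear(1)] linear_map_comp[OF _ mult_linear(2)]; assumption)+

declare unit_closed [simp]

end

context hom_coassoc_coalgebra
begin

lemma comult_closed [simp]: "c \<in> carrier C \<Longrightarrow> comult C c \<in> carrier (tensor K C C)"
  by (rule linear_map_closed[OF comult_linear])

lemma counit_closed [simp]: "c \<in> carrier C \<Longrightarrow> counit C c \<in> carrier K"
  using linear_map_closed[OF counit_linear] by simp

lemma linear_comult [simp]: "linear_map K X C f \<Longrightarrow> linear_map K X (tensor K C C) (\<lambda>x. comult C (f x))"
  by (rule linear_map_comp[OF _ comult_linear])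

lemma linear_counit [simp]: "linear_map K X C f \<Longrightarrow> linear_map K X (scalars K) (\<lambda>x. counit C (f x))"
  by (rule linear_map_comp[OF _ counit_linear])

lemma sw_counit_left:
  assumes "module K U" "linear_map K C U f" "c \<in> carrier C"
  shows "sw K C C U (comult C c) (\<lambda>x y. counit C x \<odot>\<^bsub>U\<^esub> f y) = f (alpha C c)"
  using counit_left[OF assms(3)] assms sw_push[of K C C C U f "comult C c" "\<lambda>x y. counit C x \<odot>\<^bsub>C\<^esub> y"]
  by (simp add: sweedler_eq_sw[of K C C] linear_map_smult)

lemma sw_counit_right:
  assumes "module K U" "linear_map K C U f" "c \<in> carrier C"
  shows "sw K C C U (comult C c) (\<lambda>x y. counit C y \<odot>\<^bsub>U\<^esub> f x) = f (alpha C c)"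
  using counit_right[OF assms(3)] assms sw_push[of K C C C U f "comult C c" "\<lambda>x y. counit C y \<odot>\<^bsub>C\<^esub> x"]
  by (simp add: sweedler_eq_sw[of K C C] linear_map_smult)

lemma sw_alpha:
  assumes "module K U" "c \<in> carrier C"
    and "\<And>v. v \<in> carrier C \<Longrightarrow> linear_map K C U (F v)"
    and "\<And>w. w \<in> carrier C \<Longrightarrow> linear_map K C U (\<lambda>v. F v w)"
  shows "sw K C C U (comult C (alpha C c)) F = sw K C C U (comult C c) (\<lambda>x y. F (alpha C x) (alpha C y))"
  unfolding alpha_comult[OF assms(2), symmetric]
  using assms by (simp add: tensor_map_sw[of K C C] sw_sw)

text \<open>A trilinear \<open>F\<close> induces a linear map \<open>?G\<close> on the threefold
  tensor product, and \<open>?G\<close> is applied to both sides of the coassociativity axiom. The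
  later rules for coactions arise in the same way.\<close>

lemma sw_coassoc:
  assumes U: "module K U" and c: "c \<in> carrier C"
    and F1: "\<And>v w. v \<in> carrier C \<Longrightarrow> w \<in> carrier C \<Longrightarrow> linear_map K C U (\<lambda>u. F u v w)"
    and F2: "\<And>u w. u \<in> carrier C \<Longrightarrow> w \<in> carrier C \<Longrightarrow> linear_map K C U (\<lambda>v. F u v w)"
    and F3: "\<And>u v. u \<in> carrier C \<Longrightarrow> v \<in> carrier C \<Longrightarrow> linear_map K C U (\<lambda>w. F u v w)"
  shows "sw K C C U (comult C c) (\<lambda>x z. sw K C C U (comult C x) (\<lambda>u v. F u v (alpha C z))) =
    sw K C C U (comult C c) (\<lambda>x y. sw K C C U (comult C y) (\<lambda>u v. F (alpha C x) u v))"
proof -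
  let ?G = "\<lambda>t. sw K C (tensor K C C) U t (\<lambda>x s. sw K C C U s (\<lambda>u v. F x u v))"
  have "?G (tensor_assoc K C C C (tensor_map K (tensor K C C) C (comult C) (alpha C) (comult C c))) =
      ?G (tensor_map K C (tensor K C C) (alpha C) (comult C) (comult C c))"
    using hom_coassoc[OF c] by simp
  then show ?thesis
    unfolding coassoc_sw[OF space alpha_linear comult_linear c] using assms by (simp add: sw_sw)
qed

end

lemma tensor_alg_mult:
  assumes "module K A" "module K B" "s \<in> carrier (tensor K A B)" "t \<in> carrier (tensor K A B)"
  shows "s \<otimes>\<^bsub>tensor_alg K A B\<^esub> t = sw K A B (tensor K A B) s (\<lambda>a b.
    sw K A B (tensor K A B) t (\<lambda>a' b'. pure K A B (a \<otimes>\<^bsub>A\<^esub> a') (b \<otimes>\<^bsub>B\<^esub> b')))"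
  using assms by (simp add: tensor_alg_def sweedler_eq_sw[of K A B])

text \<open>Common entry point for the twisted records and for the ordinary bicrossproduct: the
  axioms are requested as identities of \<open>sw\<close> sums, the form in which they are
  computed.\<close>

lemma hom_hopf_algebraI:
  assumes K: "field K" and [simp]: "module K H"
    and al: "linear_map K H H (alpha H)"
    and ml: "\<And>b. b \<in> carrier H \<Longrightarrow> linear_map K H H (\<lambda>a. a \<otimes>\<^bsub>H\<^esub> b)"
    and mr: "\<And>a. a \<in> carrier H \<Longrightarrow> linear_map K H H (\<lambda>b. a \<otimes>\<^bsub>H\<^esub> b)"
    and one: "\<one>\<^bsub>H\<^esub> \<in> carrier H"
    and am: "\<And>a b. \<lbrakk>a \<in> carrier H; b \<in> carrier H\<rbrakk> \<Longrightarrow>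
      alpha H (a \<otimes>\<^bsub>H\<^esub> b) = alpha H a \<otimes>\<^bsub>H\<^esub> alpha H b"
    and ao: "alpha H \<one>\<^bsub>H\<^esub> = \<one>\<^bsub>H\<^esub>"
    and om: "\<And>a. a \<in> carrier H \<Longrightarrow> \<one>\<^bsub>H\<^esub> \<otimes>\<^bsub>H\<^esub> a = alpha H a"
    and mo: "\<And>a. a \<in> carrier H \<Longrightarrow> a \<otimes>\<^bsub>H\<^esub> \<one>\<^bsub>H\<^esub> = alpha H a"
    and assoc: "\<And>a b c. \<lbrakk>a \<in> carrier H; b \<in> carrier H; c \<in> carrier H\<rbrakk> \<Longrightarrow>
      alpha H a \<otimes>\<^bsub>H\<^esub> (b \<otimes>\<^bsub>H\<^esub> c) = (a \<otimes>\<^bsub>H\<^esub> b) \<otimes>\<^bsub>H\<^esub> alpha H c"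
    and dl: "linear_map K H (tensor K H H) (comult H)"
    and el: "linear_map K H (scalars K) (counit H)"
    and ea: "\<And>c. c \<in> carrier H \<Longrightarrow> counit H (alpha H c) = counit H c"
    and da: "\<And>c. c \<in> carrier H \<Longrightarrow> comult H (alpha H c) =
      sw K H H (tensor K H H) (comult H c) (\<lambda>x y. pure K H H (alpha H x) (alpha H y))"
    and cl: "\<And>c. c \<in> carrier H \<Longrightarrow>
      sw K H H H (comult H c) (\<lambda>x y. counit H x \<odot>\<^bsub>H\<^esub> y) = alpha H c"
    and cr: "\<And>c. c \<in> carrier H \<Longrightarrow>
      sw K H H H (comult H c) (\<lambda>x y. counit H y \<odot>\<^bsub>H\<^esub> x) = alpha H c"
    and coassoc: "\<And>c. c \<in> carrier H \<Longrightarrow>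
      sw K H H (tensor K H (tensor K H H)) (comult H c) (\<lambda>x z.
        sw K H H (tensor K H (tensor K H H)) (comult H x) (\<lambda>u v.
          pure K H (tensor K H H) u (pure K H H v (alpha H z)))) =
      sw K H H (tensor K H (tensor K H H)) (comult H c) (\<lambda>x z.
        pure K H (tensor K H H) (alpha H x) (comult H z))"
    and dm: "\<And>h g. \<lbrakk>h \<in> carrier H; g \<in> carrier H\<rbrakk> \<Longrightarrow> comult H (h \<otimes>\<^bsub>H\<^esub> g) =
      sw K H H (tensor K H H) (comult H h) (\<lambda>h1 h2. sw K H H (tensor K H H) (comult H g) (\<lambda>g1 g2.
        pure K H H (h1 \<otimes>\<^bsub>H\<^esub> g1) (h2 \<otimes>\<^bsub>H\<^esub> g2)))"
    and d1: "comult H \<one>\<^bsub>H\<^esub> = pure K H H \<one>\<^bsub>H\<^esub> \<one>\<^bsub>H\<^esub>"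
    and em: "\<And>h g. \<lbrakk>h \<in> carrier H; g \<in> carrier H\<rbrakk> \<Longrightarrow>
      counit H (h \<otimes>\<^bsub>H\<^esub> g) = counit H h \<otimes>\<^bsub>K\<^esub> counit H g"
    and e1: "counit H \<one>\<^bsub>H\<^esub> = \<one>\<^bsub>K\<^esub>"
    and sl: "linear_map K H H (antipode H)"
    and sa: "\<And>h. h \<in> carrier H \<Longrightarrow> antipode H (alpha H h) = alpha H (antipode H h)"
    and s1: "\<And>h. h \<in> carrier H \<Longrightarrow>
      sw K H H H (comult H h) (\<lambda>x y. antipode H x \<otimes>\<^bsub>H\<^esub> y) = counit H h \<odot>\<^bsub>H\<^esub> \<one>\<^bsub>H\<^esub>"
    and s2: "\<And>h. h \<in> carrier H \<Longrightarrow>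
      sw K H H H (comult H h) (\<lambda>x y. x \<otimes>\<^bsub>H\<^esub> antipode H y) = counit H h \<odot>\<^bsub>H\<^esub> \<one>\<^bsub>H\<^esub>"
  shows "hom_hopf_algebra K H"
proof -
  have [simp]: "comult H x \<in> carrier (tensor K H H)" if "x \<in> carrier H" for x
    using linear_map_closed[OF dl that] .
  note s = sweedler_eq_sw[of K H H]
  show ?thesis
  proof (intro hom_hopf_algebra.intro hom_bialgebra.intro hom_assoc_algebra.intro
      hom_coassoc_coalgebra.intro hom_space.intro hom_space_axioms.intro hom_assoc_algebra_axioms.intro
      hom_coassoc_coalgebra_axioms.intro hom_bialgebra_axioms.intro hom_hopf_algebra_axioms.intro)
    show "bilinear_map K H H H (mult H)" using ml mr by (simp add: bilinear_map_def)
    show "comult H \<one>\<^bsub>H\<^esub> = \<one>\<^bsub>tensor_alg K H H\<^esub>" by (simp add: d1 tensor_alg_def)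
  next
    fix c assume "c \<in> carrier H"
    then show "tensor_assoc K H H H (tensor_map K (tensor K H H) H (comult H) (alpha H) (comult H c)) =
        tensor_map K H (tensor K H H) (alpha H) (comult H) (comult H c)"
      by (simp only: coassoc_sw[OF _ al dl] coassoc \<open>module K H\<close>)
  qed (simp_all add: K al one am ao om mo assoc dl el ea e1 em sl sa s1 s2 cl cr s
      da tensor_map_sw[of K H H] tensor_alg_mult dm)
qed

section \<open>Different Hom-structures on one vector space\<close>

definition same_space :: "('k, 'a, 'm) module_scheme \<Rightarrow> ('k, 'a, 'n) module_scheme \<Rightarrow> bool" where
  "same_space V V' \<longleftrightarrow> carrier V' = carrier V \<and> zero V' = zero V \<and> add V' = add V \<and> smult V' = smult V"

lemma same_space_refl: "same_space V V"
  by (simp add: same_space_def)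

lemma same_space_module: "same_space V V' \<Longrightarrow> module K V \<Longrightarrow> module K V'"
proof -
  assume s: "same_space V V'" and "module K V"
  then interpret V: module K V by simp
  show ?thesis
  proof (intro moduleI abelian_groupI)
    fix x assume "x \<in> carrier V'"
    then show "\<exists>y\<in>carrier V'. y \<oplus>\<^bsub>V'\<^esub> x = \<zero>\<^bsub>V'\<^esub>"
      using s by (intro bexI[of _ "\<ominus>\<^bsub>V\<^esub> x"]) (auto simp: V.M.l_neg same_space_def)
  qed (use s in \<open>simp_all add: same_space_def V.R.cring_axioms V.M.a_ac V.smult_l_distr V.smult_r_distr V.smult_assoc1\<close>)
qed

lemma same_space_tensor:
  assumes "same_space V V'" "same_space W W'"
  shows "tensor K V' W' = tensor K V W" "pure K V' W' = pure K V W" "sw K V' W' U = sw K V W U"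
    "linear_map K V' W' = linear_map K V W" "linear_map K X W' = linear_map K X W"
    "linear_map K V' Y = linear_map K V Y"
proof -
  have "tensor_relators K V' W' = tensor_relators K V W"
    using assms by (simp add: tensor_relators_def same_space_def)
  then have "tensor_kernel K V' W' = tensor_kernel K V W"
    using assms by (simp add: tensor_kernel_def same_space_def)
  then show "tensor K V' W' = tensor K V W" "pure K V' W' = pure K V W"
    using assms by (simp_all add: tensor_def pure_def fun_eq_iff same_space_def)
qed (use assms in \<open>simp_all add: linear_map_def fun_eq_iff same_space_def sw_def\<close>)

lemma same_space_sw:
  fixes V :: "('k, 'v, 'p) module_scheme" and W :: "('k, 'w, 'q) module_scheme"
  assumes "same_space U U'"
  shows "sw K V W U' = sw K V W U"
proof -
  have "finsum U' f S = finsum U f S" for f and S :: "('v \<times> 'w) set"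
    using assms by (simp add: finsum_def finprod_def same_space_def)
  then show ?thesis using assms by (simp add: sw_def sweedler_def fun_eq_iff same_space_def Let_def cong: if_cong)
qed

text \<open>Opens a tensor standing as an argument of \<open>pure\<close>, typically a coproduct,
  into a sum to which the rules for \<open>comult\<close> apply.\<close>

lemma pure_sw_right:
  assumes "module K V" "module K W" "module K W'" "v \<in> carrier V" "t \<in> carrier (tensor K W W')"
  shows "pure K V (tensor K W W') v t =
    sw K W W' (tensor K V (tensor K W W')) t (\<lambda>x y. pure K V (tensor K W W') v (pure K W W' x y))"
  using sw_push[of K W W' "tensor K W W'" "tensor K V (tensor K W W')"
      "\<lambda>s. pure K V (tensor K W W') v s" t "\<lambda>x y. pure K W W' x y"]
    assms by (simp add: sw_pure_id)

context hom_hopf_algebra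
begin

lemma antipode_closed [simp]: "x \<in> carrier H \<Longrightarrow> antipode H x \<in> carrier H"
  using linear_map_closed[OF antipode_linear] .

lemma linear_antipode [simp]: "linear_map K X H f \<Longrightarrow> linear_map K X H (\<lambda>x. antipode H (f x))"
  by (rule linear_map_comp[OF _ antipode_linear])

lemma sw_antipode:
  assumes "module K U" "linear_map K H U f" "h \<in> carrier H"
  shows "sw K H H U (comult H h) (\<lambda>x y. f (antipode H x \<otimes>\<^bsub>H\<^esub> y)) = counit H h \<odot>\<^bsub>U\<^esub> f \<one>\<^bsub>H\<^esub>"
    "sw K H H U (comult H h) (\<lambda>x y. f (x \<otimes>\<^bsub>H\<^esub> antipode H y)) = counit H h \<odot>\<^bsub>U\<^esub> f \<one>\<^bsub>H\<^esub>"
  using antipode_left[OF assms(3)] antipode_right[OF assms(3)] assms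
    sw_push[of K H H H U f "comult H h" "\<lambda>x y. antipode H x \<otimes>\<^bsub>H\<^esub> y"]
    sw_push[of K H H H U f "comult H h" "\<lambda>x y. x \<otimes>\<^bsub>H\<^esub> antipode H y"]
  by (simp_all add: sweedler_eq_sw[of K H H] linear_map_smult)

end

section \<open>Twisting\<close>

locale hom_hopf_endomorphism = hom_hopf_algebra K B
  for K :: "('k, 'r) ring_scheme" and B :: "('k, 'a, 'm) hom_hopf_scheme" +
  fixes \<gamma> :: "'a \<Rightarrow> 'a"
  assumes endo_linear: "linear_map K B B \<gamma>"
    and endo_mult: "\<lbrakk>x \<in> carrier B; y \<in> carrier B\<rbrakk> \<Longrightarrow> \<gamma> (x \<otimes>\<^bsub>B\<^esub> y) = \<gamma> x \<otimes>\<^bsub>B\<^esub> \<gamma> y"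
    and endo_one: "\<gamma> \<one>\<^bsub>B\<^esub> = \<one>\<^bsub>B\<^esub>"
    and endo_alpha: "x \<in> carrier B \<Longrightarrow> alpha B (\<gamma> x) = \<gamma> (alpha B x)"
    and endo_comult: "x \<in> carrier B \<Longrightarrow>
      comult B (\<gamma> x) = sw K B B (tensor K B B) (comult B x) (\<lambda>x y. pure K B B (\<gamma> x) (\<gamma> y))"
    and endo_counit: "x \<in> carrier B \<Longrightarrow> counit B (\<gamma> x) = counit B x"
    and endo_antipode: "x \<in> carrier B \<Longrightarrow> antipode B (\<gamma> x) = \<gamma> (antipode B x)"
begin

lemma endo_closed [simp]: "x \<in> carrier B \<Longrightarrow> \<gamma> x \<in> carrier B"
  using linear_map_closed[OF endo_linear] .

lemma linear_endo [simp]: "linear_map K X B f \<Longrightarrow> linear_map K X B (\<lambda>x. \<gamma> (f x))"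
  by (rule linear_map_comp[OF _ endo_linear])

lemma sw_endo:
  assumes "module K U" "c \<in> carrier B"
    and "\<And>v. v \<in> carrier B \<Longrightarrow> linear_map K B U (F v)"
    and "\<And>w. w \<in> carrier B \<Longrightarrow> linear_map K B U (\<lambda>v. F v w)"
  shows "sw K B B U (comult B (\<gamma> c)) F = sw K B B U (comult B c) (\<lambda>x y. F (\<gamma> x) (\<gamma> y))"
  unfolding endo_comult[OF assms(2)] using assms by (simp add: sw_sw)

lemma linear_cong:
  "linear_map K B Y f \<Longrightarrow> (\<And>x. x \<in> carrier B \<Longrightarrow> g x = f x) \<Longrightarrow> linear_map K B Y g"
  by (rule linear_map_cong[of _ _ _ f]) auto

text \<open>The twisting principle for Hom-algebras, in a form that starts from an arbitrary
  Hom-Hopf algebra. Since \<open>\<gamma>\<close> commutes with all operations, each axiom of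
  \<open>B'\<close> is that of \<open>B\<close> with the same power of \<open>\<gamma>\<close> on
  every leaf.\<close>

lemma twist:
  fixes B' :: "('k, 'a, 'n) hom_hopf_scheme"
  assumes B': "same_space B B'" "\<one>\<^bsub>B'\<^esub> = \<one>\<^bsub>B\<^esub>"
    and B'_alpha: "\<And>x. x \<in> carrier B \<Longrightarrow> alpha B' x = \<gamma> (alpha B x)"
    and B'_mult: "\<And>x y. \<lbrakk>x \<in> carrier B; y \<in> carrier B\<rbrakk> \<Longrightarrow> x \<otimes>\<^bsub>B'\<^esub> y = \<gamma> (x \<otimes>\<^bsub>B\<^esub> y)"
    and B'_comult: "\<And>x. x \<in> carrier B \<Longrightarrow> comult B' x = comult B (\<gamma> x)"
    and B'_counit: "\<And>x. x \<in> carrier B \<Longrightarrow> counit B' x = counit B x"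
    and B'_antipode: "\<And>x. x \<in> carrier B \<Longrightarrow> antipode B' x = antipode B x"
  shows "hom_hopf_algebra K B'"
proof -
  note sp = same_space_tensor[OF B'(1) B'(1)] same_space_sw[OF B'(1)]
    same_space_tensor(1,2)[OF B'(1) same_space_refl] same_space_tensor(1,2)[OF same_space_refl B'(1)]
  note [simp] = same_space_tensor[OF B'(1)] same_space_tensor[OF B'(1) B'(1)] same_space_sw[OF B'(1)]
  have [simp]: "carrier B' = carrier B" "zero B' = zero B" "add B' = add B" "smult B' = smult B"
    using B'(1) by (auto simp: same_space_def)
  have [simp]: "module K B'" by (rule same_space_module[OF B'(1)]) simp
  note [simp] = B'(2) B'_alpha B'_mult B'_comult B'_counit B'_antipode endo_mult endo_one endo_alpha
    endo_counit endo_antipode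
  show ?thesis
  proof (rule hom_hopf_algebraI)
    show "field K" by (rule field_axioms)
    show "linear_map K B' B' (alpha B')"
      by simp (rule linear_cong[of _ "\<lambda>x. \<gamma> (alpha B x)"]; simp)
    show "linear_map K B' (scalars K) (counit B')"
      by simp (rule linear_cong[of _ "counit B"]; simp add: counit_linear)
    show "linear_map K B' B' (antipode B')"
      by simp (rule linear_cong[of _ "antipode B"]; simp add: antipode_linear)
    show "alpha B' \<one>\<^bsub>B'\<^esub> = \<one>\<^bsub>B'\<^esub>" by (simp add: alpha_one)
    show "comult B' \<one>\<^bsub>B'\<^esub> = pure K B' B' \<one>\<^bsub>B'\<^esub> \<one>\<^bsub>B'\<^esub>"
      by (simp add: comult_one tensor_alg_def)
    show "linear_map K B' (tensor K B' B') (comult B')"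
      by simp (rule linear_cong[of _ "\<lambda>a. comult B (\<gamma> a)"]; simp)
    show "counit B' \<one>\<^bsub>B'\<^esub> = \<one>\<^bsub>K\<^esub>" by (simp add: counit_one)
    fix a assume "a \<in> carrier B'"
    then have [simp]: "a \<in> carrier B" by simp
    show "linear_map K B' B' (\<lambda>b. b \<otimes>\<^bsub>B'\<^esub> a)"
      by simp (rule linear_cong[of _ "\<lambda>b. \<gamma> (b \<otimes>\<^bsub>B\<^esub> a)"]; simp del: endo_mult)
    show "linear_map K B' B' (\<lambda>b. a \<otimes>\<^bsub>B'\<^esub> b)"
      by simp (rule linear_cong[of _ "\<lambda>b. \<gamma> (a \<otimes>\<^bsub>B\<^esub> b)"]; simp del: endo_mult)
    show "\<one>\<^bsub>B'\<^esub> \<otimes>\<^bsub>B'\<^esub> a = alpha B' a" "a \<otimes>\<^bsub>B'\<^esub> \<one>\<^bsub>B'\<^esub> = alpha B' a"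
      by (simp_all add: one_mult mult_one del: endo_mult)
    show "counit B' (alpha B' a) = counit B' a" by (simp add: counit_alpha)
    show "comult B' (alpha B' a) =
      sw K B' B' (tensor K B' B') (comult B' a) (\<lambda>x y. pure K B' B' (alpha B' x) (alpha B' y))"
      using sw_pure_id[of K B B "comult B (\<gamma> (\<gamma> (alpha B a)))"]
      unfolding sp by (simp add: sw_endo sw_alpha)
    show "sw K B' B' B' (comult B' a) (\<lambda>x y. counit B' x \<odot>\<^bsub>B'\<^esub> y) = alpha B' a"
      using sw_counit_left[of B "\<lambda>x. x" "\<gamma> a"] unfolding sp by simp
    show "sw K B' B' B' (comult B' a) (\<lambda>x y. counit B' y \<odot>\<^bsub>B'\<^esub> x) = alpha B' a"
      using sw_counit_right[of B "\<lambda>x. x" "\<gamma> a"] unfolding sp by simp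
    show "sw K B' B' (tensor K B' (tensor K B' B')) (comult B' a) (\<lambda>x z.
        sw K B' B' (tensor K B' (tensor K B' B')) (comult B' x) (\<lambda>u v.
          pure K B' (tensor K B' B') u (pure K B' B' v (alpha B' z)))) =
      sw K B' B' (tensor K B' (tensor K B' B')) (comult B' a) (\<lambda>x z.
        pure K B' (tensor K B' B') (alpha B' x) (comult B' z))"
      \<comment> \<open>Each leaf collects \<open>\<gamma>\<close> twice: from two nested
        coproducts, or from one coproduct and the \<open>\<gamma>\<close> inside the new structure
        map.\<close>
      using sw_coassoc[of "tensor K B (tensor K B B)" a
          "\<lambda>u v w. pure K B (tensor K B B) (\<gamma> (\<gamma> u)) (pure K B B (\<gamma> (\<gamma> v)) (\<gamma> (\<gamma> w)))"]
      unfolding sp by (simp add: sw_endo pure_sw_right[of K B B B _ "comult B _"])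
    show "antipode B' (alpha B' a) = alpha B' (antipode B' a)" by (simp add: antipode_alpha)
    show "sw K B' B' B' (comult B' a) (\<lambda>x y. antipode B' x \<otimes>\<^bsub>B'\<^esub> y) = counit B' a \<odot>\<^bsub>B'\<^esub> \<one>\<^bsub>B'\<^esub>"
      using sw_antipode(1)[of B \<gamma> "\<gamma> a"] unfolding sp by (simp add: endo_linear)
    show "sw K B' B' B' (comult B' a) (\<lambda>x y. x \<otimes>\<^bsub>B'\<^esub> antipode B' y) = counit B' a \<odot>\<^bsub>B'\<^esub> \<one>\<^bsub>B'\<^esub>"
      using sw_antipode(2)[of B \<gamma> "\<gamma> a"] unfolding sp by (simp add: endo_linear)
    fix b assume "b \<in> carrier B'"
    then have [simp]: "b \<in> carrier B" by simp
    show "alpha B' (a \<otimes>\<^bsub>B'\<^esub> b) = alpha B' a \<otimes>\<^bsub>B'\<^esub> alpha B' b" by (simp add: alpha_mult)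
    show "comult B' (a \<otimes>\<^bsub>B'\<^esub> b) =
      sw K B' B' (tensor K B' B') (comult B' a) (\<lambda>h1 h2. sw K B' B' (tensor K B' B') (comult B' b) (\<lambda>g1 g2.
        pure K B' B' (h1 \<otimes>\<^bsub>B'\<^esub> g1) (h2 \<otimes>\<^bsub>B'\<^esub> g2)))"
      unfolding sp by (simp add: comult_mult tensor_alg_mult sw_endo sw_sw)
    show "counit B' (a \<otimes>\<^bsub>B'\<^esub> b) = counit B' a \<otimes>\<^bsub>K\<^esub> counit B' b" by (simp add: counit_mult)
    fix c assume "c \<in> carrier B'"
    then have [simp]: "c \<in> carrier B" by simp
    show "alpha B' a \<otimes>\<^bsub>B'\<^esub> (b \<otimes>\<^bsub>B'\<^esub> c) = (a \<otimes>\<^bsub>B'\<^esub> b) \<otimes>\<^bsub>B'\<^esub> alpha B' c"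
      by (simp add: hom_assoc endo_alpha[symmetric] del: endo_alpha)
  qed simp_all
qed

end

text \<open>Since \<open>1a = \<alpha>(a)\<close> and \<open>(\<epsilon> \<otimes> id)\<Delta> = \<alpha>\<close>, the ordinary product and coproduct are \<open>\<alpha>\<inverse> \<circ> \<mu>\<close> and \<open>\<Delta> \<circ> \<alpha>\<inverse>\<close>.\<close>

definition untwist :: "('k, 'a, 'm) hom_hopf_scheme \<Rightarrow> ('k, 'a, 'm) hom_hopf_scheme" where
  "untwist A = A\<lparr>mult := \<lambda>a b. ainv A (a \<otimes>\<^bsub>A\<^esub> b), alpha := \<lambda>a. a, comult := \<lambda>a. comult A (ainv A a)\<rparr>"

lemma untwist_simps [simp]:
  "carrier (untwist A) = carrier A" "zero (untwist A) = zero A" "add (untwist A) = add A"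
  "smult (untwist A) = smult A" "one (untwist A) = one A"
  "mult (untwist A) = (\<lambda>a b. ainv A (a \<otimes>\<^bsub>A\<^esub> b))" "alpha (untwist A) = (\<lambda>a. a)"
  "comult (untwist A) = (\<lambda>a. comult A (ainv A a))" "counit (untwist A) = counit A"
  "antipode (untwist A) = antipode A"
  by (simp_all add: untwist_def)

lemma same_space_untwist [simp]: "same_space A (untwist A)"
  by (simp add: same_space_def)

section \<open>Bijective structure maps and untwisting\<close>

locale hom_space_bij = hom_space +
  assumes alpha_bij: "bij_betw (alpha V) (carrier V) (carrier V)"
begin

lemma ainv_closed [simp]: "x \<in> carrier V \<Longrightarrow> ainv V x \<in> carrier V"
  and alpha_ainv [simp]: "x \<in> carrier V \<Longrightarrow> alpha V (ainv V x) = x"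
  and ainv_alpha [simp]: "x \<in> carrier V \<Longrightarrow> ainv V (alpha V x) = x"
  using alpha_bij unfolding ainv_def bij_betw_def
  by (auto simp: inv_into_into f_inv_into_f)

lemma ainv_eqI: "x \<in> carrier V \<Longrightarrow> alpha V x = y \<Longrightarrow> ainv V y = x"
  using ainv_alpha by blast

lemma ainv_linear: "linear_map K V V (ainv V)"
proof (rule linear_mapI)
  interpret V: module K V by simp
  fix x y assume "x \<in> carrier V" "y \<in> carrier V"
  then show "ainv V (x \<oplus>\<^bsub>V\<^esub> y) = ainv V x \<oplus>\<^bsub>V\<^esub> ainv V y"
    by (intro ainv_eqI) (simp_all add: linear_map_add[OF alpha_linear])
next
  interpret V: module K V by simp
  fix r x assume "r \<in> carrier K" "x \<in> carrier V"
  then show "ainv V (r \<odot>\<^bsub>V\<^esub> x) = r \<odot>\<^bsub>V\<^esub> ainv V x"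
    by (intro ainv_eqI) (simp_all add: linear_map_smult[OF alpha_linear])
qed simp

lemma linear_ainv [simp]: "linear_map K X V f \<Longrightarrow> linear_map K X V (\<lambda>x. ainv V (f x))"
  by (rule linear_map_comp[OF _ ainv_linear])

end

locale hom_hopf_bij = hom_hopf_algebra K H + hom_space_bij K H
  for K :: "('k, 'r) ring_scheme" and H :: "('k, 'h, 'm) hom_hopf_scheme"
begin

sublocale alpha: hom_hopf_endomorphism K H "alpha H"
  by unfold_locales
    (simp_all add: alpha_linear alpha_mult alpha_one counit_alpha antipode_alpha alpha_comult[symmetric]
      tensor_map_sw[of K H H])

lemma comult_ainv:
  assumes x: "x \<in> carrier H"
  shows "comult H (ainv H x) = sw K H H (tensor K H H) (comult H x) (\<lambda>x y. pure K H H (ainv H x) (ainv H y))"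
  using x sw_alpha[of "tensor K H H" "ainv H x" "\<lambda>x y. pure K H H (ainv H x) (ainv H y)"]
  by (simp add: sw_pure_id)

sublocale ainv: hom_hopf_endomorphism K H "ainv H"
proof unfold_locales
  fix x assume x: "x \<in> carrier H"
  show "comult H (ainv H x) = sw K H H (tensor K H H) (comult H x) (\<lambda>x y. pure K H H (ainv H x) (ainv H y))"
    by (rule comult_ainv[OF x])
  show "alpha H (ainv H x) = ainv H (alpha H x)" using x by simp
  show "counit H (ainv H x) = counit H x" using x counit_alpha[of "ainv H x"] by simp
  show "antipode H (ainv H x) = ainv H (antipode H x)"
    using x antipode_alpha[of "ainv H x"] by (intro ainv_eqI[symmetric]) simp_all
  fix y assume y: "y \<in> carrier H"
  show "ainv H (x \<otimes>\<^bsub>H\<^esub> y) = ainv H x \<otimes>\<^bsub>H\<^esub> ainv H y"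
    using x y by (intro ainv_eqI) (simp_all add: alpha_mult)
next
  show "ainv H \<one>\<^bsub>H\<^esub> = \<one>\<^bsub>H\<^esub>" by (rule ainv_eqI) (simp_all add: alpha_one)
qed (rule ainv_linear)

text \<open>Twisting by the inverse cancels the structure map: the new one is
  \<open>ainv H (alpha H x) = x\<close>.\<close>

lemma untwist_hopf: "hom_hopf_algebra K (untwist H)"
  by (rule ainv.twist) simp_all

end

lemma (in hom_assoc_algebra) mult_pull:
  assumes "module K V" "module K W" "t \<in> carrier (tensor K V W)"
    "\<And>v w. v \<in> carrier V \<Longrightarrow> w \<in> carrier W \<Longrightarrow> F v w \<in> carrier A" "a \<in> carrier A"
  shows "sw K V W A t F \<otimes>\<^bsub>A\<^esub> a = sw K V W A t (\<lambda>v w. F v w \<otimes>\<^bsub>A\<^esub> a)"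
    and "a \<otimes>\<^bsub>A\<^esub> sw K V W A t F = sw K V W A t (\<lambda>v w. a \<otimes>\<^bsub>A\<^esub> F v w)"
  using assms sw_push[of K V W A A "\<lambda>x. x \<otimes>\<^bsub>A\<^esub> a" t F] sw_push[of K V W A A "\<lambda>x. a \<otimes>\<^bsub>A\<^esub> x" t F]
  by simp_all

lemma (in hom_bialgebra) sw_comult_mult:
  assumes "module K U" "h \<in> carrier H" "g \<in> carrier H"
    "\<And>v. v \<in> carrier H \<Longrightarrow> linear_map K H U (F v)"
    "\<And>w. w \<in> carrier H \<Longrightarrow> linear_map K H U (\<lambda>v. F v w)"
  shows "sw K H H U (comult H (h \<otimes>\<^bsub>H\<^esub> g)) F =
    sw K H H U (comult H h) (\<lambda>h1 h2. sw K H H U (comult H g) (\<lambda>g1 g2. F (h1 \<otimes>\<^bsub>H\<^esub> g1) (h2 \<otimes>\<^bsub>H\<^esub> g2)))"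
  using assms by (simp add: comult_mult tensor_alg_mult sw_sw)

lemma (in hom_bialgebra) sw_comult_one:
  assumes "module K U"
    "\<And>v. v \<in> carrier H \<Longrightarrow> linear_map K H U (F v)"
    "\<And>w. w \<in> carrier H \<Longrightarrow> linear_map K H U (\<lambda>v. F v w)"
  shows "sw K H H U (comult H \<one>\<^bsub>H\<^esub>) F = F \<one>\<^bsub>H\<^esub> \<one>\<^bsub>H\<^esub>"
  using assms by (simp add: comult_one tensor_alg_def)

lemma (in hom_assoc_algebra) mult_smult:
  assumes "a \<in> carrier A" "b \<in> carrier A" "r \<in> carrier K"
  shows "(r \<odot>\<^bsub>A\<^esub> a) \<otimes>\<^bsub>A\<^esub> b = r \<odot>\<^bsub>A\<^esub> (a \<otimes>\<^bsub>A\<^esub> b)" "a \<otimes>\<^bsub>A\<^esub> (r \<odot>\<^bsub>A\<^esub> b) = r \<odot>\<^bsub>A\<^esub> (a \<otimes>\<^bsub>A\<^esub> b)"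
  using assms linear_map_smult[OF mult_linear(1)] linear_map_smult[OF mult_linear(2)] by simp_all

lemma pure_smult:
  assumes "module K V" "module K W" "v \<in> carrier V" "w \<in> carrier W" "r \<in> carrier K"
  shows "pure K V W (r \<odot>\<^bsub>V\<^esub> v) w = r \<odot>\<^bsub>tensor K V W\<^esub> pure K V W v w"
    and "pure K V W v (r \<odot>\<^bsub>W\<^esub> w) = r \<odot>\<^bsub>tensor K V W\<^esub> pure K V W v w"
  using assms linear_map_smult[of K V "tensor K V W" "\<lambda>v. pure K V W v w" r v]
    linear_map_smult[of K W "tensor K V W" "\<lambda>w. pure K V W v w" r w] by simp_all

lemma pure_pull:
  assumes "module K V" "module K W" "t \<in> carrier (tensor K V W)" "module K X" "module K Y"
  shows "y \<in> carrier Y \<Longrightarrow> (\<And>v w. v \<in> carrier V \<Longrightarrow> w \<in> carrier W \<Longrightarrow> F v w \<in> carrier X) \<Longrightarrow>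
      pure K X Y (sw K V W X t F) y = sw K V W (tensor K X Y) t (\<lambda>v w. pure K X Y (F v w) y)"
    and "x \<in> carrier X \<Longrightarrow> (\<And>v w. v \<in> carrier V \<Longrightarrow> w \<in> carrier W \<Longrightarrow> G v w \<in> carrier Y) \<Longrightarrow>
      pure K X Y x (sw K V W Y t G) = sw K V W (tensor K X Y) t (\<lambda>v w. pure K X Y x (G v w))"
  using assms sw_push[of K V W X "tensor K X Y" "\<lambda>z. pure K X Y z y" t F]
    sw_push[of K V W Y "tensor K X Y" "\<lambda>z. pure K X Y x z" t G]
  by simp_all

section \<open>The bicrossproduct of ordinary Hopf algebras\<close>

text \<open>
  Here both structure maps are the identity, so that the last three axioms are the compatibility
  conditions of Majid's bicrossproduct.
\<close>

locale matched_hopf_pair =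
  A: hom_hopf_algebra K A + H: hom_hopf_algebra K H
  for K :: "('k, 'r) ring_scheme" and A :: "('k, 'a, 'm) hom_hopf_scheme"
    and H :: "('k, 'h, 'n) hom_hopf_scheme" +
  fixes act :: "'h \<Rightarrow> 'a \<Rightarrow> 'a" and coact :: "'h \<Rightarrow> ('h \<times> 'a \<Rightarrow> 'k) set"
  assumes alpha_A [simp]: "a \<in> carrier A \<Longrightarrow> alpha A a = a"
    and alpha_H [simp]: "h \<in> carrier H \<Longrightarrow> alpha H h = h"
    and act_linear1: "a \<in> carrier A \<Longrightarrow> linear_map K H A (\<lambda>h. act h a)"
    and act_linear2: "h \<in> carrier H \<Longrightarrow> linear_map K A A (act h)"
    and one_act [simp]: "a \<in> carrier A \<Longrightarrow> act \<one>\<^bsub>H\<^esub> a = a"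
    and act_act: "\<lbrakk>h \<in> carrier H; g \<in> carrier H; a \<in> carrier A\<rbrakk> \<Longrightarrow> act h (act g a) = act (h \<otimes>\<^bsub>H\<^esub> g) a"
    and act_mult: "\<lbrakk>h \<in> carrier H; a \<in> carrier A; b \<in> carrier A\<rbrakk> \<Longrightarrow>
      act h (a \<otimes>\<^bsub>A\<^esub> b) = sw K H H A (comult H h) (\<lambda>h1 h2. act h1 a \<otimes>\<^bsub>A\<^esub> act h2 b)"
    and act_one: "h \<in> carrier H \<Longrightarrow> act h \<one>\<^bsub>A\<^esub> = counit H h \<odot>\<^bsub>A\<^esub> \<one>\<^bsub>A\<^esub>"
    and coact_linear: "linear_map K H (tensor K H A) coact"
    and coact_counit: "h \<in> carrier H \<Longrightarrow> sw K H A H (coact h) (\<lambda>x y. counit A y \<odot>\<^bsub>H\<^esub> x) = h"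
    and coact_coassoc: "h \<in> carrier H \<Longrightarrow>
      sw K H A (tensor K H (tensor K A A)) (coact h) (\<lambda>x z.
        sw K H A (tensor K H (tensor K A A)) (coact x) (\<lambda>u v.
          pure K H (tensor K A A) u (pure K A A v z))) =
      sw K H A (tensor K H (tensor K A A)) (coact h) (\<lambda>x y. pure K H (tensor K A A) x (comult A y))"
    and counit_coact: "h \<in> carrier H \<Longrightarrow>
      sw K H A A (coact h) (\<lambda>x y. counit H x \<odot>\<^bsub>A\<^esub> y) = counit H h \<odot>\<^bsub>A\<^esub> \<one>\<^bsub>A\<^esub>"
    and comult_coact: "h \<in> carrier H \<Longrightarrow>
      sw K H A (tensor K (tensor K H H) A) (coact h) (\<lambda>x y. pure K (tensor K H H) A (comult H x) y) =
      sw K H H (tensor K (tensor K H H) A) (comult H h) (\<lambda>x y.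
        sw K H A (tensor K (tensor K H H) A) (coact x) (\<lambda>x0 x1.
          sw K H A (tensor K (tensor K H H) A) (coact y) (\<lambda>y0 y1.
            pure K (tensor K H H) A (pure K H H x0 y0) (x1 \<otimes>\<^bsub>A\<^esub> y1))))"
    and comult_act: "\<lbrakk>h \<in> carrier H; b \<in> carrier A\<rbrakk> \<Longrightarrow> comult A (act h b) =
      sw K H H (tensor K A A) (comult H h) (\<lambda>h1 h2.
        sw K H A (tensor K A A) (coact h1) (\<lambda>h10 h11.
          sw K A A (tensor K A A) (comult A b) (\<lambda>b1 b2.
            pure K A A (act h10 b1) (h11 \<otimes>\<^bsub>A\<^esub> act h2 b2))))"
    and counit_act: "\<lbrakk>h \<in> carrier H; b \<in> carrier A\<rbrakk> \<Longrightarrow>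
      counit A (act h b) = counit A b \<otimes>\<^bsub>K\<^esub> counit H h"
    and coact_mult: "\<lbrakk>h \<in> carrier H; g \<in> carrier H\<rbrakk> \<Longrightarrow> coact (h \<otimes>\<^bsub>H\<^esub> g) =
      sw K H H (tensor K H A) (comult H h) (\<lambda>h1 h2.
        sw K H A (tensor K H A) (coact h1) (\<lambda>h10 h11.
          sw K H A (tensor K H A) (coact g) (\<lambda>g0 g1.
            pure K H A (h10 \<otimes>\<^bsub>H\<^esub> g0) (h11 \<otimes>\<^bsub>A\<^esub> act h2 g1))))"
    and act_coact: "\<lbrakk>h \<in> carrier H; b \<in> carrier A\<rbrakk> \<Longrightarrow>
      sw K H H (tensor K H A) (comult H h) (\<lambda>h1 h2.
        sw K H A (tensor K H A) (coact h2) (\<lambda>h20 h21. pure K H A h20 (act h1 b \<otimes>\<^bsub>A\<^esub> h21))) =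
      sw K H H (tensor K H A) (comult H h) (\<lambda>h1 h2.
        sw K H A (tensor K H A) (coact h1) (\<lambda>h10 h11. pure K H A h10 (h11 \<otimes>\<^bsub>A\<^esub> act h2 b)))"
begin

section \<open>Sweedler calculus of a matched pair\<close>

abbreviation dA where "dA U a F \<equiv> sw K A A U (comult A a) F"
abbreviation dH where "dH U h F \<equiv> sw K H H U (comult H h) F"
abbreviation dC where "dC U h F \<equiv> sw K H A U (coact h) F"
abbreviation T where "T \<equiv> tensor K A H"
abbreviation TT where "TT \<equiv> tensor K T T"
abbreviation p where "p \<equiv> pure K A H"

lemma act_closed [simp]: "h \<in> carrier H \<Longrightarrow> a \<in> carrier A \<Longrightarrow> act h a \<in> carrier A"
  by (rule linear_map_closed[OF act_linear2])

lemma linear_act1 [simp]: "linear_map K X H f \<Longrightarrow> a \<in> carrier A \<Longrightarrow> linear_map K X A (\<lambda>x. act (f x) a)"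
  by (rule linear_map_comp[OF _ act_linear1])

lemma linear_act2 [simp]: "linear_map K X A f \<Longrightarrow> h \<in> carrier H \<Longrightarrow> linear_map K X A (\<lambda>x. act h (f x))"
  by (rule linear_map_comp[OF _ act_linear2])

lemma coact_closed [simp]: "h \<in> carrier H \<Longrightarrow> coact h \<in> carrier (tensor K H A)"
  by (rule linear_map_closed[OF coact_linear])

lemma linear_coact [simp]: "linear_map K X H f \<Longrightarrow> linear_map K X (tensor K H A) (\<lambda>x. coact (f x))"
  by (rule linear_map_comp[OF _ coact_linear])

lemma act_pull:
  assumes "module K V" "module K W" "t \<in> carrier (tensor K V W)"
  shows "h \<in> carrier H \<Longrightarrow> (\<And>v w. v \<in> carrier V \<Longrightarrow> w \<in> carrier W \<Longrightarrow> F v w \<in> carrier A) \<Longrightarrow>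
      act h (sw K V W A t F) = sw K V W A t (\<lambda>v w. act h (F v w))"
  using assms sw_push[of K V W A A "\<lambda>x. act h x" t F] by simp

lemma sw_counit_H:
  assumes "module K U" "linear_map K H U f" "h \<in> carrier H"
  shows "dH U h (\<lambda>x y. counit H x \<odot>\<^bsub>U\<^esub> f y) = f h" "dH U h (\<lambda>x y. counit H y \<odot>\<^bsub>U\<^esub> f x) = f h"
    "dC U h (\<lambda>x y. counit A y \<odot>\<^bsub>U\<^esub> f x) = f h"
  using assms sw_push[of K H A H U f "coact h" "\<lambda>x y. counit A y \<odot>\<^bsub>H\<^esub> x"]
  by (simp_all add: H.sw_counit_left H.sw_counit_right coact_counit linear_map_smult)

lemma sw_counit_A:
  assumes "module K U" "linear_map K A U f" "a \<in> carrier A"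
  shows "dA U a (\<lambda>x y. counit A x \<odot>\<^bsub>U\<^esub> f y) = f a" "dA U a (\<lambda>x y. counit A y \<odot>\<^bsub>U\<^esub> f x) = f a"
  using assms by (simp_all add: A.sw_counit_left A.sw_counit_right)

lemma sw_counit_coact:
  assumes "module K U" "linear_map K A U f" "h \<in> carrier H"
  shows "dC U h (\<lambda>x y. counit H x \<odot>\<^bsub>U\<^esub> f y) = counit H h \<odot>\<^bsub>U\<^esub> f \<one>\<^bsub>A\<^esub>"
  using assms sw_push[of K H A A U f "coact h" "\<lambda>x y. counit H x \<odot>\<^bsub>A\<^esub> y"]
  by (simp_all add: counit_coact linear_map_smult)

lemmas sw_counits = sw_counit_H sw_counit_A sw_counit_coact

lemma dH_coassoc:
  assumes "module K U" "h \<in> carrier H"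
    "\<And>v w. v \<in> carrier H \<Longrightarrow> w \<in> carrier H \<Longrightarrow> linear_map K H U (\<lambda>u. F u v w)"
    "\<And>u w. u \<in> carrier H \<Longrightarrow> w \<in> carrier H \<Longrightarrow> linear_map K H U (\<lambda>v. F u v w)"
    "\<And>u v. u \<in> carrier H \<Longrightarrow> v \<in> carrier H \<Longrightarrow> linear_map K H U (\<lambda>w. F u v w)"
  shows "dH U h (\<lambda>x z. dH U x (\<lambda>u v. F u v z)) = dH U h (\<lambda>x y. dH U y (\<lambda>u v. F x u v))"
  using H.sw_coassoc[OF assms(1,2), of F] assms(3-) by simp

lemma dA_coassoc:
  assumes "module K U" "h \<in> carrier A"
    "\<And>v w. v \<in> carrier A \<Longrightarrow> w \<in> carrier A \<Longrightarrow> linear_map K A U (\<lambda>u. F u v w)"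
    "\<And>u w. u \<in> carrier A \<Longrightarrow> w \<in> carrier A \<Longrightarrow> linear_map K A U (\<lambda>v. F u v w)"
    "\<And>u v. u \<in> carrier A \<Longrightarrow> v \<in> carrier A \<Longrightarrow> linear_map K A U (\<lambda>w. F u v w)"
  shows "dA U h (\<lambda>x z. dA U x (\<lambda>u v. F u v z)) = dA U h (\<lambda>x y. dA U y (\<lambda>u v. F x u v))"
  using A.sw_coassoc[OF assms(1,2), of F] assms(3-) by simp

lemma dC_coassoc:
  assumes "module K U" "h \<in> carrier H"
    "\<And>v w. v \<in> carrier A \<Longrightarrow> w \<in> carrier A \<Longrightarrow> linear_map K H U (\<lambda>u. F u v w)"
    "\<And>u w. u \<in> carrier H \<Longrightarrow> w \<in> carrier A \<Longrightarrow> linear_map K A U (\<lambda>v. F u v w)"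
    "\<And>u v. u \<in> carrier H \<Longrightarrow> v \<in> carrier A \<Longrightarrow> linear_map K A U (\<lambda>w. F u v w)"
  shows "dC U h (\<lambda>x z. dC U x (\<lambda>u v. F u v z)) = dC U h (\<lambda>x y. dA U y (\<lambda>u v. F x u v))"
  using arg_cong[OF coact_coassoc[OF assms(2)],
      of "\<lambda>t. sw K H (tensor K A A) U t (\<lambda>x s. sw K A A U s (\<lambda>u v. F x u v))"] assms
  by (simp add: sw_sw)

lemma dC_comult:
  assumes "module K U" "h \<in> carrier H"
    "\<And>v w. v \<in> carrier H \<Longrightarrow> w \<in> carrier A \<Longrightarrow> linear_map K H U (\<lambda>u. F u v w)"
    "\<And>u w. u \<in> carrier H \<Longrightarrow> w \<in> carrier A \<Longrightarrow> linear_map K H U (\<lambda>v. F u v w)"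
    "\<And>u v. u \<in> carrier H \<Longrightarrow> v \<in> carrier H \<Longrightarrow> linear_map K A U (\<lambda>w. F u v w)"
  shows "dC U h (\<lambda>x y. dH U x (\<lambda>u v. F u v y)) =
    dH U h (\<lambda>x y. dC U x (\<lambda>x0 x1. dC U y (\<lambda>y0 y1. F x0 y0 (x1 \<otimes>\<^bsub>A\<^esub> y1))))"
  using arg_cong[OF comult_coact[OF assms(2)],
      of "\<lambda>t. sw K (tensor K H H) A U t (\<lambda>s y. sw K H H U s (\<lambda>u v. F u v y))"] assms
  by (simp add: sw_sw)

lemma dA_act:
  assumes "module K U" "h \<in> carrier H" "b \<in> carrier A"
    "\<And>v. v \<in> carrier A \<Longrightarrow> linear_map K A U (F v)"
    "\<And>w. w \<in> carrier A \<Longrightarrow> linear_map K A U (\<lambda>v. F v w)"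
  shows "dA U (act h b) F = dH U h (\<lambda>h1 h2. dC U h1 (\<lambda>h10 h11. dA U b (\<lambda>b1 b2.
    F (act h10 b1) (h11 \<otimes>\<^bsub>A\<^esub> act h2 b2))))"
  using assms by (simp add: comult_act sw_sw)

lemma dC_mult:
  assumes "module K U" "h \<in> carrier H" "g \<in> carrier H"
    "\<And>v. v \<in> carrier H \<Longrightarrow> linear_map K A U (F v)"
    "\<And>w. w \<in> carrier A \<Longrightarrow> linear_map K H U (\<lambda>v. F v w)"
  shows "dC U (h \<otimes>\<^bsub>H\<^esub> g) F = dH U h (\<lambda>h1 h2. dC U h1 (\<lambda>h10 h11. dC U g (\<lambda>g0 g1.
    F (h10 \<otimes>\<^bsub>H\<^esub> g0) (h11 \<otimes>\<^bsub>A\<^esub> act h2 g1))))"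
  using assms by (simp add: coact_mult sw_sw)

lemma dC_act:
  assumes "module K U" "h \<in> carrier H" "b \<in> carrier A"
    "\<And>v. v \<in> carrier H \<Longrightarrow> linear_map K A U (F v)"
    "\<And>w. w \<in> carrier A \<Longrightarrow> linear_map K H U (\<lambda>v. F v w)"
  shows "dH U h (\<lambda>h1 h2. dC U h2 (\<lambda>h20 h21. F h20 (act h1 b \<otimes>\<^bsub>A\<^esub> h21))) =
    dH U h (\<lambda>h1 h2. dC U h1 (\<lambda>h10 h11. F h10 (h11 \<otimes>\<^bsub>A\<^esub> act h2 b)))"
  using arg_cong[OF act_coact[OF assms(2,3)], of "\<lambda>t. sw K H A U t F"] assms
  by (simp add: sw_sw)

section \<open>The smash product algebra\<close>

definition bmult where
  "bmult s t = sw K A H T s (\<lambda>a h. sw K A H T t (\<lambda>b g. dH T h (\<lambda>h1 h2. p (a \<otimes>\<^bsub>A\<^esub> act h1 b) (h2 \<otimes>\<^bsub>H\<^esub> g))))"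

lemma assocA: "\<lbrakk>a \<in> carrier A; b \<in> carrier A; c \<in> carrier A\<rbrakk> \<Longrightarrow> (a \<otimes>\<^bsub>A\<^esub> b) \<otimes>\<^bsub>A\<^esub> c = a \<otimes>\<^bsub>A\<^esub> (b \<otimes>\<^bsub>A\<^esub> c)"
  using A.hom_assoc[of a b c] by simp

lemma assocH: "\<lbrakk>a \<in> carrier H; b \<in> carrier H; c \<in> carrier H\<rbrakk> \<Longrightarrow> (a \<otimes>\<^bsub>H\<^esub> b) \<otimes>\<^bsub>H\<^esub> c = a \<otimes>\<^bsub>H\<^esub> (b \<otimes>\<^bsub>H\<^esub> c)"
  using H.hom_assoc[of a b c] by simp

lemma units [simp]:
  "a \<in> carrier A \<Longrightarrow> \<one>\<^bsub>A\<^esub> \<otimes>\<^bsub>A\<^esub> a = a" "a \<in> carrier A \<Longrightarrow> a \<otimes>\<^bsub>A\<^esub> \<one>\<^bsub>A\<^esub> = a"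
  "h \<in> carrier H \<Longrightarrow> \<one>\<^bsub>H\<^esub> \<otimes>\<^bsub>H\<^esub> h = h" "h \<in> carrier H \<Longrightarrow> h \<otimes>\<^bsub>H\<^esub> \<one>\<^bsub>H\<^esub> = h"
  using A.one_mult[of a] A.mult_one[of a] H.one_mult[of h] H.mult_one[of h] by simp_all

lemma bmult_closed [simp]: "s \<in> carrier T \<Longrightarrow> t \<in> carrier T \<Longrightarrow> bmult s t \<in> carrier T"
  by (simp add: bmult_def)

lemma linear_bmult1 [simp]: "linear_map K X T f \<Longrightarrow> t \<in> carrier T \<Longrightarrow> module K X \<Longrightarrow> linear_map K X T (\<lambda>x. bmult (f x) t)"
  by (simp add: bmult_def)

lemma linear_bmult2 [simp]: "linear_map K X T f \<Longrightarrow> s \<in> carrier T \<Longrightarrow> module K X \<Longrightarrow> linear_map K X T (\<lambda>x. bmult s (f x))"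
  by (simp add: bmult_def)

lemma T_eqI:
  assumes "module K U" "linear_map K T U f" "linear_map K T U g"
    "\<And>a h. a \<in> carrier A \<Longrightarrow> h \<in> carrier H \<Longrightarrow> f (p a h) = g (p a h)" "t \<in> carrier T"
  shows "f t = g t"
  by (rule linear_eq_on_pure[of K A H U f g]) (use assms in auto)

lemma T_eqI3:
  assumes U: "module K U"
    and f: "\<And>s t. s \<in> carrier T \<Longrightarrow> t \<in> carrier T \<Longrightarrow> linear_map K T U (\<lambda>r. f r s t)"
      "\<And>s t. s \<in> carrier T \<Longrightarrow> t \<in> carrier T \<Longrightarrow> linear_map K T U (\<lambda>r. f s r t)"
      "\<And>s t. s \<in> carrier T \<Longrightarrow> t \<in> carrier T \<Longrightarrow> linear_map K T U (\<lambda>r. f s t r)"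
    and g: "\<And>s t. s \<in> carrier T \<Longrightarrow> t \<in> carrier T \<Longrightarrow> linear_map K T U (\<lambda>r. g r s t)"
      "\<And>s t. s \<in> carrier T \<Longrightarrow> t \<in> carrier T \<Longrightarrow> linear_map K T U (\<lambda>r. g s r t)"
      "\<And>s t. s \<in> carrier T \<Longrightarrow> t \<in> carrier T \<Longrightarrow> linear_map K T U (\<lambda>r. g s t r)"
    and eq: "\<And>a h b g' c k. \<lbrakk>a \<in> carrier A; h \<in> carrier H; b \<in> carrier A; g' \<in> carrier H; c \<in> carrier A; k \<in> carrier H\<rbrakk>
      \<Longrightarrow> f (p a h) (p b g') (p c k) = g (p a h) (p b g') (p c k)"
    and s: "s \<in> carrier T" and t: "t \<in> carrier T" and r: "r \<in> carrier T"
  shows "f s t r = g s t r"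
proof -
  have 1: "f (p a h) (p b g') r = g (p a h) (p b g') r"
    if "a \<in> carrier A" "h \<in> carrier H" "b \<in> carrier A" "g' \<in> carrier H" for a h b g'
    by (rule T_eqI[OF U f(3) g(3) eq r]) (use that in simp_all)
  have 2: "f (p a h) t r = g (p a h) t r" if "a \<in> carrier A" "h \<in> carrier H" for a h
    by (rule T_eqI[OF U f(2) g(2) 1 t]) (use that r in simp_all)
  show ?thesis
    by (rule T_eqI[OF U f(1) g(1) 2 s]) (use t r in simp_all)
qed

text \<open>All oriented outwards: sums leave products, actions and pure tensors, until a term is a
  nest of sums around a single pure tensor.\<close>

lemmas pulls = pure_pull A.mult_pull H.mult_pull act_pull

text \<open>One side splits \<open>h\<close> by multiplicativity of \<open>comult H\<close>, the
  other by \<open>act_mult\<close>; the two threefold splittings agree by coassociativity. The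
  exchange rule is pinned to \<open>comult H g\<close>, whose sum moves inwards, so that it cannot
  loop.\<close>

lemma bmult_assoc_pure:
  assumes [simp]: "a \<in> carrier A" "h \<in> carrier H" "b \<in> carrier A" "g \<in> carrier H" "c \<in> carrier A" "k \<in> carrier H"
  shows "bmult (bmult (p a h) (p b g)) (p c k) = bmult (p a h) (bmult (p b g) (p c k))"
  by (simp add: bmult_def sw_sw H.sw_comult_mult act_mult pulls assocA assocH act_act dH_coassoc
    sw_swap[of K H H _ _ _ "comult H g"])

lemma bmult_assoc:
  assumes "s \<in> carrier T" "t \<in> carrier T" "r \<in> carrier T"
  shows "bmult (bmult s t) r = bmult s (bmult t r)"
  by (rule T_eqI3[where f = "\<lambda>s t r. bmult (bmult s t) r" and g = "\<lambda>s t r. bmult s (bmult t r)" and U = T])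
    (simp_all add: assms bmult_assoc_pure)

lemma bmult_units:
  assumes "t \<in> carrier T"
  shows "bmult (p \<one>\<^bsub>A\<^esub> \<one>\<^bsub>H\<^esub>) t = t" "bmult t (p \<one>\<^bsub>A\<^esub> \<one>\<^bsub>H\<^esub>) = t"
  by (rule T_eqI[where U = T, OF _ _ _ _ assms];
      simp add: bmult_def H.sw_comult_one act_one sw_counits A.mult_smult pure_smult)+

section \<open>The smash coproduct and its coassociativity\<close>

definition bcomult where
  "bcomult t = sw K A H TT t (\<lambda>a h. dA TT a (\<lambda>a1 a2. dH TT h (\<lambda>h1 h2. dC TT h1 (\<lambda>x y.
    pure K T T (p a1 x) (p (a2 \<otimes>\<^bsub>A\<^esub> y) h2)))))"

lemma bcomult_closed [simp]: "t \<in> carrier T \<Longrightarrow> bcomult t \<in> carrier TT"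
  by (simp add: bcomult_def)

lemma linear_bcomult [simp]: "linear_map K X T f \<Longrightarrow> linear_map K X TT (\<lambda>x. bcomult (f x))"
  by (simp add: bcomult_def)

lemma sw_bcomult_pure:
  assumes "module K U" "a \<in> carrier A" "h \<in> carrier H"
    "\<And>v. v \<in> carrier T \<Longrightarrow> linear_map K T U (F v)"
    "\<And>w. w \<in> carrier T \<Longrightarrow> linear_map K T U (\<lambda>v. F v w)"
  shows "sw K T T U (bcomult (p a h)) F = dA U a (\<lambda>a1 a2. dH U h (\<lambda>h1 h2. dC U h1 (\<lambda>x y.
    F (p a1 x) (p (a2 \<otimes>\<^bsub>A\<^esub> y) h2))))"
  using assms by (simp add: bcomult_def sw_sw)

text \<open>Together with \<open>comult_H_out\<close> this fixes a normal order of independent sums: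
  coproducts of \<open>A\<close> outside, then coproducts of \<open>H\<close>, with coactions
  innermost.\<close>

lemma comult_A_out:
  assumes "module K U" "h \<in> carrier H" "a \<in> carrier A"
  shows "(\<And>v w x y. \<lbrakk>v \<in> carrier H; w \<in> carrier H; x \<in> carrier A; y \<in> carrier A\<rbrakk> \<Longrightarrow> f v w x y \<in> carrier U) \<Longrightarrow>
      dH U h (\<lambda>v w. dA U a (f v w)) = dA U a (\<lambda>x y. dH U h (\<lambda>v w. f v w x y))"
    and "(\<And>v w x y. \<lbrakk>v \<in> carrier H; w \<in> carrier A; x \<in> carrier A; y \<in> carrier A\<rbrakk> \<Longrightarrow> g v w x y \<in> carrier U) \<Longrightarrow>
      dC U h (\<lambda>v w. dA U a (g v w)) = dA U a (\<lambda>x y. dC U h (\<lambda>v w. g v w x y))"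
  by (rule sw_swap; use assms in simp)+

lemma comult_H_out:
  assumes "module K U" "h \<in> carrier H" "h' \<in> carrier H"
    and "\<And>v w x y. \<lbrakk>v \<in> carrier H; w \<in> carrier A; x \<in> carrier H; y \<in> carrier H\<rbrakk> \<Longrightarrow> f v w x y \<in> carrier U"
  shows "dC U h (\<lambda>v w. dH U h' (f v w)) = dH U h' (\<lambda>x y. dC U h (\<lambda>v w. f v w x y))"
  by (rule sw_swap) (use assms in simp_all)

abbreviation TTT where "TTT \<equiv> tensor K T TT"

text \<open>Here the coaction of the first leg \<open>x\<close> is the inner one. If
  \<open>F\<close> coacts once more on \<open>x0\<close>, the two coactions on \<open>x\<close>
  become adjacent and \<open>dC_coassoc\<close> matches.\<close>

lemma dC_comult':
  assumes "module K U" "h \<in> carrier H"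
    "\<And>v w. v \<in> carrier H \<Longrightarrow> w \<in> carrier A \<Longrightarrow> linear_map K H U (\<lambda>u. F u v w)"
    "\<And>u w. u \<in> carrier H \<Longrightarrow> w \<in> carrier A \<Longrightarrow> linear_map K H U (\<lambda>v. F u v w)"
    "\<And>u v. u \<in> carrier H \<Longrightarrow> v \<in> carrier H \<Longrightarrow> linear_map K A U (\<lambda>w. F u v w)"
  shows "dC U h (\<lambda>x y. dH U x (\<lambda>u v. F u v y)) =
    dH U h (\<lambda>x y. dC U y (\<lambda>y0 y1. dC U x (\<lambda>x0 x1. F x0 y0 (x1 \<otimes>\<^bsub>A\<^esub> y1))))"
proof -
  have [simp]: "F u v w \<in> carrier U" if "u \<in> carrier H" "v \<in> carrier H" "w \<in> carrier A" for u v w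
    using linear_map_closed[OF assms(3)] that by blast
  have "dC U x (\<lambda>x0 x1. dC U y (\<lambda>y0 y1. F x0 y0 (x1 \<otimes>\<^bsub>A\<^esub> y1))) =
    dC U y (\<lambda>y0 y1. dC U x (\<lambda>x0 x1. F x0 y0 (x1 \<otimes>\<^bsub>A\<^esub> y1)))"
    if "x \<in> carrier H" "y \<in> carrier H" for x y
    by (rule sw_swap) (use assms(1) that in simp_all)
  then show ?thesis using dC_comult[OF assms] by (simp cong: sw_cong)
qed

text \<open>The coproduct of \<open>q\<close> is tied to the coaction that yields \<open>q\<close>,
  so these two sums pass the sums over \<open>g\<close> as a block; single exchanges guided by the
  normal order do not achieve this.\<close>

lemma bcomult_coassoc_swap:
  assumes [simp]: "module K U" "h \<in> carrier H" "g \<in> carrier H"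
    "\<And>x y z v s t. \<lbrakk>x \<in> carrier H; y \<in> carrier A; z \<in> carrier A; v \<in> carrier H; s \<in> carrier H; t \<in> carrier A\<rbrakk>
      \<Longrightarrow> G x y z v s t \<in> carrier U"
  shows "dC U h (\<lambda>x q. dA U q (\<lambda>y z. dH U g (\<lambda>u v. dC U u (\<lambda>s t. G x y z v s t)))) =
    dH U g (\<lambda>u v. dC U u (\<lambda>s t. dC U h (\<lambda>x q. dA U q (\<lambda>y z. G x y z v s t))))"
proof -
  have 1: "dC U u (\<lambda>s t. dC U h (\<lambda>x q. dA U q (\<lambda>y z. G x y z v s t))) =
      dC U h (\<lambda>x q. dA U q (\<lambda>y z. dC U u (\<lambda>s t. G x y z v s t)))"
    if [simp]: "u \<in> carrier H" "v \<in> carrier H" for u v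
    by (simp add: sw_swap[of K H A _ _ _ "coact u"])
  show ?thesis by (simp add: 1 sw_swap[of K H H _ _ _ "comult H g"])
qed

text \<open>On the left, \<open>bcomult\<close> of the first leg coacts a second time.
  \<open>comult_coact\<close> distributes the outer coaction over the coproduct below it, and
  \<open>coact_coassoc\<close> turns the repeated coaction into a coproduct in \<open>A\<close>. The
  right side produces the same coproduct, by multiplicativity of \<open>comult A\<close> on the
  product in the second leg.\<close>

lemma bcomult_coassoc_pure:
  assumes [simp]: "a \<in> carrier A" "h \<in> carrier H"
  shows "sw K T T TTT (bcomult (p a h)) (\<lambda>x z. sw K T T TTT (bcomult x) (\<lambda>u v. pure K T TT u (pure K T T v z))) =
    sw K T T TTT (bcomult (p a h)) (\<lambda>x z. pure K T TT x (bcomult z))" (is "?L = ?R")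
proof -
  have "?L = dA TTT a (\<lambda>a1 w. dA TTT w (\<lambda>a2 a3. dH TTT h (\<lambda>h1 h2. dC TTT h1 (\<lambda>x y. dH TTT x (\<lambda>u v. dC TTT u (\<lambda>s t.
      pure K T TT (p a1 s) (pure K T T (p (a2 \<otimes>\<^bsub>A\<^esub> t) v) (p (a3 \<otimes>\<^bsub>A\<^esub> y) h2))))))))"
    by (simp add: sw_bcomult_pure comult_A_out dA_coassoc)
  also have "\<dots> = dA TTT a (\<lambda>a1 w. dA TTT w (\<lambda>a2 a3. dH TTT h (\<lambda>h1 q. dH TTT q (\<lambda>h2 h3. dC TTT h2 (\<lambda>s t. dC TTT h1 (\<lambda>x q.
      dA TTT q (\<lambda>y z. pure K T TT (p a1 x) (pure K T T (p (a2 \<otimes>\<^bsub>A\<^esub> y) s) (p (a3 \<otimes>\<^bsub>A\<^esub> (z \<otimes>\<^bsub>A\<^esub> t)) h3)))))))))"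
    by (simp add: dC_comult' dH_coassoc dC_coassoc)
  also have "\<dots> = ?R"
    by (simp add: sw_bcomult_pure pure_sw_right[of K T T T _ "bcomult _"] A.sw_comult_mult comult_A_out bcomult_coassoc_swap assocA)
  finally show ?thesis .
qed

text \<open>Condition (3) concerns the two legs of one coproduct. Coassociativity groups the legs
  \<open>h1\<close> and \<open>h2\<close> of a threefold splitting into such a pair and afterwards
  undoes the grouping.\<close>

lemma dC_act_nested:
  assumes "module K U" "r \<in> carrier H" "b \<in> carrier A"
    "\<And>v w. v \<in> carrier A \<Longrightarrow> w \<in> carrier H \<Longrightarrow> linear_map K H U (\<lambda>u. F u v w)"
    "\<And>u w. u \<in> carrier H \<Longrightarrow> w \<in> carrier H \<Longrightarrow> linear_map K A U (\<lambda>v. F u v w)"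
    "\<And>u v. u \<in> carrier H \<Longrightarrow> v \<in> carrier A \<Longrightarrow> linear_map K H U (\<lambda>w. F u v w)"
  shows "dH U r (\<lambda>h1 q. dH U q (\<lambda>h2 z. dC U h2 (\<lambda>x y. F x (act h1 b \<otimes>\<^bsub>A\<^esub> y) z))) =
    dH U r (\<lambda>h1 q. dH U q (\<lambda>h2 z. dC U h1 (\<lambda>x y. F x (y \<otimes>\<^bsub>A\<^esub> act h2 b) z)))"
proof -
  have [simp]: "F u v w \<in> carrier U" if "u \<in> carrier H" "v \<in> carrier A" "w \<in> carrier H" for u v w
    using linear_map_closed[OF assms(4)] that by blast
  have "dH U r (\<lambda>k z. dH U k (\<lambda>h1 h2. dC U h2 (\<lambda>x y. F x (act h1 b \<otimes>\<^bsub>A\<^esub> y) z))) =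
    dH U r (\<lambda>k z. dH U k (\<lambda>h1 h2. dC U h1 (\<lambda>x y. F x (y \<otimes>\<^bsub>A\<^esub> act h2 b) z)))"
    by (intro sw_cong refl dC_act) (use assms in simp_all)
  then show ?thesis using assms by (simp add: dH_coassoc linear_map_comp[OF _ assms(4)]
    linear_map_comp[OF _ assms(5)] linear_map_comp[OF _ assms(6)])
qed

end

text \<open>Brings \<open>w\<close>, the counit of the second leg of \<open>h\<close> in
  \<open>bcounit_mult_pure\<close>, to the front. The result is a counit times a linear function of
  the other leg, which \<open>sw_counits_scalar\<close> recognises.\<close>

lemma (in cring) counit_reorder:
  assumes "x \<in> carrier R" "y \<in> carrier R" "v \<in> carrier R" "w \<in> carrier R" "u \<in> carrier R"
  shows "x \<otimes> (y \<otimes> v) \<otimes> (w \<otimes> u) = w \<otimes> (x \<otimes> y \<otimes> u \<otimes> v)"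
  using assms by (simp add: m_ac)

lemma (in cring) counit_regroup:
  "\<lbrakk>x \<in> carrier R; y \<in> carrier R; u \<in> carrier R; v \<in> carrier R\<rbrakk>
    \<Longrightarrow> x \<otimes> y \<otimes> u \<otimes> v = x \<otimes> v \<otimes> (y \<otimes> u)"
  by (simp add: m_ac)

lemma smult_left_commute:
  assumes "module K U" "r \<in> carrier K" "s \<in> carrier K" "x \<in> carrier U"
  shows "r \<odot>\<^bsub>U\<^esub> (s \<odot>\<^bsub>U\<^esub> x) = s \<odot>\<^bsub>U\<^esub> (r \<odot>\<^bsub>U\<^esub> x)"
proof -
  interpret U: module K U by fact
  show ?thesis using assms by (simp add: U.smult_assoc1[symmetric] U.R.m_comm)
qed

section \<open>Multiplicativity of the coproduct\<close>

context matched_hopf_pair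
begin

text \<open>Symmetric in \<open>g\<close> and \<open>h\<close>, hence looping as a free rewrite
  rule; it is applied with \<open>g\<close> fixed.\<close>

lemma comult_out:
  assumes "module K U" "g \<in> carrier H" "h \<in> carrier H"
    and "\<And>v w x y. \<lbrakk>v \<in> carrier H; w \<in> carrier H; x \<in> carrier H; y \<in> carrier H\<rbrakk> \<Longrightarrow> f v w x y \<in> carrier U"
  shows "dH U h (\<lambda>v w. dH U g (f v w)) = dH U g (\<lambda>x y. dH U h (\<lambda>v w. f v w x y))"
  by (rule sw_swap) (use assms in simp_all)

lemma comult_H_out_nested:
  assumes [simp]: "module K U" "h \<in> carrier H" "g \<in> carrier H"
    "\<And>u v c s t. \<lbrakk>u \<in> carrier H; v \<in> carrier H; c \<in> carrier A; s \<in> carrier H; t \<in> carrier H\<rbrakk>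
      \<Longrightarrow> f u v c s t \<in> carrier U"
  shows "dC U h (\<lambda>x c. dH U x (\<lambda>u v. dH U g (f u v c))) =
    dH U g (\<lambda>s t. dC U h (\<lambda>x c. dH U x (\<lambda>u v. f u v c s t)))"
  by (simp add: sw_swap[of K H H _ _ _ "comult H g"])

text \<open>
  The part of \<open>\<Delta>(xy) = \<Delta>(x)\<Delta>(y)\<close> that involves only \<open>h\<close>: \<open>dC_act\<close> exchanges the action of \<open>h\<^sub>2\<close> with the
  coaction of \<open>h\<^sub>3\<close>, after which \<open>dC_comult\<close> merges the two adjacent coactions.
\<close>

lemma comult_mult_key:
  assumes [simp]: "module K U" "h \<in> carrier H" "b \<in> carrier A"
    and F: "\<And>v c d f. \<lbrakk>v \<in> carrier H; c \<in> carrier A; d \<in> carrier H; f \<in> carrier H\<rbrakk> \<Longrightarrow>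
        linear_map K H U (\<lambda>u. F u v c d f)"
      "\<And>u c d f. \<lbrakk>u \<in> carrier H; c \<in> carrier A; d \<in> carrier H; f \<in> carrier H\<rbrakk> \<Longrightarrow>
        linear_map K H U (\<lambda>v. F u v c d f)"
      "\<And>u v d f. \<lbrakk>u \<in> carrier H; v \<in> carrier H; d \<in> carrier H; f \<in> carrier H\<rbrakk> \<Longrightarrow>
        linear_map K A U (\<lambda>c. F u v c d f)"
      "\<And>u v c f. \<lbrakk>u \<in> carrier H; v \<in> carrier H; c \<in> carrier A; f \<in> carrier H\<rbrakk> \<Longrightarrow>
        linear_map K H U (\<lambda>d. F u v c d f)"
      "\<And>u v c d. \<lbrakk>u \<in> carrier H; v \<in> carrier H; c \<in> carrier A; d \<in> carrier H\<rbrakk> \<Longrightarrow>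
        linear_map K H U (\<lambda>f. F u v c d f)"
  shows "dH U h (\<lambda>h1 q. dH U q (\<lambda>h2 q. dH U q (\<lambda>h3 q. dH U q (\<lambda>h4 h5. dC U h1 (\<lambda>u c. dC U h3 (\<lambda>v d.
      F u v (c \<otimes>\<^bsub>A\<^esub> (act h2 b \<otimes>\<^bsub>A\<^esub> d)) h4 h5)))))) =
    dH U h (\<lambda>h1 q. dH U q (\<lambda>h2 q. dH U q (\<lambda>h3 h4. dC U h1 (\<lambda>x c. dH U x (\<lambda>u v.
      F u v (c \<otimes>\<^bsub>A\<^esub> act h2 b) h3 h4)))))"
    (is "?L = ?R")
proof -
  note [simp] = linear_map_comp[OF _ F(1)] linear_map_comp[OF _ F(2)] linear_map_comp[OF _ F(3)]
    linear_map_comp[OF _ F(4)] linear_map_comp[OF _ F(5)]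
  have [simp]: "F u v c d f \<in> carrier U"
    if "u \<in> carrier H" "v \<in> carrier H" "c \<in> carrier A" "d \<in> carrier H" "f \<in> carrier H" for u v c d f
    using linear_map_closed[OF F(1)] that by blast
  \<comment> \<open>\<open>dC_act_nested\<close> needs the coaction of \<open>h3\<close> directly
    below the coproduct that yields \<open>h3\<close>. The parameter \<open>\<phi>\<close> covers
    both orders of action and coaction factor, so the same exchange leads into that form and out of
    it.\<close>
  have swap: "dC U x (\<lambda>v d. dH U q (\<lambda>h4 h5. dC U h1 (\<lambda>u c. F u v (c \<otimes>\<^bsub>A\<^esub> \<phi> d) h4 h5))) =
      dH U q (\<lambda>h4 h5. dC U h1 (\<lambda>u c. dC U x (\<lambda>v d. F u v (c \<otimes>\<^bsub>A\<^esub> \<phi> d) h4 h5)))"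
    if "h1 \<in> carrier H" "q \<in> carrier H" "x \<in> carrier H" "\<And>d. d \<in> carrier A \<Longrightarrow> \<phi> d \<in> carrier A" for h1 q x \<phi>
    using that by (simp add: sw_swap[of K H A _ _ _ "coact x"])
  have "?L = dH U h (\<lambda>h1 q. dH U q (\<lambda>h2 q. dH U q (\<lambda>h3 q. dC U h3 (\<lambda>v d.
      dH U q (\<lambda>h4 h5. dC U h1 (\<lambda>u c. F u v (c \<otimes>\<^bsub>A\<^esub> (act h2 b \<otimes>\<^bsub>A\<^esub> d)) h4 h5))))))"
    by (simp add: swap[of _ _ _ "\<lambda>d. act _ b \<otimes>\<^bsub>A\<^esub> d"])
  also have "\<dots> = dH U h (\<lambda>h1 q. dH U q (\<lambda>h2 q. dH U q (\<lambda>h3 q. dC U h2 (\<lambda>v d.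
      dH U q (\<lambda>h4 h5. dC U h1 (\<lambda>u c. F u v (c \<otimes>\<^bsub>A\<^esub> (d \<otimes>\<^bsub>A\<^esub> act h3 b)) h4 h5))))))"
    by (intro sw_cong refl dC_act_nested[where F = "\<lambda>v d q. dH U q (\<lambda>h4 h5. dC U _ (\<lambda>u c. F u v (c \<otimes>\<^bsub>A\<^esub> d) h4 h5))"])
      simp_all
  also have "\<dots> = dH U h (\<lambda>h1 q. dH U q (\<lambda>h2 q. dH U q (\<lambda>h3 q. dH U q (\<lambda>h4 h5. dC U h1 (\<lambda>u c. dC U h2 (\<lambda>v d.
      F u v (c \<otimes>\<^bsub>A\<^esub> (d \<otimes>\<^bsub>A\<^esub> act h3 b)) h4 h5))))))"
    by (simp add: swap[of _ _ _ "\<lambda>d. d \<otimes>\<^bsub>A\<^esub> act _ b"])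
  also have "\<dots> = dH U h (\<lambda>k q. dH U k (\<lambda>x y. dH U q (\<lambda>h2 q. dH U q (\<lambda>h3 h4. dC U x (\<lambda>u c. dC U y (\<lambda>v d.
      F u v ((c \<otimes>\<^bsub>A\<^esub> d) \<otimes>\<^bsub>A\<^esub> act h2 b) h3 h4))))))"
    by (simp add: dH_coassoc assocA)
  also have "\<dots> = ?R"
  proof (rule sw_cong[OF refl])
    fix k q assume [simp]: "k \<in> carrier H" "q \<in> carrier H"
    show "dH U k (\<lambda>x y. dH U q (\<lambda>h2 q. dH U q (\<lambda>h3 h4. dC U x (\<lambda>u c. dC U y (\<lambda>v d.
        F u v ((c \<otimes>\<^bsub>A\<^esub> d) \<otimes>\<^bsub>A\<^esub> act h2 b) h3 h4))))) =
      dH U q (\<lambda>h2 q. dH U q (\<lambda>h3 h4. dC U k (\<lambda>x c. dH U x (\<lambda>u v. F u v (c \<otimes>\<^bsub>A\<^esub> act h2 b) h3 h4))))"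
      by (simp add: dC_comult sw_swap[of K H H _ _ _ "comult H k"])
  qed
  finally show ?thesis .
qed

lemma bcomult_mult_pure:
  assumes [simp]: "a \<in> carrier A" "h \<in> carrier H" "b \<in> carrier A" "g \<in> carrier H"
  shows "bcomult (bmult (p a h) (p b g)) = sw K T T TT (bcomult (p a h)) (\<lambda>s1 s2. sw K T T TT (bcomult (p b g)) (\<lambda>t1 t2.
    pure K T T (bmult s1 t1) (bmult s2 t2)))" (is "?L = ?R")
proof -
  let ?F = "\<lambda>a1 a2 b1 g1 g2 u v c d f. dC TT g1 (\<lambda>x y.
    pure K T T (p (a1 \<otimes>\<^bsub>A\<^esub> act u b1) (v \<otimes>\<^bsub>H\<^esub> x)) (p (a2 \<otimes>\<^bsub>A\<^esub> (c \<otimes>\<^bsub>A\<^esub> act d y)) (f \<otimes>\<^bsub>H\<^esub> g2)))"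
  note expand = sw_bcomult_pure bcomult_def bmult_def sw_sw pulls A.sw_comult_mult H.sw_comult_mult dA_act dC_mult assocA assocH
    comult_A_out comult_H_out comult_out[of TT g] dH_coassoc act_mult
  \<comment> \<open>Origin of the five pieces: \<open>h1\<close> and \<open>h2\<close> come from the
    coproduct of the action on \<open>b\<close>, \<open>h3\<close> and \<open>h4\<close> from the
    coaction on a product with a leg of \<open>g\<close>, and \<open>h5\<close> multiplies
    \<open>g2\<close>. On the right there are four, the first being coacted on before it is
    split.\<close>
  have "?L = dA TT a (\<lambda>a1 a2. dA TT b (\<lambda>b1 b2. dH TT g (\<lambda>g1 g2.
    dH TT h (\<lambda>h1 q. dH TT q (\<lambda>h2 q. dH TT q (\<lambda>h3 q. dH TT q (\<lambda>h4 h5. dC TT h1 (\<lambda>u c. dC TT h3 (\<lambda>v d.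
      ?F a1 a2 b1 g1 g2 u v (c \<otimes>\<^bsub>A\<^esub> (act h2 b2 \<otimes>\<^bsub>A\<^esub> d)) h4 h5)))))))))"
    by (simp add: expand)
  also have "\<dots> = dA TT a (\<lambda>a1 a2. dA TT b (\<lambda>b1 b2. dH TT g (\<lambda>g1 g2.
    dH TT h (\<lambda>h1 q. dH TT q (\<lambda>h2 q. dH TT q (\<lambda>h3 h4. dC TT h1 (\<lambda>x c. dH TT x (\<lambda>u v.
      ?F a1 a2 b1 g1 g2 u v (c \<otimes>\<^bsub>A\<^esub> act h2 b2) h3 h4))))))))"
    by (intro sw_cong refl comult_mult_key[where F = "?F _ _ _ _ _"]) simp_all
  also have "\<dots> = ?R"
    by (simp add: expand comult_H_out_nested)
  finally show ?thesis .
qed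

text \<open>
  That \<open>\<rho>(1) = 1 \<otimes> 1\<close> is not an axiom: \<open>\<rho>(1)\<close> is idempotent by \<open>coact_mult\<close>, and by \<open>comult_coact\<close> it has the
  right inverse \<open>S\<^sub>H(1\<^sub>(\<^sub>0\<^sub>)) \<otimes> 1\<^sub>(\<^sub>1\<^sub>)\<close>.
\<close>

lemma coact_one:
  assumes "module K U"
    "\<And>v. v \<in> carrier H \<Longrightarrow> linear_map K A U (F v)"
    "\<And>w. w \<in> carrier A \<Longrightarrow> linear_map K H U (\<lambda>v. F v w)"
  shows "dC U \<one>\<^bsub>H\<^esub> F = F \<one>\<^bsub>H\<^esub> \<one>\<^bsub>A\<^esub>"
proof -
  let ?HA = "tensor K H A" and ?q = "pure K H A"
  have idem: "dC ?HA \<one>\<^bsub>H\<^esub> (\<lambda>x y. G x y) = dC ?HA \<one>\<^bsub>H\<^esub> (\<lambda>x y. dC ?HA \<one>\<^bsub>H\<^esub> (\<lambda>x' y'. G (x \<otimes>\<^bsub>H\<^esub> x') (y \<otimes>\<^bsub>A\<^esub> y')))"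
    if "\<And>v. v \<in> carrier H \<Longrightarrow> linear_map K A ?HA (G v)" "\<And>w. w \<in> carrier A \<Longrightarrow> linear_map K H ?HA (\<lambda>v. G v w)" for G
    using dC_mult[of ?HA "\<one>\<^bsub>H\<^esub>" "\<one>\<^bsub>H\<^esub>" G] that
    by (simp add: H.sw_comult_one linear_map_comp[OF _ that(1)] linear_map_comp[OF _ that(2)])
  have inv: "dC ?HA \<one>\<^bsub>H\<^esub> (\<lambda>x y. dC ?HA \<one>\<^bsub>H\<^esub> (\<lambda>x' y'. ?q (x \<otimes>\<^bsub>H\<^esub> antipode H x') (y \<otimes>\<^bsub>A\<^esub> y'))) = ?q \<one>\<^bsub>H\<^esub> \<one>\<^bsub>A\<^esub>"
    using dC_comult[of ?HA "\<one>\<^bsub>H\<^esub>" "\<lambda>u v y. ?q (u \<otimes>\<^bsub>H\<^esub> antipode H v) y"]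
    by (simp add: H.sw_comult_one H.sw_antipode[of ?HA "\<lambda>u. ?q u _"] sw_counits H.counit_one module.smult_one[of K "tensor K H A"])
  have "?q \<one>\<^bsub>H\<^esub> \<one>\<^bsub>A\<^esub> = dC ?HA \<one>\<^bsub>H\<^esub> (\<lambda>x y. dC ?HA \<one>\<^bsub>H\<^esub> (\<lambda>x' y'. dC ?HA \<one>\<^bsub>H\<^esub> (\<lambda>x'' y''.
      ?q ((x \<otimes>\<^bsub>H\<^esub> x') \<otimes>\<^bsub>H\<^esub> antipode H x'') ((y \<otimes>\<^bsub>A\<^esub> y') \<otimes>\<^bsub>A\<^esub> y''))))"
    \<comment> \<open>Idempotency is inserted into the equation \<open>inv\<close>. After
      reassociation the inner two factors form \<open>inv\<close> again and cancel, leaving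
      \<open>coact\<close> of the unit.\<close>
    unfolding inv[symmetric] by (rule idem) simp_all
  also have "\<dots> = dC ?HA \<one>\<^bsub>H\<^esub> (\<lambda>x y. sw K H A ?HA (dC ?HA \<one>\<^bsub>H\<^esub> (\<lambda>x' y'. dC ?HA \<one>\<^bsub>H\<^esub> (\<lambda>x'' y''.
      ?q (x' \<otimes>\<^bsub>H\<^esub> antipode H x'') (y' \<otimes>\<^bsub>A\<^esub> y'')))) (\<lambda>u v. ?q (x \<otimes>\<^bsub>H\<^esub> u) (y \<otimes>\<^bsub>A\<^esub> v)))"
    by (simp add: sw_sw assocA assocH)
  also have "\<dots> = coact \<one>\<^bsub>H\<^esub>"
    unfolding inv by (simp add: sw_pure_id)
  finally have "coact \<one>\<^bsub>H\<^esub> = ?q \<one>\<^bsub>H\<^esub> \<one>\<^bsub>A\<^esub>" ..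
  then show ?thesis using assms by simp
qed

lemma bcomult_one: "bcomult (p \<one>\<^bsub>A\<^esub> \<one>\<^bsub>H\<^esub>) = pure K T T (p \<one>\<^bsub>A\<^esub> \<one>\<^bsub>H\<^esub>) (p \<one>\<^bsub>A\<^esub> \<one>\<^bsub>H\<^esub>)"
  by (simp add: bcomult_def A.sw_comult_one H.sw_comult_one coact_one)

section \<open>Counit and antipode\<close>

definition bcounit where "bcounit t = sw K A H (scalars K) t (\<lambda>a h. counit A a \<otimes>\<^bsub>K\<^esub> counit H h)"

lemma bcounit_pure: "a \<in> carrier A \<Longrightarrow> h \<in> carrier H \<Longrightarrow> bcounit (p a h) = counit A a \<otimes>\<^bsub>K\<^esub> counit H h"
  by (simp add: bcounit_def)

lemma linear_bcounit [simp]: "linear_map K X T f \<Longrightarrow> linear_map K X (scalars K) (\<lambda>x. bcounit (f x))"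
  by (simp add: bcounit_def)

lemma bcounit_closed [simp]: "t \<in> carrier T \<Longrightarrow> bcounit t \<in> carrier K"
  using linear_map_closed[OF linear_bcounit[OF linear_map_id]] by simp

lemma module_T [simp]: "module K T" by simp

lemma smult_closed_T [simp]: "r \<in> carrier K \<Longrightarrow> t \<in> carrier T \<Longrightarrow> r \<odot>\<^bsub>T\<^esub> t \<in> carrier T"
  by (rule module.smult_closed[OF module_T])

lemma smult_T: "\<lbrakk>r \<in> carrier K; s \<in> carrier K; t \<in> carrier T\<rbrakk> \<Longrightarrow>
    (r \<otimes>\<^bsub>K\<^esub> s) \<odot>\<^bsub>T\<^esub> t = r \<odot>\<^bsub>T\<^esub> (s \<odot>\<^bsub>T\<^esub> t)"
  by (rule module.smult_assoc1[OF module_T])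

lemma bcounit_bcomult_pure:
  assumes [simp]: "a \<in> carrier A" "h \<in> carrier H"
  shows "sw K T T T (bcomult (p a h)) (\<lambda>x y. bcounit x \<odot>\<^bsub>T\<^esub> y) = p a h"
    and "sw K T T T (bcomult (p a h)) (\<lambda>x y. bcounit y \<odot>\<^bsub>T\<^esub> x) = p a h"
  by (simp_all add: sw_bcomult_pure bcounit_pure smult_T sw_smult sw_counits A.counit_mult)

lemmas sw_counits_scalar = sw_counits[of "scalars K", simplified]

lemma bcounit_mult_pure:
  assumes [simp]: "a \<in> carrier A" "h \<in> carrier H" "b \<in> carrier A" "g \<in> carrier H"
  shows "bcounit (bmult (p a h) (p b g)) = bcounit (p a h) \<otimes>\<^bsub>K\<^esub> bcounit (p b g)"
proof -
  have "bcounit (bmult (p a h) (p b g)) = counit A a \<otimes>\<^bsub>K\<^esub> counit A b \<otimes>\<^bsub>K\<^esub> counit H g \<otimes>\<^bsub>K\<^esub> counit H h"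
    by (simp add: bmult_def bcounit_def sw_sw A.counit_mult H.counit_mult counit_act sw_counits_scalar
      cring.counit_reorder[of K])
  then show ?thesis by (simp add: bcounit_pure cring.counit_regroup[of K])
qed

definition bantipode where
  "bantipode t = sw K A H T t (\<lambda>a h. dC T h (\<lambda>x y. bmult (p \<one>\<^bsub>A\<^esub> (antipode H x)) (p (antipode A (a \<otimes>\<^bsub>A\<^esub> y)) \<one>\<^bsub>H\<^esub>)))"

lemma bantipode_pure: "a \<in> carrier A \<Longrightarrow> h \<in> carrier H \<Longrightarrow>
    bantipode (p a h) = dC T h (\<lambda>x y. bmult (p \<one>\<^bsub>A\<^esub> (antipode H x)) (p (antipode A (a \<otimes>\<^bsub>A\<^esub> y)) \<one>\<^bsub>H\<^esub>))"
  by (simp add: bantipode_def)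

lemma bantipode_closed [simp]: "t \<in> carrier T \<Longrightarrow> bantipode t \<in> carrier T"
  by (simp add: bantipode_def)

lemma linear_bantipode [simp]: "linear_map K X T f \<Longrightarrow> linear_map K X T (\<lambda>x. bantipode (f x))"
  by (simp add: bantipode_def)

lemma bmult_pull:
  assumes "module K V" "module K W" "t \<in> carrier (tensor K V W)"
    "\<And>v w. v \<in> carrier V \<Longrightarrow> w \<in> carrier W \<Longrightarrow> F v w \<in> carrier T" "r \<in> carrier T"
  shows "bmult (sw K V W T t F) r = sw K V W T t (\<lambda>v w. bmult (F v w) r)"
    and "bmult r (sw K V W T t F) = sw K V W T t (\<lambda>v w. bmult r (F v w))"
  using assms sw_push[of K V W T T "\<lambda>x. bmult x r" t F] sw_push[of K V W T T "\<lambda>x. bmult r x" t F]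
  by simp_all

lemma bmult_pure_special:
  "\<lbrakk>a \<in> carrier A; b \<in> carrier A; g \<in> carrier H\<rbrakk> \<Longrightarrow> bmult (p a \<one>\<^bsub>H\<^esub>) (p b g) = p (a \<otimes>\<^bsub>A\<^esub> b) g"
  "\<lbrakk>a \<in> carrier A; h \<in> carrier H; g \<in> carrier H\<rbrakk> \<Longrightarrow> bmult (p a h) (p \<one>\<^bsub>A\<^esub> g) = p a (h \<otimes>\<^bsub>H\<^esub> g)"
  by (simp_all add: bmult_def H.sw_comult_one act_one A.mult_smult pure_smult sw_counits)

text \<open>The part in \<open>A\<close> collapses first. \<open>dC_coassoc\<close> turns the
  repeated coaction into a coproduct of \<open>q\<close>, which joins that of \<open>a\<close> to
  the coproduct of their product, where the antipode of \<open>A\<close> applies. The counit of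
  \<open>q\<close> removes the coaction and leaves the antipode axiom of \<open>H\<close>.\<close>

lemma bantipode_left_pure:
  assumes [simp]: "a \<in> carrier A" "h \<in> carrier H"
  shows "sw K T T T (bcomult (p a h)) (\<lambda>x y. bmult (bantipode x) y) = bcounit (p a h) \<odot>\<^bsub>T\<^esub> p \<one>\<^bsub>A\<^esub> \<one>\<^bsub>H\<^esub>"
proof -
  have "sw K T T T (bcomult (p a h)) (\<lambda>x y. bmult (bantipode x) y) =
    dA T a (\<lambda>a1 a2. dH T h (\<lambda>h1 h2. dC T h1 (\<lambda>u q. dA T q (\<lambda>v y.
      bmult (p \<one>\<^bsub>A\<^esub> (antipode H u)) (p (antipode A (a1 \<otimes>\<^bsub>A\<^esub> v) \<otimes>\<^bsub>A\<^esub> (a2 \<otimes>\<^bsub>A\<^esub> y)) h2)))))"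
    by (simp add: sw_bcomult_pure bantipode_pure bmult_pull bmult_assoc bmult_pure_special dC_coassoc)
  also have "\<dots> = dH T h (\<lambda>h1 h2. dC T h1 (\<lambda>u q. dA T (a \<otimes>\<^bsub>A\<^esub> q) (\<lambda>v y.
      bmult (p \<one>\<^bsub>A\<^esub> (antipode H u)) (p (antipode A v \<otimes>\<^bsub>A\<^esub> y) h2))))"
    by (simp add: A.sw_comult_mult comult_A_out)
  also have "\<dots> = dH T h (\<lambda>h1 h2. dC T h1 (\<lambda>u q. counit A (a \<otimes>\<^bsub>A\<^esub> q) \<odot>\<^bsub>T\<^esub>
      bmult (p \<one>\<^bsub>A\<^esub> (antipode H u)) (p \<one>\<^bsub>A\<^esub> h2)))"
    by (intro sw_cong refl A.sw_antipode(1)[of T "\<lambda>x. bmult (p \<one>\<^bsub>A\<^esub> (antipode H _)) (p x _)"]) simp_all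
  also have "\<dots> = bcounit (p a h) \<odot>\<^bsub>T\<^esub> p \<one>\<^bsub>A\<^esub> \<one>\<^bsub>H\<^esub>"
    by (simp add: A.counit_mult smult_T sw_smult sw_counits bmult_pure_special bcounit_pure
      H.sw_antipode(1)[of T "\<lambda>x. p _ x"])
  finally show ?thesis .
qed

text \<open>Here the part in \<open>H\<close> collapses first. \<open>dC_comult\<close> merges the
  coactions of both legs, so that the antipode of \<open>H\<close> meets a genuine coproduct of
  \<open>x\<close>. The resulting counit sends the coaction to the unit of \<open>A\<close>, and the
  antipode axiom of \<open>A\<close> finishes.\<close>

lemma bantipode_right_pure:
  assumes [simp]: "a \<in> carrier A" "h \<in> carrier H"
  shows "sw K T T T (bcomult (p a h)) (\<lambda>x y. bmult x (bantipode y)) = bcounit (p a h) \<odot>\<^bsub>T\<^esub> p \<one>\<^bsub>A\<^esub> \<one>\<^bsub>H\<^esub>"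
proof -
  have "sw K T T T (bcomult (p a h)) (\<lambda>x y. bmult x (bantipode y)) =
    dA T a (\<lambda>a1 a2. dH T h (\<lambda>h1 h2. dC T h1 (\<lambda>x y. dC T h2 (\<lambda>u v.
      bmult (p a1 (x \<otimes>\<^bsub>H\<^esub> antipode H u)) (p (antipode A (a2 \<otimes>\<^bsub>A\<^esub> (y \<otimes>\<^bsub>A\<^esub> v))) \<one>\<^bsub>H\<^esub>)))))"
    by (simp add: sw_bcomult_pure bantipode_pure bmult_pull bmult_assoc[symmetric] bmult_pure_special assocA)
  also have "\<dots> = dA T a (\<lambda>a1 a2. dC T h (\<lambda>x y. dH T x (\<lambda>u v.
      bmult (p a1 (u \<otimes>\<^bsub>H\<^esub> antipode H v)) (p (antipode A (a2 \<otimes>\<^bsub>A\<^esub> y)) \<one>\<^bsub>H\<^esub>))))"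
    by (simp add: dC_comult)
  also have "\<dots> = dA T a (\<lambda>a1 a2. dC T h (\<lambda>x y. counit H x \<odot>\<^bsub>T\<^esub>
      bmult (p a1 \<one>\<^bsub>H\<^esub>) (p (antipode A (a2 \<otimes>\<^bsub>A\<^esub> y)) \<one>\<^bsub>H\<^esub>)))"
    by (intro sw_cong refl H.sw_antipode(2)[of T "\<lambda>x. bmult (p _ x) (p (antipode A _) \<one>\<^bsub>H\<^esub>)"]) simp_all
  also have "\<dots> = bcounit (p a h) \<odot>\<^bsub>T\<^esub> p \<one>\<^bsub>A\<^esub> \<one>\<^bsub>H\<^esub>"
    by (simp add: bmult_pure_special sw_counits sw_smult bcounit_pure smult_T
      smult_left_commute[of K T "counit H h"] A.sw_antipode(2)[of T "\<lambda>x. p x _"])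
  finally show ?thesis .
qed

section \<open>The ordinary bicrossproduct as a Hopf algebra\<close>

definition bproduct :: "('k, ('a \<times> 'h \<Rightarrow> 'k) set) hom_hopf" where
  "bproduct = \<lparr>carrier = carrier T, mult = bmult, one = p \<one>\<^bsub>A\<^esub> \<one>\<^bsub>H\<^esub>, zero = zero T, add = add T, smult = smult T,
    alpha = \<lambda>t. t, comult = bcomult, counit = bcounit, antipode = bantipode\<rparr>"

lemma bproduct_simps [simp]:
  "carrier bproduct = carrier T" "mult bproduct = bmult" "one bproduct = p \<one>\<^bsub>A\<^esub> \<one>\<^bsub>H\<^esub>" "zero bproduct = zero T" "add bproduct = add T"
  "smult bproduct = smult T" "alpha bproduct = (\<lambda>t. t)" "comult bproduct = bcomult" "counit bproduct = bcounit" "antipode bproduct = bantipode"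
  by (simp_all add: bproduct_def)

lemma same_space_bproduct: "same_space T bproduct"
  by (simp add: same_space_def)

lemmas bproduct_conv =
  same_space_tensor(1-3)[OF same_space_bproduct same_space_refl] same_space_tensor(1-3)[OF same_space_refl same_space_bproduct]
  same_space_sw[OF same_space_bproduct]
  same_space_tensor(5)[OF same_space_refl same_space_bproduct] same_space_tensor(6)[OF same_space_bproduct same_space_refl]

lemma T_eqI2:
  assumes U: "module K U"
    and f: "\<And>t. t \<in> carrier T \<Longrightarrow> linear_map K T U (\<lambda>r. f r t)" "\<And>t. t \<in> carrier T \<Longrightarrow> linear_map K T U (\<lambda>r. f t r)"
    and g: "\<And>t. t \<in> carrier T \<Longrightarrow> linear_map K T U (\<lambda>r. g r t)" "\<And>t. t \<in> carrier T \<Longrightarrow> linear_map K T U (\<lambda>r. g t r)"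
    and eq: "\<And>a h b g'. \<lbrakk>a \<in> carrier A; h \<in> carrier H; b \<in> carrier A; g' \<in> carrier H\<rbrakk>
      \<Longrightarrow> f (p a h) (p b g') = g (p a h) (p b g')"
    and s: "s \<in> carrier T" and t: "t \<in> carrier T"
  shows "f s t = g s t"
proof -
  have 1: "f (p a h) t = g (p a h) t" if "a \<in> carrier A" "h \<in> carrier H" for a h
    by (rule T_eqI[OF U f(2) g(2) eq t]) (use that in simp_all)
  show ?thesis
    by (rule T_eqI[OF U f(1) g(1) 1 s]) (use t in simp_all)
qed

lemma hopf_bproduct: "hom_hopf_algebra K bproduct"
proof (rule hom_hopf_algebraI, unfold bproduct_conv bproduct_simps)
  show "field K" by (rule A.field_axioms)
  show "module K bproduct" by (rule same_space_module[OF same_space_bproduct]) simp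
  show "linear_map K T TT bcomult" "linear_map K T (scalars K) bcounit" "linear_map K T T bantipode"
    using linear_bcomult[of T "\<lambda>x. x"] linear_bcounit[of T "\<lambda>x. x"] linear_bantipode[of T "\<lambda>x. x"] by simp_all
  show "bcomult (p \<one>\<^bsub>A\<^esub> \<one>\<^bsub>H\<^esub>) = pure K T T (p \<one>\<^bsub>A\<^esub> \<one>\<^bsub>H\<^esub>) (p \<one>\<^bsub>A\<^esub> \<one>\<^bsub>H\<^esub>)" by (rule bcomult_one)
  show "bcounit (p \<one>\<^bsub>A\<^esub> \<one>\<^bsub>H\<^esub>) = \<one>\<^bsub>K\<^esub>"
    by (simp add: bcounit_pure A.counit_one H.counit_one)
  fix s assume [simp]: "s \<in> carrier T"
  show "bmult (p \<one>\<^bsub>A\<^esub> \<one>\<^bsub>H\<^esub>) s = s" "bmult s (p \<one>\<^bsub>A\<^esub> \<one>\<^bsub>H\<^esub>) = s" by (simp_all add: bmult_units)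
  show "bcomult s = sw K T T TT (bcomult s) (\<lambda>x y. pure K T T x y)" by (simp add: sw_pure_id)
  show "sw K T T T (bcomult s) (\<lambda>x y. bcounit x \<odot>\<^bsub>T\<^esub> y) = s"
    by (rule T_eqI[where g = "\<lambda>s. s" and U = T]) (simp_all add: bcounit_bcomult_pure)
  show "sw K T T T (bcomult s) (\<lambda>x y. bcounit y \<odot>\<^bsub>T\<^esub> x) = s"
    by (rule T_eqI[where g = "\<lambda>s. s" and U = T]) (simp_all add: bcounit_bcomult_pure)
  show "sw K T T TTT (bcomult s) (\<lambda>x z. sw K T T TTT (bcomult x) (\<lambda>u v. pure K T TT u (pure K T T v z))) =
      sw K T T TTT (bcomult s) (\<lambda>x z. pure K T TT x (bcomult z))"
    by (rule T_eqI[where U = TTT]) (simp_all add: bcomult_coassoc_pure)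
  show "sw K T T T (bcomult s) (\<lambda>x y. bmult (bantipode x) y) = bcounit s \<odot>\<^bsub>T\<^esub> p \<one>\<^bsub>A\<^esub> \<one>\<^bsub>H\<^esub>"
    by (rule T_eqI[where U = T]) (simp_all add: bantipode_left_pure)
  show "sw K T T T (bcomult s) (\<lambda>x y. bmult x (bantipode y)) = bcounit s \<odot>\<^bsub>T\<^esub> p \<one>\<^bsub>A\<^esub> \<one>\<^bsub>H\<^esub>"
    by (rule T_eqI[where U = T]) (simp_all add: bantipode_right_pure)
  fix t assume [simp]: "t \<in> carrier T"
  show "bcomult (bmult s t) = sw K T T TT (bcomult s) (\<lambda>s1 s2. sw K T T TT (bcomult t) (\<lambda>t1 t2. pure K T T (bmult s1 t1) (bmult s2 t2)))"
    by (rule T_eqI2[where U = TT and f = "\<lambda>s t. bcomult (bmult s t)"]) (simp_all add: bcomult_mult_pure)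
  show "bcounit (bmult s t) = bcounit s \<otimes>\<^bsub>K\<^esub> bcounit t"
    by (rule T_eqI2[where U = "scalars K" and f = "\<lambda>s t. bcounit (bmult s t)"]) (simp_all add: bcounit_mult_pure)
  fix r assume [simp]: "r \<in> carrier T"
  show "bmult s (bmult t r) = bmult (bmult s t) r" by (simp add: bmult_assoc)
qed simp_all

end

section \<open>Endomorphisms of a matched pair\<close>

locale matched_hopf_pair_endo = matched_hopf_pair +
  A': hom_hopf_endomorphism K A \<phi> + H': hom_hopf_endomorphism K H \<psi> for \<phi> \<psi> +
  assumes act_endo: "\<lbrakk>h \<in> carrier H; a \<in> carrier A\<rbrakk> \<Longrightarrow> \<phi> (act h a) = act (\<psi> h) (\<phi> a)"
    and coact_endo: "h \<in> carrier H \<Longrightarrow>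
      coact (\<psi> h) = sw K H A (tensor K H A) (coact h) (\<lambda>x y. pure K H A (\<psi> x) (\<phi> y))"
begin

definition bendo where "bendo t = sw K A H T t (\<lambda>a h. p (\<phi> a) (\<psi> h))"

lemma bendo_pure [simp]: "a \<in> carrier A \<Longrightarrow> h \<in> carrier H \<Longrightarrow> bendo (p a h) = p (\<phi> a) (\<psi> h)"
  by (simp add: bendo_def)

lemma linear_bendo [simp]: "linear_map K X T f \<Longrightarrow> linear_map K X T (\<lambda>x. bendo (f x))"
  by (simp add: bendo_def)

lemma bendo_closed [simp]: "t \<in> carrier T \<Longrightarrow> bendo t \<in> carrier T"
  by (simp add: bendo_def)

lemma sw_coact_endo:
  assumes "module K U" "h \<in> carrier H"
    "\<And>v. v \<in> carrier H \<Longrightarrow> linear_map K A U (F v)"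
    "\<And>w. w \<in> carrier A \<Longrightarrow> linear_map K H U (\<lambda>v. F v w)"
  shows "dC U (\<psi> h) F = dC U h (\<lambda>x y. F (\<psi> x) (\<phi> y))"
  unfolding coact_endo[OF assms(2)] using assms by (simp add: sw_sw)

lemma bendo_pull:
  assumes "module K V" "module K W" "t \<in> carrier (tensor K V W)"
    "\<And>v w. v \<in> carrier V \<Longrightarrow> w \<in> carrier W \<Longrightarrow> F v w \<in> carrier T"
  shows "bendo (sw K V W T t F) = sw K V W T t (\<lambda>v w. bendo (F v w))"
  using assms sw_push[of K V W T T bendo t F] linear_bendo[of T "\<lambda>x. x"] by simp

lemma bendo_mult:
  assumes "s \<in> carrier T" "t \<in> carrier T"
  shows "bendo (bmult s t) = bmult (bendo s) (bendo t)"
  by (rule T_eqI2[where U = T and f = "\<lambda>s t. bendo (bmult s t)" and g = "\<lambda>s t. bmult (bendo s) (bendo t)"])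
    (simp_all add: assms bmult_def bendo_pull A'.endo_mult H'.endo_mult act_endo H'.sw_endo)

text \<open>Supplies the map for the return journey: with the two structure maps as
  \<open>\<phi>\<close> and \<open>\<psi>\<close>, this is the endomorphism by which the
  bicrossproduct gets twisted.\<close>

lemma endo_bproduct: "hom_hopf_endomorphism K bproduct bendo"
proof -
  interpret bproduct: hom_hopf_algebra K bproduct by (rule hopf_bproduct)
  show ?thesis
  proof (unfold_locales, unfold bproduct_conv bproduct_simps)
    show "linear_map K T T bendo" using linear_bendo[of T "\<lambda>x. x"] by simp
    show "bendo (p \<one>\<^bsub>A\<^esub> \<one>\<^bsub>H\<^esub>) = p \<one>\<^bsub>A\<^esub> \<one>\<^bsub>H\<^esub>" by (simp add: A'.endo_one H'.endo_one)
    fix x assume x: "x \<in> carrier T"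
    show "bcomult (bendo x) = sw K T T TT (bcomult x) (\<lambda>x y. pure K T T (bendo x) (bendo y))"
      by (rule T_eqI[where U = TT, OF _ _ _ _ x])
        (simp_all add: sw_bcomult_pure, simp add: bcomult_def A'.sw_endo H'.sw_endo sw_coact_endo A'.endo_mult)
    show "bcounit (bendo x) = bcounit x"
      by (rule T_eqI[where U = "scalars K", OF _ _ _ _ x])
        (simp_all add: bcounit_pure A'.endo_counit H'.endo_counit)
    show "bantipode (bendo x) = bendo (bantipode x)"
      by (rule T_eqI[where U = T, OF _ _ _ _ x])
        (simp_all add: bantipode_pure sw_coact_endo bendo_pull bendo_mult A'.endo_one H'.endo_one A'.endo_antipode
          H'.endo_antipode A'.endo_mult[symmetric])
    fix y assume y: "y \<in> carrier T"
    show "bendo (bmult x y) = bmult (bendo x) (bendo y)" by (rule bendo_mult[OF x y])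
  qed simp_all
qed

end

lemma untwist_conv [simp]:
  "tensor K (untwist V) W = tensor K V W" "tensor K X (untwist Y) = tensor K X Y"
  "pure K (untwist V) W = pure K V W" "pure K X (untwist Y) = pure K X Y"
  "sw K (untwist V) W U = sw K V W U" "sw K X (untwist Y) U = sw K X Y U" "sw K X W (untwist Y) = sw K X W Y"
  "linear_map K (untwist V) W = linear_map K V W" "linear_map K X (untwist Y) = linear_map K X Y"
  by (rule same_space_tensor[OF same_space_untwist same_space_refl]
      same_space_tensor[OF same_space_refl same_space_untwist] same_space_sw[OF same_space_untwist])+

section \<open>Hom-modules and Hom-comodules in Sweedler form\<close>

context left_hom_module
begin

lemma act_linear1: "m \<in> carrier M \<Longrightarrow> linear_map K A M (\<lambda>a. act a m)"
  and act_linear2: "a \<in> carrier A \<Longrightarrow> linear_map K M M (act a)"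
  using act_bilinear by (simp_all add: bilinear_map_def)

lemma act_closed [simp]: "a \<in> carrier A \<Longrightarrow> m \<in> carrier M \<Longrightarrow> act a m \<in> carrier M"
  by (rule linear_map_closed[OF act_linear2])

lemma linear_act1 [simp]: "linear_map K X A f \<Longrightarrow> m \<in> carrier M \<Longrightarrow> linear_map K X M (\<lambda>x. act (f x) m)"
  by (rule linear_map_comp[OF _ act_linear1])

lemma linear_act2 [simp]: "linear_map K X M f \<Longrightarrow> a \<in> carrier A \<Longrightarrow> linear_map K X M (\<lambda>x. act a (f x))"
  by (rule linear_map_comp[OF _ act_linear2])

end

context right_hom_comodule
begin

lemma coact_closed [simp]: "m \<in> carrier M \<Longrightarrow> coact m \<in> carrier (tensor K M C)"
  by (rule linear_map_closed[OF coact_linear])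

lemma linear_coact [simp]: "linear_map K X M f \<Longrightarrow> linear_map K X (tensor K M C) (\<lambda>x. coact (f x))"
  by (rule linear_map_comp[OF _ coact_linear])

lemma sw_coact_alpha:
  assumes "module K U" "m \<in> carrier M"
    and "\<And>v. v \<in> carrier M \<Longrightarrow> linear_map K C U (F v)"
    and "\<And>w. w \<in> carrier C \<Longrightarrow> linear_map K M U (\<lambda>v. F v w)"
  shows "sw K M C U (coact (alpha M m)) F = sw K M C U (coact m) (\<lambda>x y. F (alpha M x) (alpha C y))"
  unfolding alpha_coact[OF assms(2), symmetric]
  using assms by (simp add: tensor_map_sw[of K M C] sw_sw)

lemma sw_coact_coassoc:
  assumes U: "module K U" and c: "m \<in> carrier M"
    and F1: "\<And>v w. v \<in> carrier C \<Longrightarrow> w \<in> carrier C \<Longrightarrow> linear_map K M U (\<lambda>u. F u v w)"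
    and F2: "\<And>u w. u \<in> carrier M \<Longrightarrow> w \<in> carrier C \<Longrightarrow> linear_map K C U (\<lambda>v. F u v w)"
    and F3: "\<And>u v. u \<in> carrier M \<Longrightarrow> v \<in> carrier C \<Longrightarrow> linear_map K C U (\<lambda>w. F u v w)"
  shows "sw K M C U (coact m) (\<lambda>x z. sw K M C U (coact x) (\<lambda>u v. F u v (alpha C z))) =
    sw K M C U (coact m) (\<lambda>x y. sw K C C U (comult C y) (\<lambda>u v. F (alpha M x) u v))"
proof -
  let ?G = "\<lambda>t. sw K M (tensor K C C) U t (\<lambda>x s. sw K C C U s (\<lambda>u v. F x u v))"
  have "?G (tensor_assoc K M C C (tensor_map K (tensor K M C) C coact (alpha C) (coact m))) =
      ?G (tensor_map K M (tensor K C C) (alpha M) (comult C) (coact m))"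
    using coact_coassoc[OF c] by simp
  then show ?thesis
    using assms by (simp add: tensor_map_sw[of K M C] tensor_assoc_def sw_sw
      sweedler_eq_sw[of K "tensor K M C" C] sweedler_eq_sw[of K M C])
qed

end

context right_comodule_hom_coalgebra
begin

lemma sw_comult_coact:
  assumes U: "module K U" and c: "c \<in> carrier C"
    and F1: "\<And>v w. v \<in> carrier C \<Longrightarrow> w \<in> carrier H \<Longrightarrow> linear_map K C U (\<lambda>u. F u v w)"
    and F2: "\<And>u w. u \<in> carrier C \<Longrightarrow> w \<in> carrier H \<Longrightarrow> linear_map K C U (\<lambda>v. F u v w)"
    and F3: "\<And>u v. u \<in> carrier C \<Longrightarrow> v \<in> carrier C \<Longrightarrow> linear_map K H U (\<lambda>w. F u v w)"
  shows "sw K C H U (coact c) (\<lambda>x y. sw K C C U (comult C x) (\<lambda>u v. F u v (alpha H (alpha H y)))) =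
    sw K C C U (comult C c) (\<lambda>x y. sw K C H U (coact x) (\<lambda>x0 x1. sw K C H U (coact y) (\<lambda>y0 y1.
      F x0 y0 (x1 \<otimes>\<^bsub>H\<^esub> y1))))"
proof -
  have "sw K C H (tensor K (tensor K C C) H) (coact c) (\<lambda>x y. pure K (tensor K C C) H (comult C x) (alpha H (alpha H y))) =
    sw K C C (tensor K (tensor K C C) H) (comult C c) (\<lambda>x y. sw K C H (tensor K (tensor K C C) H) (coact x) (\<lambda>x0 x1.
      sw K C H (tensor K (tensor K C C) H) (coact y) (\<lambda>y0 y1.
      pure K (tensor K C C) H (pure K C C x0 y0) (x1 \<otimes>\<^bsub>H\<^esub> y1))))"
    using comult_coact[OF c] c
    by (simp add: tensor_map_sw[of K C H] sweedler_eq_sw[of K C H] sweedler_eq_sw[of K C C] numeral_2_eq_2)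
  from arg_cong[OF this, of "\<lambda>t. sw K (tensor K C C) H U t (\<lambda>s y. sw K C C U s (\<lambda>u v. F u v y))"]
  show ?thesis using assms by (simp add: sw_sw)
qed

end

lemma pure_sw_left:
  assumes "module K V" "module K W" "module K W'" "v \<in> carrier V" "t \<in> carrier (tensor K W W')"
  shows "pure K (tensor K W W') V t v =
    sw K W W' (tensor K (tensor K W W') V) t (\<lambda>x y. pure K (tensor K W W') V (pure K W W' x y) v)"
  using sw_push[of K W W' "tensor K W W'" "tensor K (tensor K W W') V"
      "\<lambda>s. pure K (tensor K W W') V s v" t "\<lambda>x y. pure K W W' x y"]
    assms by (simp add: sw_pure_id)

text \<open>The structure map, replaced by the identity in \<open>untwist H\<close>, survives as an
  endomorphism of the ordinary Hopf algebra and so remains available for twisting back.\<close>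

lemma (in hom_hopf_bij) untwist_endo: "hom_hopf_endomorphism K (untwist H) (alpha H)"
proof -
  interpret U: hom_hopf_algebra K "untwist H" by (rule untwist_hopf)
  show ?thesis
  proof (unfold_locales, unfold untwist_conv untwist_simps)
    fix x assume [simp]: "x \<in> carrier H"
    show "comult H (ainv H (alpha H x)) =
        sw K H H (tensor K H H) (comult H (ainv H x)) (\<lambda>x y. pure K H H (alpha H x) (alpha H y))"
      using sw_alpha[of "tensor K H H" "ainv H x" "\<lambda>x y. pure K H H x y"] by (simp add: sw_pure_id)
    fix y assume [simp]: "y \<in> carrier H"
    show "alpha H (ainv H (x \<otimes>\<^bsub>H\<^esub> y)) = ainv H (alpha H x \<otimes>\<^bsub>H\<^esub> alpha H y)"
      by (simp add: ainv.endo_mult alpha_mult)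
  qed (simp_all add: alpha_linear alpha_one counit_alpha antipode_alpha)
qed

section \<open>The Hom-bicrossproduct\<close>

locale bicross_data =
  A: hom_hopf_bij K A + H: hom_hopf_bij K H +
  M: left_module_hom_algebra K H A act + C: right_comodule_hom_coalgebra K A H coact
  for K :: "('k, 'r) ring_scheme" and A :: "('k, 'a, 'm) hom_hopf_scheme"
    and H :: "('k, 'h, 'n) hom_hopf_scheme"
    and act :: "'h \<Rightarrow> 'a \<Rightarrow> 'a" and coact :: "'h \<Rightarrow> ('h \<times> 'a \<Rightarrow> 'k) set" +
  assumes comult_act: "\<lbrakk>h \<in> carrier H; b \<in> carrier A\<rbrakk> \<Longrightarrow> comult A (act h b) =
      sw K H H (tensor K A A) (comult H h) (\<lambda>h1 h2. sw K H A (tensor K A A) (coact h1) (\<lambda>h10 h11.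
        sw K A A (tensor K A A) (comult A b) (\<lambda>b1 b2.
          pure K A A (act (ainv H h10) b1) (ainv A h11 \<otimes>\<^bsub>A\<^esub> act (ainv H h2) (ainv A b2)))))"
    and counit_act: "\<lbrakk>h \<in> carrier H; b \<in> carrier A\<rbrakk> \<Longrightarrow>
      counit A (act h b) = counit A b \<otimes>\<^bsub>K\<^esub> counit H h"
    and coact_mult: "\<lbrakk>h \<in> carrier H; g \<in> carrier H\<rbrakk> \<Longrightarrow> coact (h \<otimes>\<^bsub>H\<^esub> g) =
      sw K H H (tensor K H A) (comult H h) (\<lambda>h1 h2. sw K H A (tensor K H A) (coact h1) (\<lambda>h10 h11.
        sw K H A (tensor K H A) (coact g) (\<lambda>g0 g1.
          pure K H A (ainv H h10 \<otimes>\<^bsub>H\<^esub> g0) (ainv A h11 \<otimes>\<^bsub>A\<^esub> act (ainv H h2) (ainv A g1)))))"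
    and act_coact: "\<lbrakk>h \<in> carrier H; b \<in> carrier A\<rbrakk> \<Longrightarrow>
      sw K H H (tensor K H A) (comult H h) (\<lambda>h1 h2. sw K H A (tensor K H A) (coact h2) (\<lambda>h20 h21.
        pure K H A h20 (act h1 b \<otimes>\<^bsub>A\<^esub> h21))) =
      sw K H H (tensor K H A) (comult H h) (\<lambda>h1 h2. sw K H A (tensor K H A) (coact h1) (\<lambda>h10 h11.
        pure K H A h10 (h11 \<otimes>\<^bsub>A\<^esub> act h2 b)))"
begin

abbreviation act' where "act' h a \<equiv> ainv A (act h a)"
abbreviation coact' where "coact' h \<equiv> coact (ainv H h)"

lemma act_ainv: "\<lbrakk>h \<in> carrier H; a \<in> carrier A\<rbrakk> \<Longrightarrow> ainv A (act h a) = act (ainv H h) (ainv A a)"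
  by (rule A.ainv_eqI) (simp_all add: M.alpha_act)

lemma sw_coact_ainv:
  assumes "module K U" "h \<in> carrier H"
    and "\<And>v. v \<in> carrier H \<Longrightarrow> linear_map K A U (F v)"
    and "\<And>w. w \<in> carrier A \<Longrightarrow> linear_map K H U (\<lambda>v. F v w)"
  shows "sw K H A U (coact (ainv H h)) F = sw K H A U (coact h) (\<lambda>x y. F (ainv H x) (ainv A y))"
  using C.sw_coact_alpha[of U "ainv H h" "\<lambda>x y. F (ainv H x) (ainv A y)"] assms
  by (simp add: linear_map_comp[OF _ assms(3)] linear_map_comp[OF _ assms(4)])

text \<open>Drives every inverse structure map down to the leaves. A Hom-axiom and its untwisted
  form can then differ in exponents only, and these are adjusted through the arguments at which the
  axiom is used.\<close>

lemmas ainv_norm = act_ainv A.ainv.endo_mult H.ainv.endo_mult A.ainv.sw_endo H.ainv.sw_endo sw_coact_ainv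

lemmas alpha_norm = M.alpha_act A.alpha_mult H.alpha_mult A.sw_alpha H.sw_alpha C.sw_coact_alpha

text \<open>Each condition is a Hom-axiom evaluated at inverse powers. For instance, two nested uses
  of \<open>act'\<close> put exponent -1 on \<open>h\<close> and -2 on \<open>g\<close> and
  \<open>a\<close>, which \<open>act_assoc\<close> yields when all three arguments carry exponent
  -2.\<close>

lemma matched: "matched_hopf_pair K (untwist A) (untwist H) act' coact'"
proof -
  interpret A': hom_hopf_algebra K "untwist A" by (rule A.untwist_hopf)
  interpret H': hom_hopf_algebra K "untwist H" by (rule H.untwist_hopf)
  show ?thesis
  proof (unfold_locales, unfold untwist_conv untwist_simps)
    show "linear_map K H (tensor K H A) coact'" by simp
    fix h assume [simp]: "h \<in> carrier H"
    show "linear_map K A A (act' h)" by simp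
    show "act' h \<one>\<^bsub>A\<^esub> = counit H h \<odot>\<^bsub>A\<^esub> \<one>\<^bsub>A\<^esub>"
      by (simp add: M.act_one linear_map_smult[OF A.ainv_linear] A.ainv.endo_one)
    show "sw K H A H (coact' h) (\<lambda>x y. counit A y \<odot>\<^bsub>H\<^esub> x) = h"
      using C.coact_counit[of "ainv H h"] by (simp add: sweedler_eq_sw[of K H A])
    show "sw K H A (tensor K H (tensor K A A)) (coact' h) (\<lambda>x z.
        sw K H A (tensor K H (tensor K A A)) (coact' x) (\<lambda>u v. pure K H (tensor K A A) u (pure K A A v z))) =
      sw K H A (tensor K H (tensor K A A)) (coact' h) (\<lambda>x y. pure K H (tensor K A A) x (comult A (ainv A y)))"
      using C.sw_coact_coassoc[of "tensor K H (tensor K A A)" "ainv H h"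
          "\<lambda>u v w. pure K H (tensor K A A) (ainv H u) (pure K A A (ainv A v) (ainv A w))"]
      by (simp add: pure_sw_right[of K H A A _ "comult A _"] ainv_norm)
    show "sw K H A A (coact' h) (\<lambda>x y. counit H x \<odot>\<^bsub>A\<^esub> y) = counit H h \<odot>\<^bsub>A\<^esub> \<one>\<^bsub>A\<^esub>"
      using C.counit_coact[of "ainv H h"] by (simp add: sweedler_eq_sw[of K H A] H.ainv.endo_counit)
    show "sw K H A (tensor K (tensor K H H) A) (coact' h) (\<lambda>x y. pure K (tensor K H H) A (comult H (ainv H x)) y) =
      sw K H H (tensor K (tensor K H H) A) (comult H (ainv H h)) (\<lambda>x y.
        sw K H A (tensor K (tensor K H H) A) (coact' x) (\<lambda>x0 x1.
          sw K H A (tensor K (tensor K H H) A) (coact' y) (\<lambda>y0 y1.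
            pure K (tensor K H H) A (pure K H H x0 y0) (ainv A (x1 \<otimes>\<^bsub>A\<^esub> y1)))))"
      using C.sw_comult_coact[of "tensor K (tensor K H H) A" "ainv H h"
          "\<lambda>u v w. pure K (tensor K H H) A (pure K H H (ainv H u) (ainv H v)) (ainv A (ainv A w))"]
      by (simp add: pure_sw_left[of K A H H _ "comult H _"] ainv_norm)
    {
      fix g assume [simp]: "g \<in> carrier H"
      show "coact' (ainv H (h \<otimes>\<^bsub>H\<^esub> g)) =
        sw K H H (tensor K H A) (comult H (ainv H h)) (\<lambda>h1 h2. sw K H A (tensor K H A) (coact' h1) (\<lambda>h10 h11.
          sw K H A (tensor K H A) (coact' g) (\<lambda>g0 g1.
            pure K H A (ainv H (h10 \<otimes>\<^bsub>H\<^esub> g0)) (ainv A (h11 \<otimes>\<^bsub>A\<^esub> act' h2 g1)))))"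
        using coact_mult[of "ainv H (ainv H h)" "ainv H (ainv H g)"] by (simp add: ainv_norm)
      fix a assume [simp]: "a \<in> carrier A"
      show "act' h (act' g a) = act' (ainv H (h \<otimes>\<^bsub>H\<^esub> g)) a"
        using M.act_assoc[of "ainv H (ainv H h)" "ainv H (ainv H g)" "ainv A (ainv A a)"]
        by (simp add: ainv_norm)
    }
    fix b assume [simp]: "b \<in> carrier A"
    show "comult A (ainv A (act' h b)) =
      sw K H H (tensor K A A) (comult H (ainv H h)) (\<lambda>h1 h2. sw K H A (tensor K A A) (coact' h1) (\<lambda>h10 h11.
        sw K A A (tensor K A A) (comult A (ainv A b)) (\<lambda>b1 b2.
          pure K A A (act' h10 b1) (ainv A (h11 \<otimes>\<^bsub>A\<^esub> act' h2 b2)))))"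
      using comult_act[of "ainv H (ainv H h)" "ainv A (ainv A b)"] by (simp add: ainv_norm)
    show "counit A (act' h b) = counit A b \<otimes>\<^bsub>K\<^esub> counit H h"
      by (simp add: A.ainv.endo_counit counit_act)
    show "sw K H H (tensor K H A) (comult H (ainv H h)) (\<lambda>h1 h2. sw K H A (tensor K H A) (coact' h2) (\<lambda>h20 h21.
        pure K H A h20 (ainv A (act' h1 b \<otimes>\<^bsub>A\<^esub> h21)))) =
      sw K H H (tensor K H A) (comult H (ainv H h)) (\<lambda>h1 h2. sw K H A (tensor K H A) (coact' h1) (\<lambda>h10 h11.
        pure K H A h10 (ainv A (h11 \<otimes>\<^bsub>A\<^esub> act' h2 b))))"
      \<comment> \<open>Collecting exponents, the leg in \<open>H\<close> carries -2. The leg in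
        \<open>A\<close> carries -3 as a whole, which leaves \<open>alpha A b\<close> inside because
        \<open>b\<close> itself has exponent -2 there.\<close>
      using arg_cong[OF act_coact[of h "alpha A b"],
          of "\<lambda>t. sw K H A (tensor K H A) t (\<lambda>u w. pure K H A (ainv H (ainv H u)) (ainv A (ainv A (ainv A w))))"]
      by (simp add: ainv_norm sw_sw)
    fix a assume [simp]: "a \<in> carrier A"
    show "act' h (ainv A (a \<otimes>\<^bsub>A\<^esub> b)) = sw K H H A (comult H (ainv H h)) (\<lambda>h1 h2. ainv A (act' h1 a \<otimes>\<^bsub>A\<^esub> act' h2 b))"
      \<comment> \<open>The axiom applies the square of the structure map to its first argument, so
        exponent -3 there leaves the -1 that \<open>act'\<close> of a product shows after
        normalisation.\<close>
      using M.act_mult[of "ainv H (ainv H (ainv H h))" "ainv A (ainv A a)" "ainv A (ainv A b)"]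
      by (simp add: ainv_norm numeral_2_eq_2 sweedler_eq_sw[of K H H])
  next
    fix a assume [simp]: "a \<in> carrier A"
    show "linear_map K H A (\<lambda>h. act' h a)" by simp
    show "act' \<one>\<^bsub>H\<^esub> a = a" by (simp add: M.one_act)
  qed simp_all
qed

lemma untwist_endo: "hom_hopf_endomorphism K (untwist A) (alpha A)" "hom_hopf_endomorphism K (untwist H) (alpha H)"
  by (rule A.untwist_endo H.untwist_endo)+

sublocale U: matched_hopf_pair_endo K "untwist A" "untwist H" act' coact' "alpha A" "alpha H"
proof -
  interpret matched_hopf_pair K "untwist A" "untwist H" act' coact' by (rule matched)
  interpret A': hom_hopf_endomorphism K "untwist A" "alpha A" by (rule untwist_endo)
  interpret H': hom_hopf_endomorphism K "untwist H" "alpha H" by (rule untwist_endo)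
  show "matched_hopf_pair_endo K (untwist A) (untwist H) act' coact' (alpha A) (alpha H)"
  proof (unfold_locales, unfold untwist_conv untwist_simps)
    fix h assume [simp]: "h \<in> carrier H"
    show "coact' (alpha H h) = sw K H A (tensor K H A) (coact' h) (\<lambda>x y. pure K H A (alpha H x) (alpha A y))"
      using C.sw_coact_alpha[of "tensor K H A" "ainv H h" "\<lambda>x y. pure K H A x y"] by (simp add: sw_pure_id)
    fix a assume [simp]: "a \<in> carrier A"
    show "alpha A (act' h a) = act' (alpha H h) (alpha A a)"
      by (simp add: act_ainv M.alpha_act)
  qed
qed

section \<open>Identification with the twisted bicrossproduct\<close>

lemmas sweedler_U = sweedler_eq_sw[of K A H] sweedler_eq_sw[of K A A] sweedler_eq_sw[of K H H] sweedler_eq_sw[of K H A]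

lemma bendo_eq: "U.bendo t = sw K A H (tensor K A H) t (\<lambda>a h. pure K A H (alpha A a) (alpha H h))"
  by (simp add: U.bendo_def)

text \<open>On \<open>h1\<close> the coproduct, the action and the product of the untwisted
  structure contribute exponent -1 each, and \<open>bendo\<close> takes one back: this is the -2 of
  the formula. The same count gives -1 on \<open>b\<close> and on \<open>h2\<close>.\<close>

lemma mult_eq:
  assumes "s \<in> carrier (tensor K A H)" "t \<in> carrier (tensor K A H)"
  shows "bicross_mult K A H act s t = U.bendo (U.bmult s t)"
  using assms
  by (simp add: bicross_mult_def U.bmult_def bendo_eq sweedler_U sw_sw ainv_norm alpha_norm numeral_2_eq_2)

text \<open>Applied beforehand, \<open>bendo\<close> cancels the inverses in both untwisted
  coproducts. What remains is -1 from the coaction and -1 from the product in \<open>A\<close>,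
  which meet in the -2 on \<open>h11\<close>.\<close>

lemma comult_eq:
  assumes "t \<in> carrier (tensor K A H)"
  shows "bicross_comult K A H coact t = U.bcomult (U.bendo t)"
  using assms
  by (simp add: bicross_comult_def U.bcomult_def bendo_eq sweedler_U sw_sw ainv_norm alpha_norm numeral_2_eq_2 Let_def)

text \<open>The antipode is not twisted. Its formula multiplies with \<open>bicross_mult\<close>,
  which contains one \<open>bendo\<close>; the exponents -2 and -3 absorb it, since the untwisted
  formula has -1 on \<open>h0\<close> and \<open>a\<close> and -2 on \<open>h1\<close>.\<close>

lemma antipode_eq:
  assumes "t \<in> carrier (tensor K A H)"
  shows "bicross_antipode K A H act coact t = U.bantipode t"
  using assms
  unfolding bicross_antipode_def U.bantipode_def U.bmult_def untwist_conv untwist_simps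
  by (simp add: sweedler_U mult_eq U.bmult_def bendo_eq sw_sw ainv_norm alpha_norm
    numeral_2_eq_2 numeral_3_eq_3 A.ainv.endo_antipode[symmetric] H.ainv.endo_antipode A.antipode_alpha[symmetric] H.antipode_alpha
    A.ainv.endo_one H.ainv.endo_one A.alpha_one H.alpha_one)

theorem hopf_bicross_product: "hom_hopf_algebra K (bicross_product K A H act coact)"
proof (rule hom_hopf_endomorphism.twist[OF U.endo_bproduct])
  show "same_space U.bproduct (bicross_product K A H act coact)"
    by (simp add: same_space_def bicross_product_def)
  show "\<one>\<^bsub>bicross_product K A H act coact\<^esub> = \<one>\<^bsub>U.bproduct\<^esub>"
    by (simp add: bicross_product_def)
  fix s assume "s \<in> carrier U.bproduct"
  then have s: "s \<in> carrier (tensor K A H)" by simp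
  show "alpha (bicross_product K A H act coact) s = U.bendo (alpha U.bproduct s)"
    using s by (simp add: bicross_product_def tensor_map_sw[of K A H] bendo_eq)
  show "comult (bicross_product K A H act coact) s = comult U.bproduct (U.bendo s)"
    using s by (simp add: bicross_product_def comult_eq)
  show "counit (bicross_product K A H act coact) s = counit U.bproduct s"
    using s by (simp add: bicross_product_def U.bcounit_def sweedler_U)
  show "antipode (bicross_product K A H act coact) s = antipode U.bproduct s"
    using s by (simp add: bicross_product_def antipode_eq)
  fix t assume "t \<in> carrier U.bproduct"
  then show "s \<otimes>\<^bsub>bicross_product K A H act coact\<^esub> t = U.bendo (s \<otimes>\<^bsub>U.bproduct\<^esub> t)"
    using s by (simp add: bicross_product_def mult_eq)
qed

end

theorem theorem2p6:
  fixes K :: "'k ring"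
    and A :: "('k, 'a) hom_hopf"
    and H :: "('k, 'h) hom_hopf"
    and act :: "'h \<Rightarrow> 'a \<Rightarrow> 'a"
    and coact :: "'h \<Rightarrow> ('h \<times> 'a \<Rightarrow> 'k) set"
  assumes "field K"
    and "hom_hopf_algebra K A"
    and "hom_hopf_algebra K H"
    and "bij_betw (alpha A) (carrier A) (carrier A)"
    and "bij_betw (alpha H) (carrier H) (carrier H)"
    and "left_module_hom_algebra K H A act"
    and "right_comodule_hom_coalgebra K A H coact"
    and comult_act: "\<And>h b. \<lbrakk>h \<in> carrier H; b \<in> carrier A\<rbrakk> \<Longrightarrow>
          comult A (act h b) =
          sweedler K (tensor K A A) (comult H h) (\<lambda>h1 h2.
            sweedler K (tensor K A A) (coact h1) (\<lambda>h10 h11.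
              sweedler K (tensor K A A) (comult A b) (\<lambda>b1 b2.
                pure K A A
                  (act (ainv H h10) b1)
                  (ainv A h11 \<otimes>\<^bsub>A\<^esub> act (ainv H h2) (ainv A b2)))))"
    and counit_act: "\<And>h b. \<lbrakk>h \<in> carrier H; b \<in> carrier A\<rbrakk> \<Longrightarrow>
          counit A (act h b) = counit A b \<otimes>\<^bsub>K\<^esub> counit H h"
    and coact_mult: "\<And>h g. \<lbrakk>h \<in> carrier H; g \<in> carrier H\<rbrakk> \<Longrightarrow>
          coact (h \<otimes>\<^bsub>H\<^esub> g) =
          sweedler K (tensor K H A) (comult H h) (\<lambda>h1 h2.
            sweedler K (tensor K H A) (coact h1) (\<lambda>h10 h11.
              sweedler K (tensor K H A) (coact g) (\<lambda>g0 g1.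
                pure K H A
                  (ainv H h10 \<otimes>\<^bsub>H\<^esub> g0)
                  (ainv A h11 \<otimes>\<^bsub>A\<^esub> act (ainv H h2) (ainv A g1)))))"
    and act_coact: "\<And>h b. \<lbrakk>h \<in> carrier H; b \<in> carrier A\<rbrakk> \<Longrightarrow>
          sweedler K (tensor K H A) (comult H h) (\<lambda>h1 h2.
            sweedler K (tensor K H A) (coact h2) (\<lambda>h20 h21.
              pure K H A h20 (act h1 b \<otimes>\<^bsub>A\<^esub> h21))) =
          sweedler K (tensor K H A) (comult H h) (\<lambda>h1 h2.
            sweedler K (tensor K H A) (coact h1) (\<lambda>h10 h11.
              pure K H A h10 (h11 \<otimes>\<^bsub>A\<^esub> act h2 b)))"
  shows "hom_hopf_algebra K (bicross_product K A H act coact)"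
proof -
  interpret A: hom_hopf_algebra K A by fact
  interpret H: hom_hopf_algebra K H by fact
  interpret M: left_module_hom_algebra K H A act by fact
  interpret C: right_comodule_hom_coalgebra K A H coact by fact
  \<comment> \<open>All tensors in the hypotheses lie in the right carriers, so the compatibility
    conditions pass from \<open>sweedler\<close> to \<open>sw\<close> by rewriting.\<close>
  note sw = sweedler_eq_sw[of K A A] sweedler_eq_sw[of K H H] sweedler_eq_sw[of K H A]
  interpret bicross_data K A H act coact
  proof unfold_locales
    show "bij_betw (alpha A) (carrier A) (carrier A)" "bij_betw (alpha H) (carrier H) (carrier H)" by fact+
    fix h b assume [simp]: "h \<in> carrier H" "b \<in> carrier A"
    show "counit A (act h b) = counit A b \<otimes>\<^bsub>K\<^esub> counit H h" by (rule counit_act) simp_all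
    show "comult A (act h b) =
      sw K H H (tensor K A A) (comult H h) (\<lambda>h1 h2. sw K H A (tensor K A A) (coact h1) (\<lambda>h10 h11.
        sw K A A (tensor K A A) (comult A b) (\<lambda>b1 b2.
          pure K A A (act (ainv H h10) b1) (ainv A h11 \<otimes>\<^bsub>A\<^esub> act (ainv H h2) (ainv A b2)))))"
      using comult_act[of h b] by (simp add: sw)
    show "sw K H H (tensor K H A) (comult H h) (\<lambda>h1 h2. sw K H A (tensor K H A) (coact h2) (\<lambda>h20 h21.
        pure K H A h20 (act h1 b \<otimes>\<^bsub>A\<^esub> h21))) =
      sw K H H (tensor K H A) (comult H h) (\<lambda>h1 h2. sw K H A (tensor K H A) (coact h1) (\<lambda>h10 h11.
        pure K H A h10 (h11 \<otimes>\<^bsub>A\<^esub> act h2 b)))"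
      using act_coact[of h b] by (simp add: sw)
  next
    fix h g assume [simp]: "h \<in> carrier H" "g \<in> carrier H"
    show "coact (h \<otimes>\<^bsub>H\<^esub> g) =
      sw K H H (tensor K H A) (comult H h) (\<lambda>h1 h2. sw K H A (tensor K H A) (coact h1) (\<lambda>h10 h11.
        sw K H A (tensor K H A) (coact g) (\<lambda>g0 g1.
          pure K H A (ainv H h10 \<otimes>\<^bsub>H\<^esub> g0) (ainv A h11 \<otimes>\<^bsub>A\<^esub> act (ainv H h2) (ainv A g1)))))"
      using coact_mult[of h g] by (simp add: sw)
  qed
  show ?thesis by (rule hopf_bicross_product)
qed

end
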